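(* Let $\Omega\subset\mathbb{C}$ be an infinitely connected domain, and let $\omega:\Omega\to\mathbb{C}$ and $\psi:\Omega\to\Omega$ be holomorphic. The following are equivalent: (1) $C_{\omega,\psi}$ is supercyclic on $H(\Omega)$. (2) $C_{\omega,\psi}$ is mixing on $H(\Omega)$. (3) The multiplier $\omega$ is zero-free and the symbol $\psi$ is univalent, $\Omega$-convex and strongly run-away.
   Context: A hole of a domain $\Omega\subseteq\mathbb{C}$ (respectively, of a compact set $K\subset\mathbb{C}$) is a bounded connected component of $\mathbb{C}\setminus\Omega$ (respectively, of $\mathbb{C}\setminus K$). $\Omega$ is infinitely connected if it has infinitely many holes. A compact subset $K$ of $\Omega$ is $\Omega$-convex if each hole of $K$ contains a point of $\mathbb{C}\setminus\Omega$. A holomorphic map $\psi:\Omega\to\Omega$ is $\Omega$-convex if $\psi(K)$ is $\Omega$-convex for each $\Omega$-convex compact subset $K$ of $\Omega$. $\psi$ is strongly run-away if for each compact subset $K$ of $\Omega$, $\psi_n(K)\cap K=\emptyset$ for all large $n\in\mathbb{N}$, where $\psi_n$ is the $n$-fold composition of $\psi$ with itself. Univalent means holomorphic and injective. $H(\Omega)$ is the space of holomorphic functions on $\Omega$ with the compact-open topology. The weighted composition operator $C_{\omega,\psi}:H(\Omega)\to H(\Omega)$ is $C_{\omega,\psi}(f)(z)=\omega(z)\,f(\psi(z))$; $\omega$ is its multiplier and $\psi$ its symbol. An operator (continuous linear self-map) $T$ on a topological vector space $X$ is supercyclic if for some $f\in X$ the set $\{\lambda T^nf:\lambda\in\mathbb{C},\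 n=0,1,\dots\}$ is dense in $X$; it is mixing if for each pair of non-empty open $U,V\subseteq X$ there is an integer $n$ so that $T^k(U)\cap V\neq\emptyset$ for each $k\ge n$. *)

theory Defs
  imports "HOL-Complex_Analysis.Complex_Analysis"
begin

definition holes :: "complex set \<Rightarrow> complex set set" where
  "holes A = {C \<in> components (- A). bounded C}"

definition infinitely_connected :: "complex set \<Rightarrow> bool" where
  "infinitely_connected \<Omega> \<longleftrightarrow> infinite (holes \<Omega>)"

definition convex_compact_in :: "complex set \<Rightarrow> complex set \<Rightarrow> bool" where
  "convex_compact_in \<Omega> K \<longleftrightarrow>
     compact K \<and> K \<subseteq> \<Omega> \<and> (\<forall>C \<in> holes K. \<exists>z \<in> C. z \<notin> \<Omega>)"

definition convex_map_on :: "complex set \<Rightarrow> (complex \<Rightarrow> complex) \<Rightarrow> bool" where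
  "convex_map_on \<Omega> \<psi> \<longleftrightarrow>
     (\<forall>K. convex_compact_in \<Omega> K \<longrightarrow> convex_compact_in \<Omega> (\<psi> ` K))"

definition strongly_run_away_on :: "complex set \<Rightarrow> (complex \<Rightarrow> complex) \<Rightarrow> bool" where
  "strongly_run_away_on \<Omega> \<psi> \<longleftrightarrow>
     (\<forall>K. compact K \<and> K \<subseteq> \<Omega> \<longrightarrow>
        (\<forall>\<^sub>F n in sequentially. (\<psi> ^^ n) ` K \<inter> K = {}))"

definition univalent_on :: "complex set \<Rightarrow> (complex \<Rightarrow> complex) \<Rightarrow> bool" where
  "univalent_on \<Omega> \<psi> \<longleftrightarrow> \<psi> holomorphic_on \<Omega> \<and> inj_on \<psi> \<Omega>"

text \<open>Functions are total in HOL. A holomorphic function on \<open>\<Omega>\<close> is represented by its unique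
  extension by zero, so that equality of elements is equality on \<open>\<Omega>\<close> and the space is closed
  under the pointwise linear operations.\<close>

definition holo_funs :: "complex set \<Rightarrow> (complex \<Rightarrow> complex) set" where
  "holo_funs \<Omega> = {f. f holomorphic_on \<Omega> \<and> (\<forall>z. z \<notin> \<Omega> \<longrightarrow> f z = 0)}"

definition compact_open_topology :: "complex set \<Rightarrow> (complex \<Rightarrow> complex) topology" where
  "compact_open_topology \<Omega> = topology_generated_by
     {{f. f ` K \<subseteq> U} | K U. compact K \<and> K \<subseteq> \<Omega> \<and> open U}"

definition holo_space :: "complex set \<Rightarrow> (complex \<Rightarrow> complex) topology" where
  "holo_space \<Omega> = subtopology (compact_open_topology \<Omega>) (holo_funs \<Omega>)"

definition weighted_comp ::
  "complex set \<Rightarrow> (complex \<Rightarrow> complex) \<Rightarrow> (complex \<Rightarrow> complex) \<Rightarrow> (complex \<Rightarrow> complex) \<Rightarrow> complex \<Rightarrow> complex"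
  where "weighted_comp \<Omega> \<omega> \<psi> f = (\<lambda>z. if z \<in> \<Omega> then \<omega> z * f (\<psi> z) else 0)"

definition supercyclic_on ::
  "('a \<Rightarrow> complex) topology \<Rightarrow> (('a \<Rightarrow> complex) \<Rightarrow> 'a \<Rightarrow> complex) \<Rightarrow> bool" where
  "supercyclic_on X T \<longleftrightarrow>
     (\<exists>f \<in> topspace X. X closure_of {(\<lambda>z. c * (T ^^ n) f z) | c n. True} = topspace X)"

definition mixing_on :: "'a topology \<Rightarrow> ('a \<Rightarrow> 'a) \<Rightarrow> bool" where
  "mixing_on X T \<longleftrightarrow>
     (\<forall>U V. openin X U \<and> U \<noteq> {} \<and> openin X V \<and> V \<noteq> {} \<longrightarrow>
        (\<exists>n. \<forall>k \<ge> n. (T ^^ k) ` U \<inter> V \<noteq> {}))"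

lemma topspace_holo_space: "topspace (holo_space \<Omega>) = holo_funs \<Omega>"
proof -
  have "topspace (compact_open_topology \<Omega>) = UNIV"
    unfolding compact_open_topology_def topology_generated_by_topspace by blast
  then show ?thesis by (simp add: holo_space_def)
qed

lemma weighted_comp_in_holo_funs:
  assumes "\<omega> holomorphic_on \<Omega>" "\<psi> holomorphic_on \<Omega>" "\<psi> \<in> \<Omega> \<rightarrow> \<Omega>" "f \<in> holo_funs \<Omega>"
  shows "weighted_comp \<Omega> \<omega> \<psi> f \<in> holo_funs \<Omega>"
proof -
  have "(f \<circ> \<psi>) holomorphic_on \<Omega>"
    by (rule holomorphic_on_compose_gen[of _ _ _ \<Omega>]) (use assms in \<open>auto simp: holo_funs_def\<close>)
  then have "(\<lambda>z. \<omega> z * f (\<psi> z)) holomorphic_on \<Omega>"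
    using assms(1) by (auto simp: o_def intro: holomorphic_on_mult)
  then have "weighted_comp \<Omega> \<omega> \<psi> f holomorphic_on \<Omega>"
    by (rule holomorphic_transform) (simp add: weighted_comp_def)
  then show ?thesis by (simp add: holo_funs_def weighted_comp_def)
qed

end

theory Submission
  imports Defs
begin

text \<open>
  Write \<open>T\<close> for the weighted composition operator and \<open>\<psi>\<^sub>n\<close> for the iterates of \<open>\<psi>\<close>. Then \<open>T\<^sup>n f = \<omega>\<^sub>n \<cdot> (f \<circ> \<psi>\<^sub>n)\<close>,
  where \<open>\<omega>\<^sub>n\<close> is the product of \<open>\<omega> \<circ> \<psi>\<^sub>j\<close> over \<open>j < n\<close>, and both dynamical conditions say that certain
  functions can be approximated uniformly on compact subsets of \<open>\<Omega>\<close>. The proof closes the cycle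
  mixing \<open>\<Longrightarrow>\<close> supercyclic \<open>\<Longrightarrow>\<close> geometric conditions \<open>\<Longrightarrow>\<close> mixing.

  \<^item> Mixing implies supercyclic by Birkhoff's transitivity argument: \<open>H(\<Omega>)\<close> is separable and complete, so
  nested balls produce a single function whose orbit comes close to everything
  (\<open>birkhoff_transitivity\<close>).

  \<^item> A supercyclic operator has dense range, because the finitely many lines spanned by the first terms of
  an orbit can be discarded without losing density (\<open>supercyclic_vector_tail\<close>). Dense range alone makes
  \<open>\<omega>\<close> zero-free and \<open>\<psi>\<close> injective, since otherwise the values of every function in the range satisfy
  a linear relation. It also makes \<open>\<psi>\<close> convex relative to \<open>\<Omega>\<close>: if a hole of \<open>\<psi>(K)\<close> were
  contained in \<open>\<Omega>\<close>, the maximum principle would extend the inverse of \<open>\<psi>\<close> holomorphically across that hole,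
  and the extension would map it onto a hole of \<open>K\<close> inside \<open>\<Omega>\<close> (\<open>dense_range_convex\<close>).

  \<^item> Supercyclicity forces the iterates to run away. The domain omits two points, so by Schottky and Montel
  every sequence of self-maps that does not escape has a locally uniform limit. If \<open>\<psi>\<close> did not run away, some
  subsequence of \<open>\<psi>\<^sub>n\<close> would converge to a self-map \<open>g\<close> of \<open>\<Omega>\<close>. A constant \<open>g\<close> yields an attracting
  fixed point \<open>c\<close>, where the quotients \<open>(T\<^sup>n f)'(c) / (T\<^sup>n f)(c)\<close> stay bounded, which contradicts density
  (\<open>attracting_fixed_point_not_supercyclic\<close>). A nonconstant \<open>g\<close> yields iterates converging to the identity; then every
  orbit stays in a compact set. By Hurwitz' theorem a supercyclic \<open>f\<close> has a zero \<open>p\<close>, and then every \<open>T\<^sup>n f\<close>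
  has a zero in one and the same compact set, so that no multiple comes close to the constant 1
  (\<open>recurrent_not_supercyclic\<close>).

  \<^item> For the way back, let \<open>E\<close> be a compact set on which two functions are to be matched, one by \<open>f\<close> and the other
  by \<open>T\<^sup>n f\<close>. This prescribes \<open>f\<close> on \<open>E\<close> and on \<open>\<psi>\<^sub>n(E)\<close>, which are disjoint for large \<open>n\<close>, and Runge's
  theorem (\<open>runge_approximation\<close>) supplies \<open>f\<close> as soon as \<open>E \<union> \<psi>\<^sub>n(E)\<close> has no hole inside \<open>\<Omega>\<close>. Both pieces
  have this property, but the region between them could be such a hole if one piece surrounds the other. The
  holes of \<open>\<Omega>\<close> prevent this: \<open>E\<close> is chosen connected and with two holes, hence so is \<open>\<psi>\<^sub>n(E)\<close>
  (\<open>two_holes_preserved\<close>), so that the surrounding and the surrounded set leave room for a point outside \<open>\<Omega>\<close> between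
  them when \<open>\<psi>\<^sub>n(E)\<close> also avoids a larger continuum \<open>K\<close> that separates holes of \<open>\<Omega>\<close> from each other
  (\<open>convex_union_of_distant_continua\<close>).
\<close>

section \<open>The compact-open topology in terms of uniform approximation\<close>

text \<open>The sets that contain, with \<open>f\<close>, a whole uniform ball around \<open>f\<close> on some compact set are stable under finite
intersections and arbitrary unions, and the subbasic sets are of this kind because the compact set \<open>f(K)\<close> has
positive distance from the complement of an open set containing it.\<close>

lemma holo_space_neighbourhood:
  assumes "open \<Omega>" "openin (holo_space \<Omega>) U" "f \<in> U"
  obtains K e where "compact K" "K \<subseteq> \<Omega>" "0 < e"
    "\<And>g. g \<in> holo_funs \<Omega> \<Longrightarrow> \<forall>z\<in>K. cmod (g z - f z) < e \<Longrightarrow> g \<in> U"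
proof -
  have fH: "f \<in> holo_funs \<Omega>"
    using openin_subset[OF assms(2)] assms(3) by (auto simp: topspace_holo_space)
  define good where "good V \<longleftrightarrow> (\<exists>K e. compact K \<and> K \<subseteq> \<Omega> \<and> 0 < e \<and>
      (\<forall>g. (\<forall>z\<in>K. cmod (g z - f z) < e) \<longrightarrow> g \<in> V))" for V :: "(complex \<Rightarrow> complex) set"
  have good: "f \<in> V \<longrightarrow> good V"
    if "generate_topology_on {{f. f ` K \<subseteq> U} | K U. compact K \<and> K \<subseteq> \<Omega> \<and> open U} V" for V
    using that
  proof (induction rule: generate_topology_on.induct)
    case Empty
    show ?case by simp
  next
    case (Int a b)
    show ?case
    proof
      assume f: "f \<in> a \<inter> b"
      obtain K1 e1 where 1: "compact K1" "K1 \<subseteq> \<Omega>" "0 < e1"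
          "\<And>g. \<forall>z\<in>K1. cmod (g z - f z) < e1 \<Longrightarrow> g \<in> a"
        using Int(3) f unfolding good_def by auto
      obtain K2 e2 where 2: "compact K2" "K2 \<subseteq> \<Omega>" "0 < e2"
          "\<And>g. \<forall>z\<in>K2. cmod (g z - f z) < e2 \<Longrightarrow> g \<in> b"
        using Int(4) f unfolding good_def by auto
      show "good (a \<inter> b)" unfolding good_def
        by (rule exI[of _ "K1 \<union> K2"], rule exI[of _ "min e1 e2"]) (use 1 2 in auto)
    qed
  next
    case (UN \<K>)
    show ?case
    proof
      assume "f \<in> \<Union>\<K>"
      then obtain k where k: "k \<in> \<K>" "f \<in> k" by blast
      then have "good k" using UN by simp
      then obtain K e where "compact K" "K \<subseteq> \<Omega>" "0 < e"
          "\<And>g. \<forall>z\<in>K. cmod (g z - f z) < e \<Longrightarrow> g \<in> k"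
        unfolding good_def by auto
      then show "good (\<Union>\<K>)" unfolding good_def using k(1)
        by (intro exI[of _ K] exI[of _ e]) auto
    qed
  next
    case (Basis s)
    then obtain K U where s: "s = {f. f ` K \<subseteq> U}" and K: "compact K" "K \<subseteq> \<Omega>" "open U" by auto
    show ?case
    proof
      assume f: "f \<in> s"
      have "f holomorphic_on \<Omega>" using fH by (simp add: holo_funs_def)
      then have "continuous_on K f"
        using K(2) continuous_on_subset holomorphic_on_imp_continuous_on by blast
      then have "compact (f ` K)" using K compact_continuous_image by blast
      moreover have "f ` K \<inter> - U = {}" using f s by blast
      ultimately obtain d where d: "0 < d" "\<forall>x\<in>f ` K. \<forall>y\<in>- U. d \<le> dist x y"
        using separate_compact_closed[of "f ` K" "- U"] open_closed[of U] K(3) by blast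
      show "good s" unfolding good_def
      proof (intro exI conjI allI impI)
        fix g assume g: "\<forall>z\<in>K. cmod (g z - f z) < d"
        have "g z \<in> U" if "z \<in> K" for z
        proof (rule ccontr)
          assume "g z \<notin> U"
          then have "d \<le> dist (f z) (g z)" using d(2) that by simp
          then show False using g that by (force simp: dist_norm norm_minus_commute)
        qed
        then show "g \<in> s" using s by auto
      qed (use K d in auto)
    qed
  qed
  obtain V where V: "U = V \<inter> holo_funs \<Omega>"
    "generate_topology_on {{f. f ` K \<subseteq> U} | K U. compact K \<and> K \<subseteq> \<Omega> \<and> open U} V"
    using assms(2) unfolding holo_space_def compact_open_topology_def openin_subtopology
      openin_topology_generated_by_iff by auto
  then have "good V" using good assms(3) by simp
  then obtain K e where K: "compact K" "K \<subseteq> \<Omega>" "0 < e"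
          "\<And>g. \<forall>z\<in>K. cmod (g z - f z) < e \<Longrightarrow> g \<in> V"
    unfolding good_def by auto
  show ?thesis by (rule that[OF K(1-3)]) (use K(4) V in auto)
qed

text \<open>Conversely, uniform balls are neighbourhoods: \<open>K\<close> is cut into finitely many compact pieces on which \<open>f\<close> varies by
less than \<open>e / 3\<close>, and each piece contributes one subbasic set.\<close>

lemma holo_space_ball_contains_open:
  assumes "open \<Omega>" "f \<in> holo_funs \<Omega>" "compact K" "K \<subseteq> \<Omega>" "0 < e"
  obtains U where "openin (holo_space \<Omega>) U" "f \<in> U"
    "\<And>g. g \<in> U \<Longrightarrow> \<forall>z\<in>K. cmod (g z - f z) < e"
proof -
  have cont: "continuous_on K f"
    using assms by (metis (mono_tags, lifting) continuous_on_subset holo_funs_def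
            holomorphic_on_imp_continuous_on mem_Collect_eq)
  define P where "P z = K \<inter> f -` cball (f z) (e/3)" for z
  have cP: "compact (P z)" for z
  proof -
    have "closed (P z)"
      unfolding P_def by (intro continuous_closed_preimage cont compact_imp_closed assms(3)) simp
    moreover have "P z = K \<inter> P z" by (auto simp: P_def)
    ultimately show ?thesis using assms(3) compact_Int_closed by metis
  qed
  have "\<exists>V. open V \<and> K \<inter> f -` ball (f z) (e/3) = K \<inter> V" for z
    using cont by (metis Int_commute continuous_on_open_invariant open_ball)
  then obtain V where V: "\<And>z. open (V z)" "\<And>z. K \<inter> f -` ball (f z) (e/3) = K \<inter> V z" by metis
  have "K \<subseteq> (\<Union>z\<in>K. V z)" using V(2) assms(5) by fastforce
  then obtain F where F: "F \<subseteq> K" "finite F" "K \<subseteq> (\<Union>z\<in>F. V z)"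
    using compactE_image[OF assms(3), of K V] V(1) by metis
  define U where "U = (\<Inter>z\<in>F. {g. g ` P z \<subseteq> ball (f z) (e/2)})"
  have gen: "openin (compact_open_topology \<Omega>) {g. g ` P z \<subseteq> ball (f z) (e/2)}" for z
    unfolding compact_open_topology_def
    by (rule topology_generated_by_Basis) (use cP assms(4) P_def in blast)
  have "topspace (compact_open_topology \<Omega>) = UNIV"
    unfolding compact_open_topology_def topology_generated_by_topspace by blast
  then have top: "openin (compact_open_topology \<Omega>) UNIV" by (metis openin_topspace)
  have "openin (compact_open_topology \<Omega>) U"
  proof (cases "F = {}")
    case True
    then show ?thesis using top by (simp add: U_def)
  next
    case False
    then show ?thesis unfolding U_def using F(2) gen by (intro openin_Inter) auto
  qed
  then have "openin (holo_space \<Omega>) (U \<inter> holo_funs \<Omega>)"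
    unfolding holo_space_def openin_subtopology by blast
  moreover have "f \<in> U \<inter> holo_funs \<Omega>" using assms(2,5) by (force simp: U_def P_def)
  moreover have "cmod (g z - f z) < e" if g: "g \<in> U \<inter> holo_funs \<Omega>" and z: "z \<in> K" for g z
  proof -
    obtain x where x: "x \<in> F" "z \<in> V x" using F z by blast
    then have zx: "f z \<in> ball (f x) (e/3)" using V(2)[of x] z by blast
    then have "z \<in> P x" unfolding P_def using z by auto
    then moreover have "g ` P x \<subseteq> ball (f x) (e/2)" using g x(1) unfolding U_def by blast
    ultimately have "g z \<in> ball (f x) (e/2)" by blast
    then show ?thesis using zx assms(5) dist_triangle_half_r[of "f x" "g z" e "f z"]
      by (simp add: dist_norm)
  qed
  ultimately show ?thesis using that by blast
qed

text \<open>From here on the two dynamical properties are used only in their \<open>\<epsilon>\<close>-forms.\<close>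

lemma supercyclic_on_holo_space_iff:
  assumes "open \<Omega>" and lin: "\<forall>f\<in>holo_funs \<Omega>. \<forall>c n. (\<lambda>z. c * (T ^^ n) f z) \<in> holo_funs \<Omega>"
  shows "supercyclic_on (holo_space \<Omega>) T \<longleftrightarrow>
    (\<exists>f\<in>holo_funs \<Omega>. \<forall>g\<in>holo_funs \<Omega>. \<forall>K e. compact K \<and> K \<subseteq> \<Omega> \<and> 0 < e \<longrightarrow>
        (\<exists>c n. \<forall>z\<in>K. cmod (c * (T ^^ n) f z - g z) < e))" (is "?L \<longleftrightarrow> ?R")
proof
  assume ?L
  then obtain f where f: "f \<in> holo_funs \<Omega>"
    and cl: "holo_space \<Omega> closure_of {(\<lambda>z. c * (T ^^ n) f z) | c n. True} = holo_funs \<Omega>"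
    unfolding supercyclic_on_def topspace_holo_space by blast
  have *: "\<exists>c n. \<forall>z\<in>K. cmod (c * (T ^^ n) f z - g z) < e"
    if g: "g \<in> holo_funs \<Omega>" "compact K" "K \<subseteq> \<Omega>" "0 < e" for g K e
  proof -
    obtain U where U: "openin (holo_space \<Omega>) U" "g \<in> U"
      "\<And>h. h \<in> U \<Longrightarrow> \<forall>z\<in>K. cmod (h z - g z) < e"
      using holo_space_ball_contains_open[OF assms(1) g] by metis
    have "g \<in> holo_space \<Omega> closure_of {(\<lambda>z. c * (T ^^ n) f z) | c n. True}" using cl g by simp
    then obtain h where "h \<in> {(\<lambda>z. c * (T ^^ n) f z) | c n. True}" "h \<in> U"
      using U unfolding in_closure_of by blast
    then show ?thesis using U(3) by fastforce
  qed
  show ?R by (rule bexI[OF _ f]) (use * in simp)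
next
  assume ?R
  then obtain f where f: "f \<in> holo_funs \<Omega>" and
    ap: "\<forall>g\<in>holo_funs \<Omega>. \<forall>K e. compact K \<and> K \<subseteq> \<Omega> \<and> 0 < e \<longrightarrow>
        (\<exists>c n. \<forall>z\<in>K. cmod (c * (T ^^ n) f z - g z) < e)" ..
  have 1: "g \<in> holo_space \<Omega> closure_of {(\<lambda>z. c * (T ^^ n) f z) | c n. True}"
    if g: "g \<in> holo_funs \<Omega>" for g
    unfolding in_closure_of topspace_holo_space
  proof (intro conjI allI impI g)
    fix U assume U: "g \<in> U \<and> openin (holo_space \<Omega>) U"
    then obtain K e where K: "compact K" "K \<subseteq> \<Omega>" "0 < e"
        "\<And>h. h \<in> holo_funs \<Omega> \<Longrightarrow> \<forall>z\<in>K. cmod (h z - g z) < e \<Longrightarrow> h \<in> U"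
      using holo_space_neighbourhood[OF assms(1)] by metis
    obtain c n where "\<forall>z\<in>K. cmod (c * (T ^^ n) f z - g z) < e" using ap g K(1-3) by meson
    then have "(\<lambda>z. c * (T ^^ n) f z) \<in> U" using K(4) lin f by simp
    then show "\<exists>y. y \<in> {(\<lambda>z. c * (T ^^ n) f z) | c n. True} \<and> y \<in> U" by blast
  qed
  have 2: "holo_space \<Omega> closure_of {(\<lambda>z. c * (T ^^ n) f z) | c n. True} \<subseteq> holo_funs \<Omega>"
    using closure_of_subset_topspace[of "holo_space \<Omega>"] by (simp add: topspace_holo_space)
  have "holo_space \<Omega> closure_of {(\<lambda>z. c * (T ^^ n) f z) | c n. True} = holo_funs \<Omega>"
    by (rule subset_antisym[OF 2 subsetI[OF 1]])
  with f show ?L unfolding supercyclic_on_def topspace_holo_space by (intro bexI)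
qed

lemma mixing_on_holo_space_iff:
  assumes "open \<Omega>" and T: "T \<in> holo_funs \<Omega> \<rightarrow> holo_funs \<Omega>"
  shows "mixing_on (holo_space \<Omega>) T \<longleftrightarrow>
    (\<forall>g\<in>holo_funs \<Omega>. \<forall>h\<in>holo_funs \<Omega>. \<forall>K e. compact K \<and> K \<subseteq> \<Omega> \<and> 0 < e \<longrightarrow>
        (\<exists>N. \<forall>n\<ge>N. \<exists>f\<in>holo_funs \<Omega>. (\<forall>z\<in>K. cmod (f z - g z) < e) \<and>
             (\<forall>z\<in>K. cmod ((T ^^ n) f z - h z) < e)))" (is "?L \<longleftrightarrow> ?R")
proof
  assume L: ?L
  show ?R
  proof (intro ballI allI impI)
    fix g h K e assume g: "g \<in> holo_funs \<Omega>" and h: "h \<in> holo_funs \<Omega>"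
      and K: "compact K \<and> K \<subseteq> \<Omega> \<and> 0 < (e::real)"
    obtain U where U: "openin (holo_space \<Omega>) U" "g \<in> U"
      "\<And>f. f \<in> U \<Longrightarrow> \<forall>z\<in>K. cmod (f z - g z) < e"
      using holo_space_ball_contains_open[OF assms(1) g] K by metis
    obtain V where V: "openin (holo_space \<Omega>) V" "h \<in> V"
      "\<And>f. f \<in> V \<Longrightarrow> \<forall>z\<in>K. cmod (f z - h z) < e"
      using holo_space_ball_contains_open[OF assms(1) h] K by metis
    obtain N where N: "\<And>n. n \<ge> N \<Longrightarrow> (T ^^ n) ` U \<inter> V \<noteq> {}"
      using L U(1,2) V(1,2) unfolding mixing_on_def by blast
    have "U \<subseteq> holo_funs \<Omega>" using openin_subset[OF U(1)] by (simp add: topspace_holo_space)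
    then show "\<exists>N. \<forall>n\<ge>N. \<exists>f\<in>holo_funs \<Omega>. (\<forall>z\<in>K. cmod (f z - g z) < e) \<and>
             (\<forall>z\<in>K. cmod ((T ^^ n) f z - h z) < e)"
      using N U(3) V(3) by (intro exI[of _ N]) blast
  qed
next
  assume R: ?R
  have Tn: "(T ^^ n) f \<in> holo_funs \<Omega>" if "f \<in> holo_funs \<Omega>" for f n
    by (induction n) (use T that in auto)
  show ?L
    unfolding mixing_on_def
  proof (intro allI impI)
    fix U V assume A: "openin (holo_space \<Omega>) U \<and> U \<noteq> {} \<and> openin (holo_space \<Omega>) V \<and> V \<noteq> {}"
    then obtain g h where g: "g \<in> U" and h: "h \<in> V" by blast
    then have gh: "g \<in> holo_funs \<Omega>" "h \<in> holo_funs \<Omega>"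
      using A openin_subset topspace_holo_space by blast+
    obtain K e where K: "compact K" "K \<subseteq> \<Omega>" "0 < e"
        "\<And>f. f \<in> holo_funs \<Omega> \<Longrightarrow> \<forall>z\<in>K. cmod (f z - g z) < e \<Longrightarrow> f \<in> U"
      using holo_space_neighbourhood[OF assms(1)] g A by metis
    obtain L d where L: "compact L" "L \<subseteq> \<Omega>" "0 < d"
        "\<And>f. f \<in> holo_funs \<Omega> \<Longrightarrow> \<forall>z\<in>L. cmod (f z - h z) < d \<Longrightarrow> f \<in> V"
      using holo_space_neighbourhood[OF assms(1)] h A by metis
    obtain N where N: "\<And>n. n \<ge> N \<Longrightarrow> \<exists>f\<in>holo_funs \<Omega>. (\<forall>z\<in>K\<union>L. cmod (f z - g z) < min d e) \<and>
             (\<forall>z\<in>K\<union>L. cmod ((T ^^ n) f z - h z) < min d e)"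
      using R[rule_format, OF gh, of "K \<union> L" "min d e"] K L by auto
    show "\<exists>n. \<forall>k\<ge>n. (T ^^ k) ` U \<inter> V \<noteq> {}"
    proof (intro exI[of _ N] allI impI)
      fix n assume "n \<ge> N"
      from N[OF this] obtain f where f: "f \<in> holo_funs \<Omega>" "\<forall>z\<in>K\<union>L. cmod (f z - g z) < min d e"
             "\<forall>z\<in>K\<union>L. cmod ((T ^^ n) f z - h z) < min d e" by blast
      then have "f \<in> U" "(T ^^ n) f \<in> V" using K(4) L(4) Tn by auto
      then show "(T ^^ n) ` U \<inter> V \<noteq> {}" by blast
    qed
  qed
qed

section \<open>Iterates of a weighted composition operator\<close>

lemma holo_funs_cut: "f holomorphic_on \<Omega> \<Longrightarrow> (\<lambda>z. if z \<in> \<Omega> then f z else 0) \<in> holo_funs \<Omega>"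
  by (auto simp: holo_funs_def intro: holomorphic_transform)

lemma holo_funs_holomorphic: "f \<in> holo_funs \<Omega> \<Longrightarrow> f holomorphic_on \<Omega>"
  by (simp add: holo_funs_def)

lemma weighted_comp_funpow:
  assumes "\<psi> \<in> \<Omega> \<rightarrow> \<Omega>" "z \<in> \<Omega>"
  shows "(weighted_comp \<Omega> \<omega> \<psi> ^^ n) f z = (\<Prod>j<n. \<omega> ((\<psi> ^^ j) z)) * f ((\<psi> ^^ n) z)"
  using assms(2)
proof (induction n arbitrary: z)
  case (Suc n)
  then have "\<psi> z \<in> \<Omega>" using assms(1) by blast
  from Suc.IH[OF this] Suc.prems show ?case
    by (simp add: weighted_comp_def prod.lessThan_Suc_shift funpow_swap1 del: prod.lessThan_Suc)
qed simp

lemma weighted_comp_funpow_holo_funs: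
  assumes "\<omega> holomorphic_on \<Omega>" "\<psi> holomorphic_on \<Omega>" "\<psi> \<in> \<Omega> \<rightarrow> \<Omega>" "f \<in> holo_funs \<Omega>"
  shows "(weighted_comp \<Omega> \<omega> \<psi> ^^ n) f \<in> holo_funs \<Omega>"
  by (induction n) (use assms weighted_comp_in_holo_funs in auto)

lemma funpow_in: "\<psi> \<in> \<Omega> \<rightarrow> \<Omega> \<Longrightarrow> z \<in> \<Omega> \<Longrightarrow> (\<psi> ^^ n) z \<in> (\<Omega> :: 'a set)"
  by (induction n) auto

lemma funpow_holomorphic:
  assumes "\<psi> holomorphic_on \<Omega>" "\<psi> \<in> \<Omega> \<rightarrow> \<Omega>"
  shows "(\<psi> ^^ n) holomorphic_on \<Omega>"
proof (induction n)
  case 0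
  show ?case by (simp add: id_def)
next
  case (Suc n)
  then have "(\<psi> \<circ> (\<psi> ^^ n)) holomorphic_on \<Omega>"
    using assms by (intro holomorphic_on_compose_gen[of _ _ _ \<Omega>]) (auto intro: funpow_in)
  then show ?case by (simp add: o_def)
qed

lemma funpow_inj_on:
  assumes "inj_on \<psi> \<Omega>" "\<psi> \<in> \<Omega> \<rightarrow> \<Omega>"
  shows "inj_on (\<psi> ^^ n) \<Omega>"
proof (induction n)
  case (Suc n)
  have "inj_on (\<psi> \<circ> (\<psi> ^^ n)) \<Omega>"
    by (rule comp_inj_on[OF Suc]) (use assms funpow_in in \<open>force intro: inj_on_subset\<close>)
  then show ?case by (simp add: o_def)
qed simp

section \<open>Mixing implies supercyclic\<close>

lemma complex_rational_dense:
  assumes "0 < (e::real)"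
  shows "\<exists>a b. cmod (Complex (of_rat a) (of_rat b) - w) < e"
proof -
  obtain a where a: "Re w < of_rat a" "of_rat a < Re w + e / 2"
    using of_rat_dense[of "Re w" "Re w + e / 2"] assms by auto
  obtain b where b: "Im w < of_rat b" "of_rat b < Im w + e / 2"
    using of_rat_dense[of "Im w" "Im w + e / 2"] assms by auto
  have "cmod (Complex (of_rat a) (of_rat b) - w) \<le> \<bar>of_rat a - Re w\<bar> + \<bar>of_rat b - Im w\<bar>"
    using cmod_le[of "Complex (of_rat a) (of_rat b) - w"] by simp
  also have "\<dots> < e" using a b by auto
  finally show ?thesis by blast
qed

text \<open>Separability of \<open>H(\<Omega>)\<close> is obtained from a countable supply of step functions, constant on the cells of a square
grid with rational values; they need not be holomorphic.\<close>

definition grid_cell :: "nat \<Rightarrow> complex \<Rightarrow> int \<times> int" where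
  "grid_cell n z = (\<lfloor>real n * Re z\<rfloor>, \<lfloor>real n * Im z\<rfloor>)"

text \<open>A code consists of the mesh parameter and of a finite table of values. Its type is countable, which makes the
enumeration of all step functions automatic.\<close>

definition step_function :: "nat \<times> ((int \<times> int) \<times> (rat \<times> rat)) list \<Rightarrow> complex \<Rightarrow> complex" where
  "step_function c z = (case map_of (snd c) (grid_cell (fst c) z) of
     None \<Rightarrow> 0 | Some (a, b) \<Rightarrow> Complex (of_rat a) (of_rat b))"

lemma grid_cell_eq_dist:
  assumes "n > 0" "grid_cell n x = grid_cell n y"
  shows "cmod (x - y) < 2 / real n"
proof -
  have *: "\<bar>u - v\<bar> < 1 / real n" if "\<lfloor>real n * u\<rfloor> = \<lfloor>real n * v\<rfloor>" for u v
  proof -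
    have "\<bar>real n * u - real n * v\<bar> < 1" using that by linarith
    moreover have "\<bar>real n * u - real n * v\<bar> = real n * \<bar>u - v\<bar>"
      by (simp add: abs_mult flip: right_diff_distrib)
    ultimately show ?thesis using assms(1) by (simp add: field_simps)
  qed
  have "cmod (x - y) \<le> \<bar>Re x - Re y\<bar> + \<bar>Im x - Im y\<bar>" using cmod_le[of "x - y"] by simp
  also have "\<dots> < 1 / real n + 1 / real n"
    using assms(2) by (intro add_strict_mono *) (simp_all add: grid_cell_def)
  finally show ?thesis by simp
qed

lemma finite_grid_cells:
  assumes "bounded X"
  shows "finite (grid_cell n ` X)"
proof -
  obtain B where B: "\<And>x. x \<in> X \<Longrightarrow> cmod x \<le> B" using assms by (auto simp: bounded_iff)
  define b where "b = \<lceil>real n * B\<rceil> + 1"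
  have *: "\<lfloor>real n * u\<rfloor> \<in> {-b..b}" if "\<bar>u\<bar> \<le> B" for u
  proof -
    have "\<bar>real n * u\<bar> \<le> real n * B" using that by (simp add: abs_mult mult_left_mono)
    then show ?thesis unfolding b_def by (auto, linarith+)
  qed
  have "grid_cell n x \<in> {-b..b} \<times> {-b..b}" if "x \<in> X" for x
    unfolding grid_cell_def
    by (intro SigmaI *; use B[OF that] abs_Re_le_cmod[of x] abs_Im_le_cmod[of x] in linarith)
  then have "grid_cell n ` X \<subseteq> {-b..b} \<times> {-b..b}" by blast
  then show ?thesis using finite_subset by blast
qed

lemma step_function_approximates:
  assumes "compact X" "continuous_on X g" "0 < e"
  shows "\<exists>c. \<forall>z\<in>X. cmod (step_function c z - g z) < e"
proof -
  obtain d where d: "d > 0" "\<And>x y. x \<in> X \<Longrightarrow> y \<in> X \<Longrightarrow> dist y x < d \<Longrightarrow> dist (g y) (g x) < e / 2"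
    using compact_uniformly_continuous[OF assms(2,1)] assms(3) unfolding uniformly_continuous_on_def
    by (metis half_gt_zero)
  obtain n :: nat where n: "n > 0" "2 / real n < d"
    using reals_Archimedean2[of "2 / d"] d(1)
    by (metis divide_less_eq gr0I mult.commute not_less_iff_gr_or_eq of_nat_0 of_nat_0_less_iff divide_pos_pos zero_less_numeral)
  define rep where "rep c = (SOME x. x \<in> X \<and> grid_cell n x = c)" for c
  have rep: "rep (grid_cell n z) \<in> X" "grid_cell n (rep (grid_cell n z)) = grid_cell n z" if "z \<in> X" for z
    using someI[of "\<lambda>x. x \<in> X \<and> grid_cell n x = grid_cell n z" z] that by (auto simp: rep_def)
  have "\<forall>c. \<exists>v. cmod (Complex (of_rat (fst v)) (of_rat (snd v)) - g (rep c)) < e / 2"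
    using complex_rational_dense[of "e / 2"] assms(3) by simp
  from choice[OF this] obtain v
    where v: "\<And>c. cmod (Complex (of_rat (fst (v c))) (of_rat (snd (v c))) - g (rep c)) < e / 2"
    by auto
  obtain xs where xs: "set xs = grid_cell n ` X"
    using finite_list[OF finite_grid_cells[OF compact_imp_bounded[OF assms(1)]]] by metis
  define l where "l = map (\<lambda>c. (c, v c)) xs"
  have "cmod (step_function (n, l) z - g z) < e" if z: "z \<in> X" for z
  proof -
    let ?c = "grid_cell n z"
    have "?c \<in> set xs" using xs z by blast
    then have "map_of l ?c = Some (v ?c)"
      by (simp add: l_def map_of_map_restrict)
    then have "step_function (n, l) z = Complex (of_rat (fst (v ?c))) (of_rat (snd (v ?c)))"
      by (simp add: step_function_def split: prod.split)
    moreover have "cmod (rep ?c - z) < 2 / real n"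
      by (rule grid_cell_eq_dist[OF n(1) rep(2)[OF z]])
    then have "cmod (g (rep ?c) - g z) < e / 2"
      using d(2)[OF z rep(1)[OF z]] n(2) by (simp add: dist_norm)
    ultimately show ?thesis
      using v[of ?c] norm_triangle_ineq[of "step_function (n, l) z - g (rep ?c)" "g (rep ?c) - g z"] by simp
  qed
  then show ?thesis by blast
qed

text \<open>Step functions are not in \<open>H(\<Omega>)\<close>; for every code, compact set of an exhaustion and accuracy for which a nearby
holomorphic function exists, one such function is selected.\<close>

lemma holo_funs_separable:
  assumes "open \<Omega>"
  shows "\<exists>d :: nat \<Rightarrow> complex \<Rightarrow> complex. (\<forall>m. d m \<in> holo_funs \<Omega>) \<and>
    (\<forall>g\<in>holo_funs \<Omega>. \<forall>K e. compact K \<and> K \<subseteq> \<Omega> \<and> 0 < e \<longrightarrow>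
        (\<exists>m. \<forall>z\<in>K. cmod (d m z - g z) < e))"
proof -
  obtain C :: "nat \<Rightarrow> complex set" where C: "\<And>n. compact (C n)" "\<And>n. C n \<subseteq> \<Omega>"
    "\<And>K. compact K \<Longrightarrow> K \<subseteq> \<Omega> \<Longrightarrow> \<exists>N. \<forall>n\<ge>N. K \<subseteq> C n"
    using open_Union_compact_subsets[OF assms] by metis
  define P where "P = (\<lambda>(c, k, q::nat) h. h \<in> holo_funs \<Omega> \<and>
     (\<forall>z\<in>C k. cmod (step_function c z - h z) < 1 / real (Suc q)))"
  define D where "D x = (if \<exists>h. P x h then SOME h. P x h else (\<lambda>_. 0))" for x
  have D: "P x (D x)" if "P x h" for x h
    using someI[of "P x" h] that by (auto simp: D_def)
  have D0: "D x \<in> holo_funs \<Omega>" for x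
  proof (cases "\<exists>h. P x h")
    case True
    then have "P x (D x)" using D by blast
    then show ?thesis by (auto simp: P_def split: prod.splits)
  next
    case False
    then have "D x = (\<lambda>_. 0)" by (simp add: D_def)
    then show ?thesis by (simp add: holo_funs_def)
  qed
  show ?thesis
  proof (intro exI conjI)
    show "\<forall>m. D (from_nat m) \<in> holo_funs \<Omega>" using D0 by blast
    have "\<exists>m. \<forall>z\<in>K. cmod (D (from_nat m) z - g z) < e"
      if g: "g \<in> holo_funs \<Omega>" and K: "compact K" "K \<subseteq> \<Omega>" "0 < e" for g K and e :: real
    proof -
      obtain k where k: "K \<subseteq> C k" using C(3)[OF K(1,2)] by blast
      obtain q :: nat where q: "1 / real (Suc q) < e / 2"
        using nat_approx_posE[of "e / 2"] K(3) by auto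
      have "continuous_on (C k) g"
        using g C(2) by (meson continuous_on_subset holo_funs_holomorphic holomorphic_on_imp_continuous_on)
      from step_function_approximates[OF C(1) this, of "1 / real (Suc q)"]
      obtain c where c: "\<And>z. z \<in> C k \<Longrightarrow> cmod (step_function c z - g z) < 1 / real (Suc q)" by auto
      then have "P (c, k, q) g" using g by (simp add: P_def)
      from D[OF this] have 1: "\<And>z. z \<in> C k \<Longrightarrow> cmod (step_function c z - D (c, k, q) z) < 1 / real (Suc q)"
        by (simp add: P_def)
      have "cmod (D (c, k, q) z - g z) < e" if "z \<in> K" for z
      proof -
        have "z \<in> C k" using that k by blast
        from c[OF this] 1[OF this] show ?thesis
          using norm_triangle_ineq4[of "step_function c z - g z" "step_function c z - D (c, k, q) z"] q by simp
      qed
      then show "\<exists>m. \<forall>z\<in>K. cmod (D (from_nat m) z - g z) < e"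
        by (intro exI[of _ "to_nat (c, k, q)"]) simp
    qed
    then show "\<forall>g\<in>holo_funs \<Omega>. \<forall>K e. compact K \<and> K \<subseteq> \<Omega> \<and> 0 < e \<longrightarrow>
        (\<exists>m. \<forall>z\<in>K. cmod (D (from_nat m) z - g z) < e)" by simp
  qed
qed

text \<open>The Baire category argument, carried out by hand: closed balls \<open>B\<close> (uniform closeness on a member of a compact
exhaustion) are nested so that, after step \<open>m\<close>, every member of the ball has some image \<open>T n g\<close> close to the
\<open>m\<close>-th target; every function of a countable dense set is a target with all accuracies on all sets of the
exhaustion. The centres converge locally uniformly to a point common to all balls.\<close>

lemma birkhoff_transitivity:
  fixes T :: "nat \<Rightarrow> (complex \<Rightarrow> complex) \<Rightarrow> complex \<Rightarrow> complex"
  assumes \<Omega>: "open \<Omega>"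
    and cont: "\<And>n f K e. f \<in> holo_funs \<Omega> \<Longrightarrow> compact K \<Longrightarrow> K \<subseteq> \<Omega> \<Longrightarrow> 0 < e \<Longrightarrow>
       \<exists>L d. compact L \<and> L \<subseteq> \<Omega> \<and> 0 < d \<and>
         (\<forall>g\<in>holo_funs \<Omega>. (\<forall>z\<in>L. cmod (g z - f z) < d) \<longrightarrow> (\<forall>z\<in>K. cmod (T n g z - T n f z) < e))"
    and trans: "\<And>g h K e. g \<in> holo_funs \<Omega> \<Longrightarrow> h \<in> holo_funs \<Omega> \<Longrightarrow> compact K \<Longrightarrow> K \<subseteq> \<Omega> \<Longrightarrow> 0 < e \<Longrightarrow>
       \<exists>n. \<exists>f\<in>holo_funs \<Omega>. (\<forall>z\<in>K. cmod (f z - g z) < e) \<and> (\<forall>z\<in>K. cmod (T n f z - h z) < e)"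
  shows "\<exists>f\<in>holo_funs \<Omega>. \<forall>g\<in>holo_funs \<Omega>. \<forall>K e. compact K \<and> K \<subseteq> \<Omega> \<and> 0 < e \<longrightarrow>
       (\<exists>n. \<forall>z\<in>K. cmod (T n f z - g z) < e)"
proof -
  obtain d :: "nat \<Rightarrow> complex \<Rightarrow> complex" where d: "\<forall>m. d m \<in> holo_funs \<Omega>"
    "\<forall>g\<in>holo_funs \<Omega>. \<forall>K e. compact K \<and> K \<subseteq> \<Omega> \<and> 0 < e \<longrightarrow>
        (\<exists>m. \<forall>z\<in>K. cmod (d m z - g z) < e)"
    using holo_funs_separable[OF \<Omega>] by (elim exE conjE)
  obtain C :: "nat \<Rightarrow> complex set" where C: "\<And>n. compact (C n)" "\<And>n. C n \<subseteq> \<Omega>"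
    "\<And>n. C n \<subseteq> interior (C (Suc n))" "\<Union>(range C) = \<Omega>"
    "\<And>K. compact K \<Longrightarrow> K \<subseteq> \<Omega> \<Longrightarrow> \<exists>N. \<forall>n\<ge>N. K \<subseteq> C n"
    using open_Union_compact_subsets[OF \<Omega>] by metis
  have "C n \<subseteq> C (Suc n)" for n using C(3)[of n] interior_subset by blast
  then have Cmono: "C m \<subseteq> C n" if "m \<le> n" for m n
    using lift_Suc_mono_le[of C] that by blast
  define B where "B = (\<lambda>(f, k, \<delta>). {g \<in> holo_funs \<Omega>. \<forall>z\<in>C k. cmod (g z - f z) \<le> \<delta>})"
  define hit where "hit m g \<longleftrightarrow> (\<exists>n. \<forall>z\<in>C (snd (prod_decode m)).
      cmod (T n g z - d (fst (prod_decode m)) z) < 1 / real (Suc (snd (prod_decode m))))" for m g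
  \<comment> \<open>The bounds on \<open>\<delta>\<close> and \<open>k\<close> make the radii tend to 0 and the sets \<open>C k\<close> exhaust \<open>\<Omega>\<close>, so that the centres converge.\<close>
  define P where "P m = (\<lambda>(f, k, \<delta>). f \<in> holo_funs \<Omega> \<and> 0 < (\<delta>::real) \<and> \<delta> \<le> 1 / real (Suc m) \<and> m \<le> (k::nat))" for m :: nat
  define Q where "Q m x y \<longleftrightarrow> B y \<subseteq> B x \<and> (\<forall>g\<in>B y. hit m g)" for m x y
  have "\<exists>x. \<forall>m. P m (x m) \<and> Q m (x m) (x (Suc m))"
  proof (rule dependent_nat_choice)
    have "P 0 (\<lambda>_. 0, 0, 1)" by (simp add: P_def holo_funs_def)
    then show "\<exists>x. P 0 x" by blast
    fix x m assume "P m x"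
    then obtain f k \<delta> where x: "x = (f, k, \<delta>)" "f \<in> holo_funs \<Omega>" "0 < \<delta>"
      by (auto simp: P_def split: prod.splits)
    define i where "i = fst (prod_decode m)"
    define j where "j = snd (prod_decode m)"
    define e where "e = 1 / (2 * real (Suc j))"
    have e: "e > 0" by (simp add: e_def)
    obtain n f' where f': "f' \<in> holo_funs \<Omega>" "\<And>z. z \<in> C (max k j) \<Longrightarrow> cmod (f' z - f z) < min (\<delta> / 2) e"
      "\<And>z. z \<in> C (max k j) \<Longrightarrow> cmod (T n f' z - d i z) < min (\<delta> / 2) e"
      using trans[OF x(2) d(1)[rule_format] C(1,2), of "min (\<delta> / 2) e" "max k j" i] x(3) e by auto
    obtain L \<eta> where L: "compact L" "L \<subseteq> \<Omega>" "0 < \<eta>"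
      "\<And>g. g \<in> holo_funs \<Omega> \<Longrightarrow> \<forall>z\<in>L. cmod (g z - f' z) < \<eta> \<Longrightarrow> \<forall>z\<in>C j. cmod (T n g z - T n f' z) < e"
      using cont[OF f'(1) C(1)[of j] C(2)[of j] e, of n] by auto
    obtain k0 where k0: "L \<subseteq> C k0" using C(5)[OF L(1,2)] by blast
    define k' where "k' = Max {k, k0, Suc m}"
    have k': "k \<le> k'" "k0 \<le> k'" "Suc m \<le> k'" by (simp_all add: k'_def)
    define \<delta>' where "\<delta>' = Min {\<delta> / 2, \<eta> / 2, 1 / real (Suc (Suc m))}"
    have \<delta>': "0 < \<delta>'" "\<delta>' \<le> \<delta> / 2" "\<delta>' \<le> \<eta> / 2" "\<delta>' \<le> 1 / real (Suc (Suc m))"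
      using x(3) L(3) by (simp_all add: \<delta>'_def)
    have "P (Suc m) (f', k', \<delta>')" using f' \<delta>' k' by (simp add: P_def)
    moreover have "Q m x (f', k', \<delta>')"
      unfolding Q_def
    proof (intro conjI subsetI ballI)
      fix g assume "g \<in> B (f', k', \<delta>')"
      then have g: "g \<in> holo_funs \<Omega>" "\<And>z. z \<in> C k' \<Longrightarrow> cmod (g z - f' z) \<le> \<delta>'" by (auto simp: B_def)
      have "cmod (g z - f z) \<le> \<delta>" if z: "z \<in> C k" for z
      proof -
        have "z \<in> C k'" "z \<in> C (max k j)" using z Cmono[OF k'(1)] Cmono[of k "max k j"] by auto
        then show ?thesis
          using g(2)[of z] f'(2)[of z] \<delta>'(2) norm_triangle_ineq[of "g z - f' z" "f' z - f z"] by simp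
      qed
      then show "g \<in> B x" using g by (simp add: B_def x)
      have "cmod (g z - f' z) < \<eta>" if "z \<in> L" for z
        using g(2)[of z] that k0 Cmono[OF k'(2)] \<delta>'(3) L(3) by force
      then have 1: "\<forall>z\<in>C j. cmod (T n g z - T n f' z) < e" using L(4)[OF g(1)] by blast
      \<comment> \<open>The error splits into one half from continuity of \<open>T n\<close> and one half from \<open>f'\<close>.\<close>
      show "hit m g"
        unfolding hit_def
      proof (intro exI[of _ n] ballI)
        fix z assume "z \<in> C (snd (prod_decode m))"
        then have z: "z \<in> C j" "z \<in> C (max k j)" using Cmono[of j "max k j"] by (auto simp: j_def)
        then have "cmod (T n g z - d i z) < e + e"
          using 1 f'(3)[OF z(2)] norm_triangle_ineq[of "T n g z - T n f' z" "T n f' z - d i z"] by fastforce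
        also have "e + e = 1 / real (Suc j)" by (simp add: e_def field_simps)
        finally show "cmod (T n g z - d (fst (prod_decode m)) z) < 1 / real (Suc (snd (prod_decode m)))"
          by (simp add: i_def j_def)
      qed
    qed
    ultimately show "\<exists>y. P (Suc m) y \<and> Q m x y" by blast
  qed
  then obtain x where x: "\<And>m. P m (x m)" "\<And>m. Q m (x m) (x (Suc m))" by blast
  define f where "f m = fst (x m)" for m
  define k where "k m = fst (snd (x m))" for m
  define \<delta> where "\<delta> m = snd (snd (x m))" for m
  have Bx: "B (x m) = {g \<in> holo_funs \<Omega>. \<forall>z\<in>C (k m). cmod (g z - f m z) \<le> \<delta> m}" for m
    by (simp add: B_def f_def k_def \<delta>_def split: prod.split)
  have f: "f m \<in> holo_funs \<Omega>" "0 < \<delta> m" "\<delta> m \<le> 1 / real (Suc m)" "m \<le> k m" for m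
    using x(1)[of m] by (auto simp: P_def f_def k_def \<delta>_def split: prod.splits)
  have Bmono: "B (x n) \<subseteq> B (x m)" if "m \<le> n" for m n
    using lift_Suc_antimono_le[of "\<lambda>m. B (x m)"] x(2) that by (auto simp: Q_def)
  have fB: "f m \<in> B (x m)" for m using f[of m] by (simp add: Bx less_imp_le)
  have close: "cmod (f n z - f m z) \<le> \<delta> m" if "m \<le> n" "z \<in> C (k m)" for m n z
    using fB[of n] Bmono[OF that(1)] that(2) by (auto simp: Bx)
  have cauchy: "uniformly_Cauchy_on (C j) f" for j
    unfolding uniformly_Cauchy_on_def
  proof (intro allI impI)
    fix e :: real assume "e > 0"
    then obtain N :: nat where N: "1 / real (Suc N) < e / 2" using nat_approx_posE[of "e / 2"] by auto
    define M where "M = max N j"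
    have M: "\<delta> M < e / 2"
    proof -
      have "1 / real (Suc M) \<le> 1 / real (Suc N)" by (simp add: M_def frac_le)
      then show ?thesis using f(3)[of M] N by linarith
    qed
    have jM: "C j \<subseteq> C (k M)" using Cmono f(4)[of M] by (simp add: M_def)
    show "\<exists>M. \<forall>x\<in>C j. \<forall>m\<ge>M. \<forall>n\<ge>M. dist (f m x) (f n x) < e"
    proof (intro exI[of _ M] ballI allI impI)
      fix z m n assume "z \<in> C j" "m \<ge> M" "n \<ge> M"
      then have "cmod (f m z - f M z) \<le> \<delta> M" "cmod (f n z - f M z) \<le> \<delta> M" using close jM by blast+
      then show "dist (f m z) (f n z) < e"
        using norm_triangle_ineq4[of "f m z - f M z" "f n z - f M z"] M by (simp add: dist_norm)
    qed
  qed
  define F where "F z = lim (\<lambda>m. f m z)" for z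
  have ul: "uniform_limit (C j) f F sequentially" for j
    using Cauchy_uniformly_convergent[OF cauchy] unfolding uniformly_convergent_uniform_limit_iff F_def .
  have holF: "F holomorphic_on \<Omega>"
  proof (rule holomorphic_uniform_sequence[OF \<Omega>])
    show "f n holomorphic_on \<Omega>" for n using f(1) by (rule holo_funs_holomorphic)
    fix z assume "z \<in> \<Omega>"
    then obtain r where r: "r > 0" "cball z r \<subseteq> \<Omega>" using \<Omega> open_contains_cball by blast
    then obtain j where "cball z r \<subseteq> C j" using C(5)[OF compact_cball r(2)] by blast
    then show "\<exists>d>0. cball z d \<subseteq> \<Omega> \<and> uniform_limit (cball z d) f F sequentially"
      using r uniform_limit_on_subset[OF ul] by blast
  qed
  moreover have "F z = 0" if "z \<notin> \<Omega>" for z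
  proof -
    have "f m z = 0" for m using f(1)[of m] that by (simp add: holo_funs_def)
    then show ?thesis by (simp add: F_def)
  qed
  ultimately have FH: "F \<in> holo_funs \<Omega>" by (simp add: holo_funs_def)
  have FB: "F \<in> B (x m)" for m
  proof -
    have "cmod (F z - f m z) \<le> \<delta> m" if z: "z \<in> C (k m)" for z
    proof (rule Lim_norm_ubound[OF sequentially_bot])
      show "(\<lambda>n. f n z - f m z) \<longlonglongrightarrow> F z - f m z"
        by (intro tendsto_diff tendsto_const tendsto_uniform_limitI[OF ul z])
      show "\<forall>\<^sub>F n in sequentially. cmod (f n z - f m z) \<le> \<delta> m"
        using close[OF _ z] by (auto simp: eventually_sequentially)
    qed
    then show ?thesis using FH by (simp add: Bx)
  qed
  have hits: "hit m F" for m using x(2)[of m] FB[of "Suc m"] by (simp add: Q_def)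
  show ?thesis
  proof (rule bexI[OF _ FH], intro ballI allI impI)
    fix g K and e :: real assume g: "g \<in> holo_funs \<Omega>" and K: "compact K \<and> K \<subseteq> \<Omega> \<and> 0 < e"
    then obtain i where i: "\<And>z. z \<in> K \<Longrightarrow> cmod (d i z - g z) < e / 2"
      using bspec[OF d(2) g, rule_format, of K "e / 2"] by auto
    obtain N where N: "\<And>n. n \<ge> N \<Longrightarrow> K \<subseteq> C n" using C(5) K by blast
    obtain q :: nat where q: "1 / real (Suc q) < e / 2" using nat_approx_posE[of "e / 2"] K by auto
    define j where "j = max N q"
    have j: "1 / real (Suc j) < e / 2"
    proof -
      have "1 / real (Suc j) \<le> 1 / real (Suc q)" by (simp add: j_def frac_le)
      then show ?thesis using q by linarith
    qed
    obtain n where n: "\<And>z. z \<in> C j \<Longrightarrow> cmod (T n F z - d i z) < 1 / real (Suc j)"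
      using hits[of "prod_encode (i, j)"] by (auto simp: hit_def)
    have "cmod (T n F z - g z) < e" if z: "z \<in> K" for z
    proof -
      have "z \<in> C j" using z N[of j] by (auto simp: j_def)
      from n[OF this] i[OF z] show ?thesis
        using norm_triangle_ineq[of "T n F z - d i z" "d i z - g z"] j by simp
    qed
    then show "\<exists>n. \<forall>z\<in>K. cmod (T n F z - g z) < e" by blast
  qed
qed

text \<open>Closeness of \<open>f\<close> and \<open>g\<close> on \<open>\<psi>\<^sub>n(K)\<close> is all that matters on \<open>K\<close>, up to a bound for \<open>\<omega>\<^sub>n\<close>.\<close>

lemma weighted_comp_funpow_continuous:
  assumes \<Omega>: "open \<Omega>" and hol: "\<omega> holomorphic_on \<Omega>" "\<psi> holomorphic_on \<Omega>" "\<psi> \<in> \<Omega> \<rightarrow> \<Omega>"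
    and K: "compact K" "K \<subseteq> \<Omega>" "0 < e"
  shows "\<exists>L d. compact L \<and> L \<subseteq> \<Omega> \<and> 0 < d \<and>
         (\<forall>g\<in>holo_funs \<Omega>. (\<forall>z\<in>L. cmod (g z - f z) < d) \<longrightarrow>
           (\<forall>z\<in>K. cmod ((weighted_comp \<Omega> \<omega> \<psi> ^^ n) g z - (weighted_comp \<Omega> \<omega> \<psi> ^^ n) f z) < e))"
proof -
  define w where "w z = (\<Prod>j<n. \<omega> ((\<psi> ^^ j) z))" for z
  have hn: "(\<psi> ^^ j) holomorphic_on \<Omega>" for j by (rule funpow_holomorphic[OF hol(2,3)])
  have "(\<omega> \<circ> (\<psi> ^^ j)) holomorphic_on \<Omega>" for j
    by (rule holomorphic_on_compose_gen[OF hn hol(1)]) (use funpow_in[OF hol(3)] in auto)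
  then have "w holomorphic_on \<Omega>"
    unfolding w_def by (intro holomorphic_intros) (simp add: o_def)
  then have "compact (w ` K)"
    using K by (meson compact_continuous_image continuous_on_subset holomorphic_on_imp_continuous_on)
  then obtain M where M: "M > 0" "\<And>z. z \<in> K \<Longrightarrow> cmod (w z) \<le> M"
    using compact_imp_bounded bounded_pos by (metis (no_types, lifting) imageI)
  have cL: "compact ((\<psi> ^^ n) ` K)"
    using hn K by (meson compact_continuous_image continuous_on_subset holomorphic_on_imp_continuous_on)
  show ?thesis
  proof (intro exI[of _ "(\<psi> ^^ n) ` K"] exI[of _ "e / M"] conjI ballI impI cL)
    show "(\<psi> ^^ n) ` K \<subseteq> \<Omega>" using K funpow_in[OF hol(3)] by blast
    show "0 < e / M" using K M by simp
    fix g z assume g: "\<forall>z\<in>(\<psi> ^^ n) ` K. cmod (g z - f z) < e / M" and z: "z \<in> K"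
    have zO: "z \<in> \<Omega>" using z K by blast
    have "cmod ((weighted_comp \<Omega> \<omega> \<psi> ^^ n) g z - (weighted_comp \<Omega> \<omega> \<psi> ^^ n) f z)
       = cmod (w z) * cmod (g ((\<psi> ^^ n) z) - f ((\<psi> ^^ n) z))"
      unfolding weighted_comp_funpow[OF hol(3) zO] w_def by (simp flip: norm_mult right_diff_distrib)
    also have "\<dots> \<le> M * cmod (g ((\<psi> ^^ n) z) - f ((\<psi> ^^ n) z))"
      using M(2)[OF z] by (intro mult_right_mono) auto
    also have "\<dots> < M * (e / M)" using g z M(1) by (intro mult_strict_left_mono) auto
    finally show "cmod ((weighted_comp \<Omega> \<omega> \<psi> ^^ n) g z - (weighted_comp \<Omega> \<omega> \<psi> ^^ n) f z) < e"
      using M(1) by simp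
  qed
qed

section \<open>Consequences of dense range\<close>

text \<open>A strictly larger connected set disjoint from \<open>K\<close> would have to cross the frontier of \<open>Y\<close>.\<close>

lemma componentI_frontier:
  fixes Y K :: "'a::real_normed_vector set"
  assumes "connected Y" "Y \<noteq> {}" "Y \<inter> K = {}" "frontier Y \<subseteq> K"
  shows "Y \<in> components (- K)"
proof -
  obtain y where y: "y \<in> Y" using assms(2) by blast
  define D where "D = connected_component_set (- K) y"
  have YD: "Y \<subseteq> D"
    unfolding D_def using y assms(1,3) by (intro connected_component_maximal) auto
  have "D \<inter> K = {}" using connected_component_subset unfolding D_def by blast
  have "D - Y = {}"
  proof (rule ccontr)
    assume "D - Y \<noteq> {}"
    moreover have "D \<inter> Y \<noteq> {}" using y YD by blast
    moreover have "connected D" by (simp add: D_def)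
    ultimately have "D \<inter> frontier Y \<noteq> {}" by (simp add: connected_Int_frontier)
    then show False using assms(4) \<open>D \<inter> K = {}\<close> by blast
  qed
  then have "Y = D" using YD by blast
  moreover have "y \<in> - K" using y assms(3) by blast
  ultimately show ?thesis unfolding D_def by (auto simp: components_def)
qed

lemma hole_maximum_modulus:
  assumes X: "compact X" and C: "C \<in> components (- X)" "bounded C"
    and u: "u holomorphic_on C" "continuous_on (C \<union> X) u"
    and B: "\<And>x. x \<in> X \<Longrightarrow> cmod (u x) \<le> B" and w: "w \<in> C"
  shows "cmod (u w) \<le> B"
proof -
  have op: "open C" using C(1) X by (meson compact_imp_closed open_Compl open_components)
  have fr: "frontier C \<subseteq> X"
    using C(1) X compact_imp_closed frontier_of_components_closed_complement by blast
  show ?thesis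
  proof (rule maximum_modulus_frontier[of u C])
    show "u holomorphic_on interior C" using u(1) op by (simp add: interior_open)
    have "closure C \<subseteq> C \<union> X" using fr closure_Un_frontier by blast
    then show "continuous_on (closure C) u" using u(2) continuous_on_subset by blast
  qed (use C fr B w in auto)
qed

lemma dense_range_zero_free:
  assumes dense: "\<And>g K e. g \<in> holo_funs \<Omega> \<Longrightarrow> compact K \<Longrightarrow> K \<subseteq> \<Omega> \<Longrightarrow> 0 < e \<Longrightarrow>
       \<exists>f\<in>holo_funs \<Omega>. \<forall>z\<in>K. cmod (\<omega> z * f (\<psi> z) - g z) < e"
    and "z \<in> \<Omega>"
  shows "\<omega> z \<noteq> 0"
proof
  assume "\<omega> z = 0"
  have "(\<lambda>z. if z \<in> \<Omega> then 1 else 0) \<in> holo_funs \<Omega>" by (rule holo_funs_cut) simp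
  from dense[OF this, of "{z}" 1] show False using \<open>\<omega> z = 0\<close> assms(2) by auto
qed

text \<open>If \<open>\<psi> a = \<psi> b\<close>, every function \<open>F\<close> in the range satisfies \<open>\<omega> b * F a = \<omega> a * F b\<close>, and so would every limit;
but some polynomial has the values 1 at \<open>a\<close> and 0 at \<open>b\<close>.\<close>

lemma dense_range_inj:
  assumes dense: "\<And>g K e. g \<in> holo_funs \<Omega> \<Longrightarrow> compact K \<Longrightarrow> K \<subseteq> \<Omega> \<Longrightarrow> 0 < e \<Longrightarrow>
       \<exists>f\<in>holo_funs \<Omega>. \<forall>z\<in>K. cmod (\<omega> z * f (\<psi> z) - g z) < e"
  shows "inj_on \<psi> \<Omega>"
proof (rule inj_onI, rule ccontr)
  fix a b assume ab: "a \<in> \<Omega>" "b \<in> \<Omega>" "\<psi> a = \<psi> b" "a \<noteq> b"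
  have "\<omega> z \<noteq> 0" if "z \<in> \<Omega>" for z
    by (rule dense_range_zero_free[OF dense that])
  then have nz: "\<omega> a \<noteq> 0" "\<omega> b \<noteq> 0" using ab by auto
  define M where "M = 1 + cmod (\<omega> a) / cmod (\<omega> b)"
  have M: "M \<ge> 1" by (simp add: M_def)
  have "(\<lambda>z. if z \<in> \<Omega> then (z - b) / (a - b) else 0) \<in> holo_funs \<Omega>"
    by (rule holo_funs_cut) (use ab in \<open>auto intro!: holomorphic_intros\<close>)
  from dense[OF this, of "{a, b}" "1 / M"] obtain f where
    f: "cmod (\<omega> a * f (\<psi> b) - 1) < 1 / M" "cmod (\<omega> b * f (\<psi> b)) < 1 / M"
    using ab M by auto
  have "\<omega> a * f (\<psi> b) = (\<omega> a / \<omega> b) * (\<omega> b * f (\<psi> b))" using nz by simp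
  then have "cmod (\<omega> a * f (\<psi> b)) = (M - 1) * cmod (\<omega> b * f (\<psi> b))"
    by (simp only: norm_mult norm_divide M_def) simp
  also have "\<dots> \<le> (M - 1) * (1 / M)" using f(2) M by (intro mult_left_mono) auto
  finally have "cmod (\<omega> a * f (\<psi> b)) \<le> 1 - 1 / M" using M by (simp add: field_simps)
  moreover have "1 - cmod (\<omega> a * f (\<psi> b)) \<le> cmod (\<omega> a * f (\<psi> b) - 1)"
    by (metis norm_minus_commute norm_one norm_triangle_ineq2)
  ultimately show False using f(1) by linarith
qed

text \<open>Approximating \<open>\<omega> g\<close> by \<open>\<omega> (f \<circ> \<psi>)\<close> and dividing by the zero-free weight reduces density of the range to the
unweighted case.\<close>

lemma dense_range_unweighted:
  assumes "\<omega> holomorphic_on \<Omega>"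
    and dense: "\<And>g K e. g \<in> holo_funs \<Omega> \<Longrightarrow> compact K \<Longrightarrow> K \<subseteq> \<Omega> \<Longrightarrow> 0 < e \<Longrightarrow>
       \<exists>f\<in>holo_funs \<Omega>. \<forall>z\<in>K. cmod (\<omega> z * f (\<psi> z) - g z) < e"
    and g: "g \<in> holo_funs \<Omega>" and K: "compact K" "K \<subseteq> \<Omega>" "0 < e"
  shows "\<exists>f\<in>holo_funs \<Omega>. \<forall>z\<in>K. cmod (f (\<psi> z) - g z) < e"
proof (cases "K = {}")
  case True
  then show ?thesis using g by auto
next
  case False
  have "continuous_on K (\<lambda>z. cmod (\<omega> z))"
    using continuous_on_subset[OF holomorphic_on_imp_continuous_on[OF assms(1)] K(2)]
    by (rule continuous_on_norm)
  then obtain x where x: "x \<in> K" "\<And>y. y \<in> K \<Longrightarrow> cmod (\<omega> x) \<le> cmod (\<omega> y)"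
    using continuous_attains_inf[OF K(1) False] by blast
  have "\<omega> z \<noteq> 0" if "z \<in> \<Omega>" for z
    by (rule dense_range_zero_free[OF dense that])
  then have m: "cmod (\<omega> x) > 0" using x(1) K(2) by auto
  have "(\<lambda>z. if z \<in> \<Omega> then \<omega> z * g z else 0) \<in> holo_funs \<Omega>"
    by (rule holo_funs_cut) (use assms(1) g in \<open>auto simp: holo_funs_def intro!: holomorphic_intros\<close>)
  from dense[OF this K(1,2), of "e * cmod (\<omega> x)"] obtain f where
    f: "f \<in> holo_funs \<Omega>" "\<forall>z\<in>K. cmod (\<omega> z * f (\<psi> z) - \<omega> z * g z) < e * cmod (\<omega> x)"
    using m K by (auto simp: subset_iff) 
  have "cmod (f (\<psi> z) - g z) < e" if z: "z \<in> K" for z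
  proof -
    have "cmod (\<omega> x) * cmod (f (\<psi> z) - g z) \<le> cmod (\<omega> z) * cmod (f (\<psi> z) - g z)"
      using x(2)[OF z] by (simp add: mult_right_mono)
    also have "\<dots> = cmod (\<omega> z * f (\<psi> z) - \<omega> z * g z)"
      by (simp flip: norm_mult add: algebra_simps)
    also have "\<dots> < e * cmod (\<omega> x)" using f(2) z by blast
    finally show ?thesis using m by (simp add: mult.commute)
  qed
  then show ?thesis using f(1) by blast
qed

text \<open>Functions \<open>h j\<close> with \<open>h j \<circ> \<psi>\<close> converging to \<open>g\<close> on \<open>K\<close> are uniformly Cauchy on \<open>\<psi>(K)\<close>, hence by the maximum
principle also on a hole \<open>C\<close> of \<open>\<psi>(K)\<close> contained in \<open>\<Omega>\<close>. Their limit transports \<open>g\<close> to \<open>\<psi>(K)\<close> and extends it to \<open>C\<close>.\<close>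

lemma dense_range_extension:
  assumes \<Omega>: "open \<Omega>" "\<psi> holomorphic_on \<Omega>" "\<psi> \<in> \<Omega> \<rightarrow> \<Omega>"
    and dense: "\<And>g K e. g \<in> holo_funs \<Omega> \<Longrightarrow> compact K \<Longrightarrow> K \<subseteq> \<Omega> \<Longrightarrow> 0 < e \<Longrightarrow>
       \<exists>f\<in>holo_funs \<Omega>. \<forall>z\<in>K. cmod (f (\<psi> z) - g z) < e"
    and K: "compact K" "K \<subseteq> \<Omega>" and C: "C \<in> components (- (\<psi> ` K))" "bounded C" "C \<subseteq> \<Omega>"
    and g: "g \<in> holo_funs \<Omega>"
  obtains G where "G holomorphic_on C" "continuous_on (C \<union> \<psi> ` K) G" "\<And>z. z \<in> K \<Longrightarrow> G (\<psi> z) = g z"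
proof -
  have cont: "continuous_on \<Omega> \<psi>" using \<Omega>(2) holomorphic_on_imp_continuous_on by blast
  have X: "compact (\<psi> ` K)" "\<psi> ` K \<subseteq> \<Omega>"
    using K \<Omega>(3) compact_continuous_image continuous_on_subset[OF cont] by blast+
  have opC: "open C" using C(1) X by (meson compact_imp_closed open_Compl open_components)
  have "\<exists>f\<in>holo_funs \<Omega>. \<forall>z\<in>K. cmod (f (\<psi> z) - g z) < 1 / real (Suc j)" for j
    using dense[OF g K] by simp
  then obtain h where h: "\<And>j. h j \<in> holo_funs \<Omega>"
    "\<And>j z. z \<in> K \<Longrightarrow> cmod (h j (\<psi> z) - g z) < 1 / real (Suc j)" by metis
  have hol: "h j holomorphic_on \<Omega>" for j using h(1) by (simp add: holo_funs_def)
  have conth: "continuous_on (C \<union> \<psi> ` K) (h j)" for j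
    using hol C(3) X(2) by (meson Un_least continuous_on_subset holomorphic_on_imp_continuous_on)
  have bd: "cmod (h j w - h k w) \<le> 1 / real (Suc j) + 1 / real (Suc k)" if "w \<in> C \<union> \<psi> ` K" for j k w
  proof -
    have 1: "cmod (h j w - h k w) \<le> 1 / real (Suc j) + 1 / real (Suc k)" if w: "w \<in> \<psi> ` K" for w
    proof -
      obtain z where z: "z \<in> K" "w = \<psi> z" using w by blast
      have "cmod (h j w - h k w) \<le> cmod (h j w - g z) + cmod (h k w - g z)"
        using norm_triangle_ineq4[of "h j w - g z" "h k w - g z"] by simp
      then show ?thesis using h(2)[OF z(1), of j] h(2)[OF z(1), of k] z(2) by simp
    qed
    show ?thesis
    proof (cases "w \<in> \<psi> ` K")
      case False
      with that have w: "w \<in> C" by blast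
      show ?thesis
        by (rule hole_maximum_modulus[OF X(1) C(1,2) _ _ 1 w])
          (use hol C(3) conth in \<open>auto intro!: holomorphic_on_diff continuous_on_diff intro: holomorphic_on_subset\<close>)
    qed (rule 1)
  qed
  have "uniformly_Cauchy_on (C \<union> \<psi> ` K) h"
    unfolding uniformly_Cauchy_on_def
  proof (intro allI impI)
    fix e :: real assume "e > 0"
    then obtain N where N: "1 / real (Suc N) < e / 2"
      using nat_approx_posE[of "e / 2"] by (auto simp: field_simps)
    have le: "1 / real (Suc j) \<le> 1 / real (Suc N)" if "j \<ge> N" for j
      using that by (simp add: frac_le)
    show "\<exists>M. \<forall>x\<in>C \<union> \<psi> ` K. \<forall>m\<ge>M. \<forall>n\<ge>M. dist (h m x) (h n x) < e"
    proof (intro exI[of _ N] ballI allI impI)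
      fix x m n assume "x \<in> C \<union> \<psi> ` K" "m \<ge> N" "n \<ge> N"
      then show "dist (h m x) (h n x) < e"
        using bd[of x m n] le[of m] le[of n] N by (simp add: dist_norm)
    qed
  qed
  then obtain G where G: "uniform_limit (C \<union> \<psi> ` K) h G sequentially"
    using Cauchy_uniformly_convergent uniformly_convergent_on_def by blast
  show ?thesis
  proof
    show "continuous_on (C \<union> \<psi> ` K) G"
      by (rule uniform_limit_theorem[OF always_eventually G]) (use conth in auto)
    show "G holomorphic_on C"
    proof (rule holomorphic_uniform_sequence[OF opC])
      show "h n holomorphic_on C" for n using hol C(3) holomorphic_on_subset by blast
      fix x assume "x \<in> C"
      then obtain d where "0 < d" "cball x d \<subseteq> C" using opC open_contains_cball by blast
      then show "\<exists>d>0. cball x d \<subseteq> C \<and> uniform_limit (cball x d) h G sequentially"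
        using uniform_limit_on_subset[OF G] by (metis le_supI1)
    qed
    fix z assume z: "z \<in> K"
    have "(\<lambda>j. h j (\<psi> z)) \<longlonglongrightarrow> G (\<psi> z)"
      using tendsto_uniform_limitI[OF G, of "\<psi> z"] z by blast
    moreover have "(\<lambda>j. h j (\<psi> z)) \<longlonglongrightarrow> g z"
    proof (rule LIM_zero_cancel, rule Lim_null_comparison)
      show "\<forall>\<^sub>F j in sequentially. cmod (h j (\<psi> z) - g z) \<le> 1 / real (Suc j)"
        using h(2)[OF z] by (auto intro!: always_eventually less_imp_le)
    qed (use LIMSEQ_inverse_real_of_nat in \<open>simp add: inverse_eq_divide\<close>)
    ultimately show "G (\<psi> z) = g z" using LIMSEQ_unique by blast
  qed
qed

text \<open>Suppose that a hole \<open>C\<close> of \<open>\<psi>(K)\<close> lies in \<open>\<Omega>\<close>. Extending the identity gives a map \<open>\<phi>\<close> on \<open>C\<close> that inverts \<open>\<psi>\<close> on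
\<open>\<psi>(K)\<close>. It omits every \<open>a \<notin> \<Omega>\<close>, because the extension of \<open>1 / (z - a)\<close> stays the reciprocal of \<open>\<phi> - a\<close>.
Hence \<open>\<psi> \<circ> \<phi>\<close> makes sense on \<open>C\<close> and is the identity there, and \<open>\<phi>(C)\<close> is an open connected set in \<open>\<Omega>\<close> with
frontier in \<open>K\<close>: a hole of \<open>K\<close> inside \<open>\<Omega>\<close>.\<close>

lemma dense_range_convex:
  assumes \<Omega>: "open \<Omega>" "\<psi> holomorphic_on \<Omega>" "\<psi> \<in> \<Omega> \<rightarrow> \<Omega>" and inj: "inj_on \<psi> \<Omega>"
    and dense: "\<And>g K e. g \<in> holo_funs \<Omega> \<Longrightarrow> compact K \<Longrightarrow> K \<subseteq> \<Omega> \<Longrightarrow> 0 < e \<Longrightarrow>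
       \<exists>f\<in>holo_funs \<Omega>. \<forall>z\<in>K. cmod (f (\<psi> z) - g z) < e"
  shows "convex_map_on \<Omega> \<psi>"
  unfolding convex_map_on_def
proof (intro allI impI)
  fix K assume "convex_compact_in \<Omega> K"
  then have K: "compact K" "K \<subseteq> \<Omega>" and hK: "\<And>C. C \<in> holes K \<Longrightarrow> \<exists>z\<in>C. z \<notin> \<Omega>"
    by (auto simp: convex_compact_in_def)
  have cont: "continuous_on \<Omega> \<psi>" using \<Omega>(2) holomorphic_on_imp_continuous_on by blast
  have X: "compact (\<psi> ` K)" "\<psi> ` K \<subseteq> \<Omega>"
    using K \<Omega>(3) compact_continuous_image continuous_on_subset[OF cont] by blast+
  show "convex_compact_in \<Omega> (\<psi> ` K)"
    unfolding convex_compact_in_def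
  proof (intro conjI X ballI, rule ccontr)
    fix C assume "C \<in> holes (\<psi> ` K)" and "\<not> (\<exists>z\<in>C. z \<notin> \<Omega>)"
    then have C: "C \<in> components (- (\<psi> ` K))" "bounded C" "C \<subseteq> \<Omega>"
      by (auto simp: holes_def)
    note ext = dense_range_extension[OF \<Omega> dense K C]
    have opC: "open C" using C(1) X by (meson compact_imp_closed open_Compl open_components)
    have CX: "C \<inter> \<psi> ` K = {}" using C(1) in_components_subset by blast
    have cl: "closure C \<subseteq> C \<union> \<psi> ` K"
      using C(1) X(1) compact_imp_closed frontier_of_components_closed_complement closure_Un_frontier by blast
    have max0: "u w = 0" if "u holomorphic_on C" "continuous_on (C \<union> \<psi> ` K) u" "\<And>z. z \<in> K \<Longrightarrow> u (\<psi> z) = 0"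
      "w \<in> C" for u w
      using hole_maximum_modulus[OF X(1) C(1,2) that(1,2) _ that(4), of 0] that(3) by auto
    have "(\<lambda>z. if z \<in> \<Omega> then z else 0) \<in> holo_funs \<Omega>" by (rule holo_funs_cut) simp
    then obtain \<phi> where \<phi>: "\<phi> holomorphic_on C" "continuous_on (C \<union> \<psi> ` K) \<phi>"
      "\<And>z. z \<in> K \<Longrightarrow> \<phi> (\<psi> z) = z"
      using ext K(2) by (smt (verit, best) subsetD)
    have im: "\<phi> p \<in> \<Omega>" if p: "p \<in> C" for p
    proof (rule ccontr)
      define a where "a = \<phi> p"
      assume "\<phi> p \<notin> \<Omega>"
      then have a: "a \<notin> \<Omega>" by (simp add: a_def)
      have "(\<lambda>z. if z \<in> \<Omega> then 1 / (z - a) else 0) \<in> holo_funs \<Omega>"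
        by (rule holo_funs_cut) (use a in \<open>auto intro!: holomorphic_intros\<close>)
      then obtain G where G: "G holomorphic_on C" "continuous_on (C \<union> \<psi> ` K) G"
        "\<And>z. z \<in> K \<Longrightarrow> G (\<psi> z) = (if z \<in> \<Omega> then 1 / (z - a) else 0)"
        using ext by blast
      \<comment> \<open>This function vanishes on \<open>\<psi>(K)\<close>, hence on \<open>C\<close>; at \<open>p\<close> its value is \<open>-1\<close>.\<close>
      have "(\<phi> p - a) * G p - 1 = 0"
        by (rule max0[OF _ _ _ p])
          (use G \<phi> K(2) a in \<open>auto intro!: holomorphic_intros continuous_intros simp: subset_iff\<close>)
      then show False by (simp add: a_def)
    qed
    have imX: "\<phi> w \<in> \<Omega>" if "w \<in> C \<union> \<psi> ` K" for w
      using that im \<phi>(3) K(2) by auto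
    have inv: "\<psi> (\<phi> w) = w" if w: "w \<in> C" for w
    proof -
      have "(\<psi> \<circ> \<phi>) holomorphic_on C"
        by (rule holomorphic_on_compose_gen[OF \<phi>(1) \<Omega>(2)]) (use im in auto)
      moreover have "continuous_on (C \<union> \<psi> ` K) (\<psi> \<circ> \<phi>)"
        by (rule continuous_on_compose[OF \<phi>(2)]) (use imX cont in \<open>auto intro: continuous_on_subset\<close>)
      ultimately have "(\<psi> \<circ> \<phi>) w - w = 0"
        by (intro max0[of "\<lambda>w. (\<psi> \<circ> \<phi>) w - w" w] holomorphic_on_diff continuous_on_diff
            holomorphic_on_ident continuous_on_id w) (simp_all add: \<phi>(3) o_def)
      then show ?thesis by simp
    qed
    have "\<phi> ` C \<in> components (- K)"
    proof (rule componentI_frontier)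
      show "connected (\<phi> ` C)"
        using C(1) \<phi>(1) connected_continuous_image holomorphic_on_imp_continuous_on in_components_connected by blast
      show "\<phi> ` C \<noteq> {}" using C(1) in_components_nonempty by blast
      show "\<phi> ` C \<inter> K = {}"
      proof (rule ccontr)
        assume "\<phi> ` C \<inter> K \<noteq> {}"
        then obtain w where "w \<in> C" "\<phi> w \<in> K" by blast
        then show False using CX inv[of w] by (metis disjoint_iff imageI)
      qed
      have "inj_on \<phi> C" by (metis inj_onI inv)
      then have op: "open (\<phi> ` C)" using open_mapping_thm3[OF \<phi>(1) opC] by blast
      have "compact (\<phi> ` closure C)"
        using \<phi>(2) cl C(2) by (meson compact_closure compact_continuous_image continuous_on_subset)
      then have "closure (\<phi> ` C) \<subseteq> \<phi> ` closure C"
        by (meson closure_minimal closure_subset compact_imp_closed image_mono)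
      also have "\<dots> \<subseteq> \<phi> ` C \<union> K" using cl \<phi>(3) by auto
      finally show "frontier (\<phi> ` C) \<subseteq> K"
        using op by (auto simp: frontier_def interior_open)
    qed
    moreover have "bounded (\<phi> ` C)"
    proof -
      have "compact (\<phi> ` closure C)"
        using \<phi>(2) cl C(2) by (meson compact_closure compact_continuous_image continuous_on_subset)
      then show ?thesis by (meson bounded_subset closure_subset compact_imp_bounded image_mono)
    qed
    ultimately show False using hK[of "\<phi> ` C"] im by (auto simp: holes_def)
  qed
qed

text \<open>A line is closed, and two points suffice to keep a given function away from it.\<close>

lemma not_multiple_separated:
  fixes u h :: "complex \<Rightarrow> complex"
  assumes "\<And>c. \<exists>z\<in>S. c * u z \<noteq> h z"
  obtains K e where "finite K" "K \<subseteq> S" "0 < e" "\<And>c. \<exists>z\<in>K. e \<le> cmod (c * u z - h z)"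
proof (cases "\<forall>z\<in>S. u z = 0")
  case True
  obtain z where "z \<in> S" "h z \<noteq> 0" using assms[of 0] by auto
  show ?thesis by (rule that[of "{z}" "cmod (h z)"]) (use True \<open>z \<in> S\<close> \<open>h z \<noteq> 0\<close> in auto)
next
  case False
  then obtain a where a: "a \<in> S" "u a \<noteq> 0" by blast
  obtain b where b: "b \<in> S" "h a / u a * u b \<noteq> h b" using assms by blast
  define d where "d = cmod (h a / u a * u b - h b)"
  define q where "q = cmod (u b) / cmod (u a)"
  have d: "d > 0" using b by (simp add: d_def)
  have q: "q \<ge> 0" by (simp add: q_def)
  show ?thesis
  proof (rule that[of "{a, b}" "d / (1 + q)"])
    fix c
    show "\<exists>z\<in>{a, b}. d / (1 + q) \<le> cmod (c * u z - h z)"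
    proof (rule ccontr)
      assume "\<not> ?thesis"
      then have 1: "cmod (c * u a - h a) < d / (1 + q)" "cmod (c * u b - h b) < d / (1 + q)" by auto
      have "(h a / u a * u b - h b) = (c * u b - h b) - (u b / u a) * (c * u a - h a)"
        using a by (simp add: field_simps)
      then have "d \<le> cmod (c * u b - h b) + cmod ((u b / u a) * (c * u a - h a))"
        unfolding d_def by (metis norm_triangle_ineq4)
      also have "\<dots> = cmod (c * u b - h b) + q * cmod (c * u a - h a)"
        by (simp add: norm_mult norm_divide q_def)
      also have "\<dots> < d / (1 + q) + q * (d / (1 + q))"
        using 1 q by (intro add_less_le_mono mult_left_mono) auto
      also have "\<dots> = (1 + q) * (d / (1 + q))" by (simp only: distrib_right mult_1)
      also have "\<dots> = d" using q by simp
      finally show False by simp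
    qed
  qed (use a b d q in auto)
qed

text \<open>The first \<open>N\<close> terms of the orbit span finitely many lines. Arbitrarily close to \<open>g\<close> there is a function outside all
of them, and it has a positive distance from each; a multiple of some \<open>u n\<close> that approximates it better than
this distance has \<open>n \<ge> N\<close>.\<close>

lemma supercyclic_vector_tail:
  fixes u :: "nat \<Rightarrow> complex \<Rightarrow> complex"
  assumes \<Omega>: "open \<Omega>" "\<Omega> \<noteq> {}"
    and dense: "\<And>g K e. g \<in> holo_funs \<Omega> \<Longrightarrow> compact K \<Longrightarrow> K \<subseteq> \<Omega> \<Longrightarrow> 0 < e \<Longrightarrow>
       \<exists>c n. \<forall>z\<in>K. cmod (c * u n z - g z) < e"
    and g: "g \<in> holo_funs \<Omega>" and K: "compact K" "K \<subseteq> \<Omega>" "0 < e"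
  shows "\<exists>c. \<exists>n\<ge>N. \<forall>z\<in>K. cmod (c * u n z - g z) < e"
proof (cases "\<forall>z\<in>\<Omega>. g z = 0")
  case True
  then show ?thesis using K by (intro exI[of _ 0] exI[of _ N]) auto
next
  case False
  \<comment> \<open>Moving along a direction \<open>q\<close> that is not proportional to \<open>g\<close>, the functions \<open>g + t q\<close> are pairwise not
    proportional, so each line contains at most one of them.\<close>
  obtain q where q: "q \<in> holo_funs \<Omega>" "\<And>c. \<exists>z\<in>\<Omega>. c * q z \<noteq> g z" "\<exists>z\<in>\<Omega>. q z \<noteq> 0"
  proof (cases "\<exists>c. \<forall>z\<in>\<Omega>. g z = c")
    case True
    then obtain c0 where c0: "\<And>z. z \<in> \<Omega> \<Longrightarrow> g z = c0" by blast
    obtain p where p: "p \<in> \<Omega>" using \<Omega> by blast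
    obtain d where d: "d > 0" "cball p d \<subseteq> \<Omega>" using \<Omega>(1) p open_contains_cball by blast
    have "p + of_real d \<in> cball p d" using d by (simp add: dist_norm)
    then have p': "p + of_real d \<in> \<Omega>" using d by blast
    have "(\<lambda>z. if z \<in> \<Omega> then z - p else 0) \<in> holo_funs \<Omega>"
      by (rule holo_funs_cut) (auto intro!: holomorphic_intros)
    moreover have "\<exists>z\<in>\<Omega>. c * (if z \<in> \<Omega> then z - p else 0) \<noteq> g z" for c
      using \<open>\<not> (\<forall>z\<in>\<Omega>. g z = 0)\<close> c0 p by (intro bexI[of _ p]) auto
    moreover have "\<exists>z\<in>\<Omega>. (if z \<in> \<Omega> then z - p else 0) \<noteq> 0"
      using p' d by (intro bexI[of _ "p + of_real d"]) auto
    ultimately show ?thesis using that by blast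
  next
    case False
    have "(\<lambda>z. if z \<in> \<Omega> then 1 else 0) \<in> holo_funs \<Omega>" by (rule holo_funs_cut) simp
    moreover have "\<exists>z\<in>\<Omega>. c * (if z \<in> \<Omega> then 1 else 0) \<noteq> g z" for c
      using False by (auto simp: eq_commute)
    moreover have "\<exists>z\<in>\<Omega>. (if z \<in> \<Omega> then 1 else 0) \<noteq> (0::complex)" using \<Omega>(2) by auto
    ultimately show ?thesis using that by blast
  qed
  define h where "h t = (\<lambda>z. g z + of_real t * q z)" for t :: real
  have hH: "h t \<in> holo_funs \<Omega>" for t
    using g q(1) by (auto simp: holo_funs_def h_def intro!: holomorphic_intros)
  define B where "B n = {t. \<exists>c. \<forall>z\<in>\<Omega>. c * u n z = h t z}" for n
  have eq: "s = t" if st: "s \<in> B n" "t \<in> B n" for s t n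
  proof (rule ccontr)
    assume ne: "s \<noteq> t"
    obtain c c' where c: "\<And>z. z \<in> \<Omega> \<Longrightarrow> c * u n z = h s z" "\<And>z. z \<in> \<Omega> \<Longrightarrow> c' * u n z = h t z"
      using st unfolding B_def by blast
    have d: "(c - c') * u n z = of_real (s - t) * q z" if "z \<in> \<Omega>" for z
      using c[OF that] by (simp add: h_def algebra_simps)
    have "c \<noteq> c'" using d q(3) ne by auto
    have "g z = (c * (of_real (s - t) / (c - c')) - of_real s) * q z" if "z \<in> \<Omega>" for z
    proof -
      have "u n z = of_real (s - t) / (c - c') * q z" using d[OF that] \<open>c \<noteq> c'\<close> by (simp add: field_simps)
      moreover have "g z = c * u n z - of_real s * q z" using c(1)[OF that] by (simp add: h_def)
      ultimately show ?thesis by (simp add: algebra_simps)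
    qed
    then show False using q(2) by metis
  qed
  have "finite (B n)" for n
  proof (cases "B n = {}")
    case False
    then obtain t where "t \<in> B n" by blast
    then have "B n \<subseteq> {t}" using eq by blast
    then show ?thesis using finite_subset by blast
  qed simp
  then have fin: "finite (\<Union>n<N. B n)" by blast
  have "compact (q ` K)"
    using q(1) K by (meson compact_continuous_image continuous_on_subset holo_funs_holomorphic holomorphic_on_imp_continuous_on)
  then obtain M where M: "M > 0" "\<And>z. z \<in> K \<Longrightarrow> cmod (q z) \<le> M"
    using compact_imp_bounded bounded_pos by (metis (no_types, lifting) imageI)
  have "infinite {0<..<e / (2 * M)}" using M K(3) by simp
  then obtain t where t: "t \<in> {0<..<e / (2 * M)}" "t \<notin> (\<Union>n<N. B n)"
    using fin by (meson finite_subset subsetI)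
  have "\<exists>L d. finite L \<and> L \<subseteq> \<Omega> \<and> 0 < d \<and> (\<forall>c. \<exists>z\<in>L. d \<le> cmod (c * u n z - h t z))" if "n < N" for n
  proof -
    have "\<exists>z\<in>\<Omega>. c * u n z \<noteq> h t z" for c using t(2) that unfolding B_def by auto
    from not_multiple_separated[of \<Omega> "u n" "h t", OF this] show ?thesis by metis
  qed
  then obtain L d where L: "\<And>n. n < N \<Longrightarrow> finite (L n)" "\<And>n. n < N \<Longrightarrow> L n \<subseteq> \<Omega>" "\<And>n. n < N \<Longrightarrow> 0 < d n"
    "\<And>n c. n < N \<Longrightarrow> \<exists>z\<in>L n. d n \<le> cmod (c * u n z - h t z)" by metis
  define \<epsilon> where "\<epsilon> = Min (insert (e / 2) (d ` {..<N}))"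
  have \<epsilon>: "0 < \<epsilon>" "\<epsilon> \<le> e / 2" "\<And>n. n < N \<Longrightarrow> \<epsilon> \<le> d n"
  proof -
    show "0 < \<epsilon>" using L(3) K(3) by (auto simp: \<epsilon>_def)
    show "\<epsilon> \<le> e / 2" unfolding \<epsilon>_def by (rule Min_le) simp_all
    show "\<epsilon> \<le> d n" if "n < N" for n unfolding \<epsilon>_def by (rule Min_le) (use that in auto)
  qed
  have "finite (\<Union>n<N. L n)" using L(1) by blast
  then have "compact (K \<union> (\<Union>n<N. L n))" by (intro compact_Un K(1) finite_imp_compact)
  moreover have "K \<union> (\<Union>n<N. L n) \<subseteq> \<Omega>" using K L(2) by blast
  ultimately obtain c n where
    cn: "\<And>z. z \<in> K \<union> (\<Union>n<N. L n) \<Longrightarrow> cmod (c * u n z - h t z) < \<epsilon>"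
    using dense[OF hH _ _ \<epsilon>(1), of "K \<union> (\<Union>n<N. L n)" t] by auto
  have "n \<ge> N"
  proof (rule ccontr)
    assume "\<not> n \<ge> N"
    then have n: "n < N" by simp
    obtain z where "z \<in> L n" "d n \<le> cmod (c * u n z - h t z)" using L(4)[OF n] by blast
    moreover from this have "cmod (c * u n z - h t z) < \<epsilon>" using cn n by blast
    ultimately show False using \<epsilon>(3)[OF n] by linarith
  qed
  moreover have "cmod (c * u n z - g z) < e" if z: "z \<in> K" for z
  proof -
    have "cmod (h t z - g z) = t * cmod (q z)" using t by (simp add: h_def norm_mult)
    also have "\<dots> \<le> t * M" using M(2)[OF z] t by (intro mult_left_mono) auto
    also have "\<dots> < e / 2" using t M by (simp add: field_simps)
    finally have "cmod (h t z - g z) < e / 2" .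
    moreover have "cmod (c * u n z - h t z) < e / 2" using cn[of z] z \<epsilon>(2) by force
    ultimately show ?thesis
      using norm_triangle_ineq[of "c * u n z - h t z" "h t z - g z"] by simp
  qed
  ultimately show ?thesis by blast
qed

lemma supercyclic_dense_range:
  assumes \<Omega>: "open \<Omega>" "\<Omega> \<noteq> {}" and hol: "\<omega> holomorphic_on \<Omega>" "\<psi> holomorphic_on \<Omega>" "\<psi> \<in> \<Omega> \<rightarrow> \<Omega>"
    and f: "f \<in> holo_funs \<Omega>"
    and dense: "\<And>g K e. g \<in> holo_funs \<Omega> \<Longrightarrow> compact K \<Longrightarrow> K \<subseteq> \<Omega> \<Longrightarrow> 0 < e \<Longrightarrow>
       \<exists>c n. \<forall>z\<in>K. cmod (c * (weighted_comp \<Omega> \<omega> \<psi> ^^ n) f z - g z) < e"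
    and g: "g \<in> holo_funs \<Omega>" and K: "compact K" "K \<subseteq> \<Omega>" "0 < e"
  shows "\<exists>f\<in>holo_funs \<Omega>. \<forall>z\<in>K. cmod (\<omega> z * f (\<psi> z) - g z) < e"
proof -
  let ?T = "weighted_comp \<Omega> \<omega> \<psi>"
  obtain c n where n: "n \<ge> 1" and cn: "\<forall>z\<in>K. cmod (c * (?T ^^ n) f z - g z) < e"
    using supercyclic_vector_tail[OF \<Omega> dense g K, of 1] by blast
  define h where "h = (\<lambda>z. c * (?T ^^ (n - 1)) f z)"
  have "(?T ^^ (n - 1)) f \<in> holo_funs \<Omega>" by (rule weighted_comp_funpow_holo_funs[OF hol f])
  then have "h \<in> holo_funs \<Omega>" by (auto simp: holo_funs_def h_def intro!: holomorphic_intros)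
  moreover have "\<omega> z * h (\<psi> z) = c * (?T ^^ n) f z" if "z \<in> K" for z
  proof -
    have "(?T ^^ n) f z = ?T ((?T ^^ (n - 1)) f) z" using n by (cases n) auto
    then show ?thesis using that K(2) by (auto simp: h_def weighted_comp_def)
  qed
  ultimately show ?thesis using cn by (intro bexI[of _ h]) auto
qed

section \<open>Normal families of self-maps\<close>

lemma uniform_limit_moving_point:
  fixes F :: "nat \<Rightarrow> 'a::metric_space \<Rightarrow> 'b::real_normed_vector"
  assumes "uniform_limit K F g sequentially" "continuous_on K g"
    and p: "\<And>n. p n \<in> K" "p \<longlonglongrightarrow> q" "q \<in> K"
  shows "(\<lambda>n. F n (p n)) \<longlonglongrightarrow> g q"
proof -
  have "(\<lambda>n. g (p n)) \<longlonglongrightarrow> g q"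
    using assms(2) p by (auto simp: continuous_on_sequentially o_def)
  then show ?thesis
  proof (rule Lim_transform)
    show "(\<lambda>n. F n (p n) - g (p n)) \<longlonglongrightarrow> 0"
    proof (rule tendstoI)
      fix e :: real assume "e > 0"
      then show "\<forall>\<^sub>F n in sequentially. dist (F n (p n) - g (p n)) 0 < e"
        using uniform_limitD[OF assms(1), of e] p(1) by (auto simp: dist_norm elim!: eventually_mono)
    qed
  qed
qed

text \<open>Hurwitz' theorem in a form that covers constant limits as well.\<close>

lemma limit_of_nonvanishing:
  fixes F :: "nat \<Rightarrow> complex \<Rightarrow> complex"
  assumes "open S" "connected S" "\<And>n. F n holomorphic_on S" "g holomorphic_on S"
    and "\<And>K. compact K \<Longrightarrow> K \<subseteq> S \<Longrightarrow> uniform_limit K F g sequentially"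
    and "\<And>n z. z \<in> S \<Longrightarrow> F n z \<noteq> 0" and "w \<in> S" "g w \<noteq> 0" "z \<in> S"
  shows "g z \<noteq> 0"
proof (cases "g constant_on S")
  case True
  then show ?thesis using assms(7-9) by (metis constant_on_def)
next
  case False
  show ?thesis by (rule Hurwitz_no_zeros[OF assms(1-5) False assms(6,9)])
qed

lemma normal_sequence_omitting_0_1:
  fixes F :: "nat \<Rightarrow> complex \<Rightarrow> complex"
  assumes S: "open S" "connected S" and hol: "\<And>n. F n holomorphic_on S"
    and om: "\<And>n z. z \<in> S \<Longrightarrow> F n z \<noteq> 0 \<and> F n z \<noteq> 1"
    and w: "w \<in> S" "\<And>n. cmod (F n w) \<le> 1"
  obtains g r where "g holomorphic_on S" "strict_mono (r :: nat \<Rightarrow> nat)"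
    "\<And>K. compact K \<Longrightarrow> K \<subseteq> S \<Longrightarrow> uniform_limit K (\<lambda>n. F (r n)) g sequentially"
proof -
  have bd: "\<exists>B. \<forall>h \<in> range F. \<forall>z \<in> K. norm (h z) \<le> B" if "compact K" "K \<subseteq> S" for K
  proof -
    show ?thesis
    proof (rule GPicard3[of S w "range F" "range F" K])
      fix B assume "\<And>h z. h \<in> range F \<Longrightarrow> z \<in> K \<Longrightarrow> cmod (h z) \<le> B"
      then show ?thesis by blast
    qed (use S hol om w that in auto)
  qed
  have hol': "h holomorphic_on S" if "h \<in> range F" for h using that hol by auto
  show ?thesis
  proof (rule Montel[of S "range F" F])
    fix g r assume "g holomorphic_on S" "strict_mono (r :: nat \<Rightarrow> nat)"
      "\<And>K. compact K \<Longrightarrow> K \<subseteq> S \<Longrightarrow> uniform_limit K (F \<circ> r) g sequentially"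
    then show ?thesis using that[of g r] by (simp add: o_def)
  qed (use S hol' bd in auto)
qed

text \<open>The values are controlled only at moving points \<open>p n\<close>, which may be assumed to converge to some \<open>q\<close>. After an affine
change the omitted values are 0 and 1. If infinitely many values at \<open>q\<close> are bounded by 1, Schottky and Montel apply
at once. Otherwise they apply to the reciprocals; the limit \<open>k\<close> of these does not vanish at \<open>q\<close>, since the values at
\<open>p n\<close> are bounded, hence vanishes nowhere by Hurwitz, and can be inverted again.\<close>

lemma normal_sequence_omitting_two:
  fixes F :: "nat \<Rightarrow> complex \<Rightarrow> complex"
  assumes S: "open S" "connected S" and hol: "\<And>n. F n holomorphic_on S"
    and ab: "a \<noteq> b" "\<And>n z. z \<in> S \<Longrightarrow> F n z \<noteq> a \<and> F n z \<noteq> b"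
    and K: "compact K" "K \<subseteq> S" "\<And>n. p n \<in> K" "\<And>n. cmod (F n (p n)) \<le> B"
  obtains g r where "g holomorphic_on S" "strict_mono (r :: nat \<Rightarrow> nat)"
    "\<And>K. compact K \<Longrightarrow> K \<subseteq> S \<Longrightarrow> uniform_limit K (\<lambda>n. F (r n)) g sequentially"
proof -
  obtain q s where q: "q \<in> K" "strict_mono (s :: nat \<Rightarrow> nat)" "(p \<circ> s) \<longlonglongrightarrow> q"
    using K(1)[unfolded compact_def, rule_format, of p] K(3) by auto
  then have qS: "q \<in> S" using K by blast
  define H where "H n z = (F (s n) z - a) / (b - a)" for n z
  have H: "H n holomorphic_on S" for n
    unfolding H_def using hol ab by (intro holomorphic_intros) auto
  have Hom: "H n z \<noteq> 0 \<and> H n z \<noteq> 1" if "z \<in> S" for n z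
    using ab(1) ab(2)[OF that, of "s n"] by (auto simp: H_def)
  have "\<exists>g r. g holomorphic_on S \<and> strict_mono (r :: nat \<Rightarrow> nat) \<and>
    (\<forall>K. compact K \<and> K \<subseteq> S \<longrightarrow> uniform_limit K (\<lambda>n. H (r n)) g sequentially)"
  proof (cases "\<exists>\<^sub>\<infinity>n. cmod (H n q) \<le> 1")
    case True
    then obtain r0 where r0: "strict_mono (r0 :: nat \<Rightarrow> nat)" "\<And>n. cmod (H (r0 n) q) \<le> 1"
      by (metis (mono_tags) INFM_nat_le infinite_enumerate mem_Collect_eq INFM_iff_infinite)
    obtain g r where "g holomorphic_on S" "strict_mono (r :: nat \<Rightarrow> nat)"
      "\<And>K. compact K \<Longrightarrow> K \<subseteq> S \<Longrightarrow> uniform_limit K (\<lambda>n. H (r0 (r n))) g sequentially"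
      by (rule normal_sequence_omitting_0_1[OF S, of "\<lambda>n. H (r0 n)" q]) (use H Hom r0 qS in auto)
    moreover have "strict_mono (r0 \<circ> r)" using r0 calculation strict_mono_o by blast
    ultimately show ?thesis by (intro exI[of _ g] exI[of _ "r0 \<circ> r"]) auto
  next
    case False
    obtain m where m: "\<And>n. n \<ge> m \<Longrightarrow> cmod (H n q) > 1"
      using False unfolding INFM_nat_le by (metis not_le)
    define G where "G n z = inverse (H (m + n) z)" for n z
    have Ghol: "G n holomorphic_on S" for n
      unfolding G_def using H Hom by (intro holomorphic_intros) auto
    have Gom: "G n z \<noteq> 0 \<and> G n z \<noteq> 1" if "z \<in> S" for n z
      using Hom[OF that, of "m + n"] by (auto simp: G_def)
    have Gq: "cmod (G n q) \<le> 1" for n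
      using m[of "m + n"] by (simp add: G_def norm_inverse inverse_le_1_iff)
    obtain k r where k: "k holomorphic_on S" "strict_mono (r :: nat \<Rightarrow> nat)"
      "\<And>K. compact K \<Longrightarrow> K \<subseteq> S \<Longrightarrow> uniform_limit K (\<lambda>n. G (r n)) k sequentially"
      by (rule normal_sequence_omitting_0_1[of S G q]) (use S Ghol Gom qS Gq in auto)
    define C where "C = (B + cmod a) / cmod (b - a)"
    have C: "cmod (H n (p (s n))) \<le> C" for n
      using K(4)[of "s n"] norm_triangle_ineq4[of "F (s n) (p (s n))" a]
      by (auto simp: H_def C_def norm_divide intro!: divide_right_mono)
    have "0 < cmod (H 0 (p (s 0)))" using Hom[of "p (s 0)" 0] K by auto
    then have Cpos: "C > 0" using C[of 0] by linarith
    have "(\<lambda>n. G (r n) (p (s (m + r n)))) \<longlonglongrightarrow> k q"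
    proof (rule uniform_limit_moving_point[of "\<lambda>n. G (r n)" K k "\<lambda>n. p (s (m + r n))" q])
      show "uniform_limit K (\<lambda>n. G (r n)) k sequentially" by (rule k(3)[OF K(1,2)])
      show "continuous_on K k" using k(1) K(2) continuous_on_subset holomorphic_on_imp_continuous_on by blast
      have "strict_mono (\<lambda>n. m + r n)" using k(2) by (auto simp: strict_mono_def)
      from LIMSEQ_subseq_LIMSEQ[OF q(3) this] show "(\<lambda>n. p (s (m + r n))) \<longlonglongrightarrow> q" by (simp add: o_def)
    qed (use K q in auto)
    moreover have Gge: "1 / C \<le> cmod (G (r n) (p (s (m + r n))))" for n
    proof -
      have "0 < cmod (H (m + r n) (p (s (m + r n))))" using Hom K by (simp add: subset_iff)
      from le_imp_inverse_le[OF C[of "m + r n"] this] show ?thesis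
        by (simp only: G_def norm_inverse inverse_eq_divide[symmetric])
    qed
    ultimately have "1 / C \<le> cmod (k q)"
      by (intro Lim_norm_lbound[OF sequentially_bot]) auto
    then have kq: "k q \<noteq> 0" using Cpos by auto
    have kz: "k z \<noteq> 0" if "z \<in> S" for z
      by (rule limit_of_nonvanishing[where F = "\<lambda>n. G (r n)" and S = S and g = k and w = q])
        (use S k Ghol Gom qS kq that in auto)
    have ul: "uniform_limit L (\<lambda>n. H (m + r n)) (\<lambda>z. inverse (k z)) sequentially" if L: "compact L" "L \<subseteq> S" for L
    proof (cases "L = {}")
      case False
      have "continuous_on L (\<lambda>z. cmod (k z))"
        using continuous_on_subset[OF holomorphic_on_imp_continuous_on[OF k(1)] L(2)] by (rule continuous_on_norm)
      then obtain x where x: "x \<in> L" "\<And>y. y \<in> L \<Longrightarrow> cmod (k x) \<le> cmod (k y)"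
        using continuous_attains_inf[OF L(1) False] by blast
      have "uniform_limit L (\<lambda>n z. inverse (G (r n) z)) (inverse \<circ> k) sequentially"
        by (rule uniform_lim_inverse[OF k(3)[OF L] x(2)]) (use x L kz in auto)
      then show ?thesis by (simp add: G_def o_def)
    qed simp
    show ?thesis
    proof (intro exI conjI allI impI)
      show "(\<lambda>z. inverse (k z)) holomorphic_on S" using k(1) kz by (intro holomorphic_intros) auto
      show "strict_mono (\<lambda>n. m + r n)" using k(2) by (auto simp: strict_mono_def)
    qed (use ul in auto)
  qed
  then obtain g r where g: "g holomorphic_on S" "strict_mono (r :: nat \<Rightarrow> nat)"
    "\<And>K. compact K \<Longrightarrow> K \<subseteq> S \<Longrightarrow> uniform_limit K (\<lambda>n. H (r n)) g sequentially" by blast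
  show ?thesis
  proof
    show "(\<lambda>z. (b - a) * g z + a) holomorphic_on S" using g(1) by (intro holomorphic_intros)
    show "strict_mono (s \<circ> r)" using g(2) q(2) strict_mono_o by blast
    fix K assume "compact K" "K \<subseteq> S"
    from g(3)[OF this] have "uniform_limit K (\<lambda>n z. (b - a) * H (r n) z + a) (\<lambda>z. (b - a) * g z + a) sequentially"
      by (intro uniform_limit_intros bounded_linear.uniform_limit[OF bounded_linear_mult_right])
    then show "uniform_limit K (\<lambda>n. F ((s \<circ> r) n)) (\<lambda>z. (b - a) * g z + a) sequentially"
      using ab(1) by (simp add: H_def)
  qed
qed

text \<open>A limit that takes one value in \<open>S\<close> takes all its values there, since each \<open>c \<notin> S\<close> is omitted by the whole
sequence and hence, by Hurwitz, by the limit.\<close>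

lemma selfmap_sequence_limit:
  fixes F :: "nat \<Rightarrow> complex \<Rightarrow> complex"
  assumes S: "open S" "connected S" and hol: "\<And>n. F n holomorphic_on S" "\<And>n. F n \<in> S \<rightarrow> S"
    and ab: "a \<noteq> b" "a \<notin> S" "b \<notin> S"
    and K: "compact K" "K \<subseteq> S" "\<And>n. p n \<in> K" and L: "compact L" "L \<subseteq> S" "\<And>n. F n (p n) \<in> L"
  obtains g r where "g holomorphic_on S" "g \<in> S \<rightarrow> S" "strict_mono (r :: nat \<Rightarrow> nat)"
    "\<And>K. compact K \<Longrightarrow> K \<subseteq> S \<Longrightarrow> uniform_limit K (\<lambda>n. F (r n)) g sequentially"
proof -
  obtain B where B: "\<And>x. x \<in> L \<Longrightarrow> cmod x \<le> B"
    using compact_imp_bounded[OF L(1)] by (auto simp: bounded_iff)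
  obtain g r where g: "g holomorphic_on S" "strict_mono (r :: nat \<Rightarrow> nat)"
    "\<And>K. compact K \<Longrightarrow> K \<subseteq> S \<Longrightarrow> uniform_limit K (\<lambda>n. F (r n)) g sequentially"
  proof (rule normal_sequence_omitting_two[of S F a b K p B])
    show "F n z \<noteq> a \<and> F n z \<noteq> b" if "z \<in> S" for n z using hol(2)[of n] that ab by auto
    show "cmod (F n (p n)) \<le> B" for n using B L(3) by blast
  qed (use S hol ab K in auto)
  have "\<forall>n. p (r n) \<in> K" using K by blast
  then obtain q s where q: "q \<in> K" "strict_mono (s :: nat \<Rightarrow> nat)" "((\<lambda>n. p (r n)) \<circ> s) \<longlonglongrightarrow> q"
    using K(1)[unfolded compact_def, rule_format, of "\<lambda>n. p (r n)"] K(3) by auto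
  have lim: "(\<lambda>n. F (r (s n)) (p (r (s n)))) \<longlonglongrightarrow> g q"
  proof (rule uniform_limit_moving_point[of "\<lambda>n. F (r (s n))" K g "\<lambda>n. p (r (s n))" q])
    show "uniform_limit K (\<lambda>n. F (r (s n))) g sequentially"
      by (rule filterlim_compose[OF g(3)[OF K(1,2)] filterlim_subseq[OF q(2)]])
    show "continuous_on K g" using g(1) K(2) continuous_on_subset holomorphic_on_imp_continuous_on by blast
  qed (use K q in \<open>auto simp: o_def\<close>)
  have "g q \<in> L"
    by (rule Lim_in_closed_set[OF compact_imp_closed[OF L(1)] _ sequentially_bot lim]) (use L(3) in auto)
  then have gq: "g q \<in> S" "q \<in> S" using L q K by auto
  have gS: "g z \<in> S" if z: "z \<in> S" for z
  proof (rule ccontr)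
    define c where "c = g z"
    assume "g z \<notin> S"
    then have c: "c \<notin> S" by (simp add: c_def)
    have "g z - c \<noteq> 0"
    proof (rule limit_of_nonvanishing[OF S, of "\<lambda>n z. F (r n) z - c" "\<lambda>z. g z - c" q z])
      show "uniform_limit K (\<lambda>n z. F (r n) z - c) (\<lambda>z. g z - c) sequentially" if "compact K" "K \<subseteq> S" for K
        by (intro uniform_limit_intros g(3) that)
      show "F (r n) z - c \<noteq> 0" if "z \<in> S" for n z using hol(2)[of "r n"] that c by auto
    qed (use hol g gq z c in \<open>auto intro!: holomorphic_intros\<close>)
    then show False by (simp add: c_def)
  qed
  show ?thesis by (rule that[OF g(1) _ g(2) g(3)]) (use gS in auto)
qed

lemma uniform_limit_selfmap_comp:
  fixes F :: "nat \<Rightarrow> complex \<Rightarrow> complex"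
  assumes "open S" "g holomorphic_on S"
    and "\<And>K. compact K \<Longrightarrow> K \<subseteq> S \<Longrightarrow> uniform_limit K F g sequentially"
    and "p \<longlonglongrightarrow> q" "q \<in> S"
  shows "(\<lambda>n. F n (p n)) \<longlonglongrightarrow> g q"
proof -
  obtain d where d: "d > 0" "cball q d \<subseteq> S" using assms open_contains_cball by blast
  then obtain N where N: "\<And>n. n \<ge> N \<Longrightarrow> p n \<in> cball q d"
    using tendstoD[OF assms(4) d(1)] unfolding eventually_sequentially
    by (metis dist_commute less_imp_le mem_cball)
  have "(\<lambda>n. F (n + N) (p (n + N))) \<longlonglongrightarrow> g q"
  proof (rule uniform_limit_moving_point[of "\<lambda>n. F (n + N)" "cball q d" g "\<lambda>n. p (n + N)" q])
    show "uniform_limit (cball q d) (\<lambda>n. F (n + N)) g sequentially"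
      by (rule filterlim_compose[OF assms(3)[OF compact_cball d(2)] filterlim_add_const_nat_at_top])
    show "continuous_on (cball q d) g"
      using assms(2) d(2) continuous_on_subset holomorphic_on_imp_continuous_on by blast
    show "(\<lambda>n. p (n + N)) \<longlonglongrightarrow> q" using assms(4) LIMSEQ_ignore_initial_segment by blast
  qed (use N d in auto)
  then show ?thesis by (rule LIMSEQ_offset)
qed

section \<open>Supercyclic symbols run away\<close>

text \<open>At a fixed point \<open>c\<close> the pair of value and derivative of \<open>T\<^sup>n f\<close> evolves by a triangular linear recursion, and
\<open>\<bar>\<psi>'(c)\<bar> < 1\<close> keeps the quotient of derivative and value bounded by a constant \<open>M\<close>. Since locally uniform
convergence carries over to derivatives, no function whose quotient is \<open>M + 1\<close> can be approximated.\<close>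

lemma attracting_fixed_point_not_supercyclic:
  fixes \<omega> \<psi> :: "complex \<Rightarrow> complex"
  assumes \<Omega>: "open \<Omega>" and hol: "\<omega> holomorphic_on \<Omega>" "\<psi> holomorphic_on \<Omega>" "\<psi> \<in> \<Omega> \<rightarrow> \<Omega>"
    and nz: "\<And>z. z \<in> \<Omega> \<Longrightarrow> \<omega> z \<noteq> 0"
    and c: "c \<in> \<Omega>" "\<psi> c = c" "cmod (deriv \<psi> c) < 1"
    and f: "f \<in> holo_funs \<Omega>"
    and dense: "\<And>g K e. g \<in> holo_funs \<Omega> \<Longrightarrow> compact K \<Longrightarrow> K \<subseteq> \<Omega> \<Longrightarrow> 0 < e \<Longrightarrow>
       \<exists>c n. \<forall>z\<in>K. cmod (c * (weighted_comp \<Omega> \<omega> \<psi> ^^ n) f z - g z) < e"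
  shows False
proof -
  define t where "t n = (weighted_comp \<Omega> \<omega> \<psi> ^^ n) f" for n
  define l where "l = cmod (deriv \<psi> c)"
  have tH: "t n holomorphic_on \<Omega>" for n
    using weighted_comp_funpow_holo_funs[OF hol f] unfolding t_def by (rule holo_funs_holomorphic)
  have tS: "t (Suc n) z = \<omega> z * t n (\<psi> z)" if "z \<in> \<Omega>" for n z
    using that by (simp add: t_def weighted_comp_def)
  have val: "t (Suc n) c = \<omega> c * t n c" for n using tS[OF c(1)] c(2) by simp
  have der: "deriv (t (Suc n)) c = deriv \<omega> c * t n c + \<omega> c * (deriv (t n) c * deriv \<psi> c)" for n
  proof -
    have d\<psi>: "(\<psi> has_field_derivative deriv \<psi> c) (at c)" and d\<omega>: "(\<omega> has_field_derivative deriv \<omega> c) (at c)"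
      using hol \<Omega> c(1) holomorphic_derivI by blast+
    have dt: "(t n has_field_derivative deriv (t n) c) (at (\<psi> c))"
      using tH \<Omega> c(1,2) holomorphic_derivI by metis
    have "((\<lambda>z. t n (\<psi> z)) has_field_derivative deriv (t n) c * deriv \<psi> c) (at c)"
      using DERIV_chain2[OF dt d\<psi>] .
    from DERIV_mult[OF d\<omega> this]
    have "((\<lambda>z. \<omega> z * t n (\<psi> z)) has_field_derivative
        deriv \<omega> c * t n c + \<omega> c * (deriv (t n) c * deriv \<psi> c)) (at c)"
      using c(2) by (simp add: algebra_simps)
    then have "(t (Suc n) has_field_derivative
        deriv \<omega> c * t n c + \<omega> c * (deriv (t n) c * deriv \<psi> c)) (at c)"
      by (rule has_field_derivative_transform_within_open[OF _ \<Omega> c(1)]) (simp add: tS)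
    then show ?thesis by (rule DERIV_imp_deriv)
  qed
  have fc: "f c \<noteq> 0"
  proof
    assume f0: "f c = 0"
    have "t n c = 0" for n by (induction n) (simp_all add: val f0, simp add: t_def f0)
    moreover have "(\<lambda>z. if z \<in> \<Omega> then 1 else 0) \<in> holo_funs \<Omega>" by (rule holo_funs_cut) simp
    from dense[OF this, of "{c}" 1] obtain a n where "cmod (a * t n c - 1) < 1"
      using c(1) by (auto simp: t_def)
    ultimately show False by simp
  qed
  \<comment> \<open>The first entry makes the bound true for \<open>n = 0\<close>; the second makes it survive the recursion \<open>der\<close>.\<close>
  define M where "M = max (cmod (deriv f c) / cmod (f c)) (cmod (deriv \<omega> c) / (cmod (\<omega> c) * (1 - l)))"
  have l: "0 \<le> l" "l < 1" using c(3) by (auto simp: l_def)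
  have wc: "cmod (\<omega> c) > 0" using nz c(1) by simp
  have M1: "cmod (deriv f c) \<le> M * cmod (f c)"
    using fc by (simp add: M_def field_simps max_def)
  have M2: "cmod (deriv \<omega> c) \<le> M * (cmod (\<omega> c) * (1 - l))"
  proof -
    have "cmod (deriv \<omega> c) / (cmod (\<omega> c) * (1 - l)) \<le> M" by (simp add: M_def)
    moreover have "0 < cmod (\<omega> c) * (1 - l)" using wc l by simp
    ultimately show ?thesis by (simp only: pos_divide_le_eq)
  qed
  have "0 \<le> cmod (deriv f c) / cmod (f c)" by simp
  also have "\<dots> \<le> M" unfolding M_def by (rule max.cobounded1)
  finally have M0: "0 \<le> M" .
  have bound: "cmod (deriv (t n) c) \<le> M * cmod (t n c)" for n
  proof (induction n)
    case 0
    show ?case using M1 by (simp add: t_def)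
  next
    case (Suc n)
    have "cmod (deriv (t (Suc n)) c) \<le> cmod (deriv \<omega> c) * cmod (t n c) + cmod (\<omega> c) * (cmod (deriv (t n) c) * l)"
      unfolding der l_def by (metis norm_mult norm_triangle_ineq)
    also have "\<dots> \<le> M * (cmod (\<omega> c) * (1 - l)) * cmod (t n c) + cmod (\<omega> c) * (M * cmod (t n c) * l)"
      using M2 Suc l(1) by (intro add_mono mult_left_mono mult_right_mono) auto
    also have "\<dots> = M * cmod (t (Suc n) c)" by (simp add: val norm_mult algebra_simps)
    finally show ?case .
  qed
  obtain r where r: "r > 0" "cball c r \<subseteq> \<Omega>" using \<Omega> c(1) open_contains_cball by blast
  define g where "g z = 1 + of_real (M + 1) * (z - c)" for z
  have gH: "(\<lambda>z. if z \<in> \<Omega> then g z else 0) \<in> holo_funs \<Omega>"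
    by (rule holo_funs_cut) (auto simp: g_def intro!: holomorphic_intros)
  have "\<exists>a n. \<forall>z\<in>cball c r. cmod (a * t n z - g z) < 1 / real (Suc j)" for j
  proof -
    obtain a n where an: "\<forall>z\<in>cball c r. cmod (a * t n z - (if z \<in> \<Omega> then g z else 0)) < 1 / real (Suc j)"
      using dense[OF gH compact_cball r(2), of "1 / real (Suc j)"] by (auto simp: t_def)
    show ?thesis by (rule exI[of _ a], rule exI[of _ n]) (use an r(2) in \<open>auto simp: subset_iff\<close>)
  qed
  then obtain a n where an: "\<And>j z. z \<in> cball c r \<Longrightarrow> cmod (a j * t (n j) z - g z) < 1 / real (Suc j)"
    by metis
  define u where "u j z = a j * t (n j) z" for j z
  have lim1: "(\<lambda>j. 1 / real (Suc j)) \<longlonglongrightarrow> 0"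
    using LIMSEQ_inverse_real_of_nat by (simp add: inverse_eq_divide)
  have ul: "uniform_limit (cball c r) u g sequentially"
  proof (rule uniform_limitI)
    fix e :: real assume "e > 0"
    then have "\<forall>\<^sub>F j in sequentially. 1 / real (Suc j) < e"
      using order_tendstoD(2)[OF lim1] by blast
    then show "\<forall>\<^sub>F j in sequentially. \<forall>z\<in>cball c r. dist (u j z) (g z) < e"
    proof eventually_elim
      case (elim j)
      then show ?case using less_trans[OF an] by (simp add: u_def dist_norm)
    qed
  qed
  have uH: "u j holomorphic_on ball c r" for j
    unfolding u_def using tH r(2)
    by (intro holomorphic_intros) (meson ball_subset_cball holomorphic_on_subset order_trans)
  have "(\<lambda>j. deriv (u j) c) \<longlonglongrightarrow> deriv g c"
    by (rule deriv_complex_uniform_limit[OF uniform_limit_on_subset[OF ul ball_subset_cball] _ sequentially_bot open_ball])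
      (use uH r in auto)
  moreover have "(\<lambda>j. u j c) \<longlonglongrightarrow> g c"
    using tendsto_uniform_limitI[OF ul, of c] r by simp
  moreover have "cmod (deriv (u j) c) \<le> M * cmod (u j c)" for j
  proof -
    have "deriv (u j) c = a j * deriv (t (n j)) c"
      unfolding u_def using tH \<Omega> c(1) by (intro deriv_cmult) (meson holomorphic_on_imp_differentiable_at)
    then show ?thesis using mult_left_mono[OF bound[of "n j"], of "cmod (a j)"]
      by (simp add: u_def norm_mult algebra_simps)
  qed
  ultimately have "cmod (deriv g c) \<le> M * cmod (g c)"
    by (intro LIMSEQ_le[OF tendsto_norm tendsto_mult[OF tendsto_const tendsto_norm]]) auto
  moreover have "deriv g c = of_real (M + 1)"
    unfolding g_def[abs_def] by (rule DERIV_imp_deriv) (auto intro!: derivative_eq_intros)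
  ultimately show False using M0 by (simp add: g_def del: of_real_add)
qed

text \<open>Let the ball around \<open>p\<close> be visited by the orbit of \<open>p\<close> at the times in \<open>N\<close>. The gaps between consecutive times in \<open>N\<close>
are bounded: otherwise some limit point \<open>y\<close> of the orbit never enters the ball again, while normality and the
recurrence of \<open>p\<close> together produce iterates carrying \<open>y\<close> arbitrarily close to \<open>p\<close>. With gaps bounded by \<open>L\<close>, the first
\<open>L\<close> images of the closed ball contain the whole orbit.\<close>

lemma recurrent_orbit_relatively_compact:
  fixes \<psi> :: "complex \<Rightarrow> complex"
  assumes \<Omega>: "open \<Omega>" "connected \<Omega>" and hol: "\<psi> holomorphic_on \<Omega>" "\<psi> \<in> \<Omega> \<rightarrow> \<Omega>"
    and ab: "a \<noteq> b" "a \<notin> \<Omega>" "b \<notin> \<Omega>"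
    and p: "p \<in> \<Omega>" and M: "\<And>k::nat. M k \<ge> k" "(\<lambda>k. (\<psi> ^^ M k) p) \<longlonglongrightarrow> p"
  obtains S where "compact S" "S \<subseteq> \<Omega>" "\<And>n. (\<psi> ^^ n) p \<in> S"
proof -
  obtain r where r: "r > 0" "cball p r \<subseteq> \<Omega>" using \<Omega> p open_contains_cball by blast
  have hn: "(\<psi> ^^ n) holomorphic_on \<Omega>" and sn: "(\<psi> ^^ n) \<in> \<Omega> \<rightarrow> \<Omega>" for n
    using funpow_holomorphic[OF hol] funpow_in[OF hol(2)] by auto
  define N where "N = {n. (\<psi> ^^ n) p \<in> ball p r}"
  have "\<exists>L. \<forall>n\<in>N. \<exists>i\<in>{1..L}. n + i \<in> N"
  proof (rule ccontr)
    assume "\<not> ?thesis"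
    then have "\<forall>L. \<exists>n\<in>N. \<forall>i\<in>{1..L}. n + i \<notin> N" by blast
    then obtain n where n: "\<And>L. n L \<in> N" "\<And>L i. i \<in> {1..L} \<Longrightarrow> n L + i \<notin> N" by metis
    obtain x s where x: "x holomorphic_on \<Omega>" "x \<in> \<Omega> \<rightarrow> \<Omega>" "strict_mono (s :: nat \<Rightarrow> nat)"
      "\<And>K. compact K \<Longrightarrow> K \<subseteq> \<Omega> \<Longrightarrow> uniform_limit K (\<lambda>L. \<psi> ^^ n (s L)) x sequentially"
    proof (rule selfmap_sequence_limit[of \<Omega> "\<lambda>L. \<psi> ^^ n L" a b "{p}" "\<lambda>_. p" "cball p r"])
      show "(\<psi> ^^ n k) p \<in> cball p r" for k using n(1)[of k] by (simp add: N_def less_imp_le)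
    qed (use \<Omega> hn sn ab p r in auto)
    define y where "y = x p"
    have y: "y \<in> \<Omega>" using x(2) p by (auto simp: y_def)
    have lim: "(\<lambda>L. (\<psi> ^^ n (s L)) p) \<longlonglongrightarrow> y"
      unfolding y_def by (rule tendsto_uniform_limitI[OF x(4)[of "{p}"]]) (use p in auto)
    have out: "(\<psi> ^^ i) y \<in> - ball p r" if "i \<ge> 1" for i
    proof (rule Lim_in_closed_set[OF _ _ sequentially_bot])
      have "isCont (\<psi> ^^ i) y"
        using hn y \<Omega>(1) by (meson continuous_on_eq_continuous_at holomorphic_on_imp_continuous_on)
      then show "(\<lambda>L. (\<psi> ^^ i) ((\<psi> ^^ n (s L)) p)) \<longlonglongrightarrow> (\<psi> ^^ i) y"
        using lim by (rule isCont_tendsto_compose)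
      show "\<forall>\<^sub>F L in sequentially. (\<psi> ^^ i) ((\<psi> ^^ n (s L)) p) \<in> - ball p r"
        unfolding eventually_sequentially
      proof (intro exI[of _ i] allI impI)
        fix L assume "L \<ge> i"
        then have "i \<le> s L" using x(3) seq_suble le_trans by blast
        then have "n (s L) + i \<notin> N" using n(2)[of i "s L"] that by simp
        then show "(\<psi> ^^ i) ((\<psi> ^^ n (s L)) p) \<in> - ball p r"
          by (simp add: N_def funpow_add add.commute)
      qed
    qed auto
    \<comment> \<open>The time \<open>M (k L)\<close> comes after \<open>n (s L)\<close>, so \<open>i L\<close> further steps lead from \<open>\<psi>\<^sub>n(p)\<close>, which is near \<open>y\<close>, back to \<open>p\<close>.\<close>
    define k where "k L = n (s L) + 1 + L" for L
    define i where "i L = M (k L) - n (s L)" for L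
    have iL: "i L \<ge> 1" "i L + n (s L) = M (k L)" for L
      using M(1)[of "k L"] by (auto simp: i_def k_def)
    have kinf: "filterlim k at_top sequentially"
      by (rule filterlim_at_top_mono[OF filterlim_ident]) (auto simp: k_def)
    have lp: "(\<lambda>L. (\<psi> ^^ i L) ((\<psi> ^^ n (s L)) p)) \<longlonglongrightarrow> p"
      using filterlim_compose[OF M(2) kinf] by (simp flip: iL(2) add: funpow_add)
    obtain h s' where h: "h holomorphic_on \<Omega>" "h \<in> \<Omega> \<rightarrow> \<Omega>" "strict_mono (s' :: nat \<Rightarrow> nat)"
      "\<And>K. compact K \<Longrightarrow> K \<subseteq> \<Omega> \<Longrightarrow> uniform_limit K (\<lambda>L. \<psi> ^^ i (s' L)) h sequentially"
    proof (rule selfmap_sequence_limit[of \<Omega> "\<lambda>L. \<psi> ^^ i L" a b "cball p r" "\<lambda>L. (\<psi> ^^ n (s L)) p"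
          "insert p (range (\<lambda>L. (\<psi> ^^ i L) ((\<psi> ^^ n (s L)) p)))"])
      show "compact (insert p (range (\<lambda>L. (\<psi> ^^ i L) ((\<psi> ^^ n (s L)) p))))"
        by (rule compact_sequence_with_limit[OF lp])
      show "insert p (range (\<lambda>L. (\<psi> ^^ i L) ((\<psi> ^^ n (s L)) p))) \<subseteq> \<Omega>"
        using p funpow_in[OF hol(2)] by auto
      show "(\<psi> ^^ n (s L)) p \<in> cball p r" for L using n(1)[of "s L"] by (simp add: N_def less_imp_le)
    qed (use \<Omega> hn sn ab p r in auto)
    have "(\<lambda>L. (\<psi> ^^ i (s' L)) ((\<psi> ^^ n (s (s' L))) p)) \<longlonglongrightarrow> h y"
      by (rule uniform_limit_selfmap_comp[OF \<Omega>(1) h(1,4) _ y])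
        (use LIMSEQ_subseq_LIMSEQ[OF lim h(3)] in \<open>auto simp: o_def\<close>)
    moreover have "(\<lambda>L. (\<psi> ^^ i (s' L)) ((\<psi> ^^ n (s (s' L))) p)) \<longlonglongrightarrow> p"
      using LIMSEQ_subseq_LIMSEQ[OF lp h(3)] by (simp add: o_def)
    ultimately have "h y = p" using LIMSEQ_unique by blast
    moreover have "(\<lambda>L. (\<psi> ^^ i (s' L)) y) \<longlonglongrightarrow> h y"
      by (rule tendsto_uniform_limitI[OF h(4)[of "{y}"]]) (use y in auto)
    then have "h y \<in> - ball p r"
      by (rule Lim_in_closed_set[rotated 3]) (use out iL in auto)
    ultimately show False using r(1) by simp
  qed
  then obtain L where L: "\<And>n. n \<in> N \<Longrightarrow> \<exists>i\<in>{1..L}. n + i \<in> N" by blast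
  have N: "\<exists>n'\<in>N. n' \<le> n \<and> n \<le> n' + L" for n
  proof (induction n)
    case 0
    have "0 \<in> N" using r(1) by (simp add: N_def)
    then show ?case by blast
  next
    case (Suc n)
    then obtain n' where n': "n' \<in> N" "n' \<le> n" "n \<le> n' + L" by blast
    show ?case
    proof (cases "Suc n \<le> n' + L")
      case True
      then show ?thesis using n' by (intro bexI[of _ n']) auto
    next
      case False
      obtain i where "i \<in> {1..L}" "n' + i \<in> N" using L[OF n'(1)] by blast
      then show ?thesis using False n' by (intro bexI[of _ "n' + i"]) auto
    qed
  qed
  define S where "S = (\<Union>i\<in>{..L}. (\<psi> ^^ i) ` cball p r)"
  show ?thesis
  proof
    have "compact ((\<psi> ^^ i) ` cball p r)" for i
      using hn r(2) by (meson compact_cball compact_continuous_image continuous_on_subset holomorphic_on_imp_continuous_on)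
    then show "compact S" unfolding S_def by (intro compact_UN) auto
    show "S \<subseteq> \<Omega>" unfolding S_def using funpow_in[OF hol(2)] r(2) by auto
    fix n
    obtain n' where n': "n' \<in> N" "n' \<le> n" "n \<le> n' + L" using N by blast
    have "(\<psi> ^^ n) p = (\<psi> ^^ (n - n')) ((\<psi> ^^ n') p)"
      using n'(2) by (metis comp_apply funpow_add le_add_diff_inverse2)
    moreover have "(\<psi> ^^ n') p \<in> cball p r" using n'(1) by (simp add: N_def less_imp_le)
    ultimately show "(\<psi> ^^ n) p \<in> S" unfolding S_def using n'(3) by (intro UN_I[of "n - n'"]) auto
  qed
qed

text \<open>All multiples of zero-free functions \<open>T\<^sup>n f\<close> are zero-free, so by Hurwitz they could not approximate \<open>z - q\<close>
near \<open>q\<close>.\<close>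

lemma supercyclic_vector_has_zero:
  fixes \<omega> \<psi> :: "complex \<Rightarrow> complex"
  assumes \<Omega>: "open \<Omega>" "\<Omega> \<noteq> {}" and hol: "\<omega> holomorphic_on \<Omega>" "\<psi> holomorphic_on \<Omega>" "\<psi> \<in> \<Omega> \<rightarrow> \<Omega>"
    and nz: "\<And>z. z \<in> \<Omega> \<Longrightarrow> \<omega> z \<noteq> 0"
    and f: "f \<in> holo_funs \<Omega>"
    and dense: "\<And>g K e. g \<in> holo_funs \<Omega> \<Longrightarrow> compact K \<Longrightarrow> K \<subseteq> \<Omega> \<Longrightarrow> 0 < e \<Longrightarrow>
       \<exists>c n. \<forall>z\<in>K. cmod (c * (weighted_comp \<Omega> \<omega> \<psi> ^^ n) f z - g z) < e"
  shows "\<exists>p\<in>\<Omega>. f p = 0"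
proof (rule ccontr)
  assume nof: "\<not> ?thesis"
  obtain q where q: "q \<in> \<Omega>" using \<Omega>(2) by blast
  obtain r where r: "r > 0" "cball q r \<subseteq> \<Omega>" using \<Omega> q open_contains_cball by blast
  have gH: "(\<lambda>z. if z \<in> \<Omega> then z - q else 0) \<in> holo_funs \<Omega>"
    by (rule holo_funs_cut) (auto intro!: holomorphic_intros)
  define t where "t n = (weighted_comp \<Omega> \<omega> \<psi> ^^ n) f" for n
  have tH: "t n holomorphic_on \<Omega>" for n
    using weighted_comp_funpow_holo_funs[OF hol f] unfolding t_def by (rule holo_funs_holomorphic)
  have tnz: "t n z \<noteq> 0" if "z \<in> \<Omega>" for n z
  proof -
    have "(\<psi> ^^ j) z \<in> \<Omega>" for j using funpow_in[OF hol(3) that] .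
    then show ?thesis using nz nof unfolding t_def weighted_comp_funpow[OF hol(3) that] by auto
  qed
  have "\<exists>a n. \<forall>z\<in>cball q r. cmod (a * t n z - (z - q)) < r / (2 * real (Suc j))" for j
  proof -
    obtain a n where an: "\<forall>z\<in>cball q r. cmod (a * t n z - (if z \<in> \<Omega> then z - q else 0)) < r / (2 * real (Suc j))"
      using dense[OF gH compact_cball r(2), of "r / (2 * real (Suc j))"] r(1) by (auto simp: t_def)
    show ?thesis by (rule exI[of _ a], rule exI[of _ n]) (use an r(2) in \<open>auto simp: subset_iff\<close>)
  qed
  then obtain a n where an: "\<And>j z. z \<in> cball q r \<Longrightarrow> cmod (a j * t (n j) z - (z - q)) < r / (2 * real (Suc j))"
    by metis
  have anz: "a j \<noteq> 0" for j
  proof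
    assume "a j = 0"
    moreover have "q + of_real r \<in> cball q r" using r(1) by (simp add: dist_norm)
    ultimately have "r < r / (2 * real (Suc j))" using an[of "q + of_real r" j] r(1) by simp
    moreover have "r / (2 * real (Suc j)) \<le> r" using r(1) by (simp add: field_simps)
    ultimately show False by linarith
  qed
  have lim1: "(\<lambda>j. r / (2 * real (Suc j))) \<longlonglongrightarrow> 0"
    using tendsto_mult_right_zero[OF LIMSEQ_inverse_real_of_nat, of "r / 2"] by (simp add: field_simps)
  have ul: "uniform_limit (cball q r) (\<lambda>j z. a j * t (n j) z) (\<lambda>z. z - q) sequentially"
  proof (rule uniform_limitI)
    fix e :: real assume "e > 0"
    then have "\<forall>\<^sub>F j in sequentially. r / (2 * real (Suc j)) < e"
      using order_tendstoD(2)[OF lim1] by blast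
    then show "\<forall>\<^sub>F j in sequentially. \<forall>z\<in>cball q r. dist (a j * t (n j) z) (z - q) < e"
    proof eventually_elim
      case (elim j)
      then show ?case using less_trans[OF an] by (simp add: dist_norm)
    qed
  qed
  have "(\<lambda>z. z - q) q \<noteq> 0"
  proof (rule limit_of_nonvanishing[of "ball q r" "\<lambda>j z. a j * t (n j) z" "\<lambda>z. z - q" "q + of_real (r / 2)"])
    show "(\<lambda>z. a j * t (n j) z) holomorphic_on ball q r" for j
      using tH r(2) by (intro holomorphic_intros) (meson ball_subset_cball holomorphic_on_subset order_trans)
    show "uniform_limit K (\<lambda>j z. a j * t (n j) z) (\<lambda>z. z - q) sequentially" if "K \<subseteq> ball q r" for K
      using uniform_limit_on_subset[OF ul] that ball_subset_cball by blast
    show "a j * t (n j) z \<noteq> 0" if "z \<in> ball q r" for j z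
      using anz tnz r(2) that by (auto simp: subset_iff)
  qed (use r(1) in \<open>auto intro!: holomorphic_intros simp: dist_norm\<close>)
  then show False by simp
qed

text \<open>If iterates \<open>\<psi>\<^sub>M\<close> with \<open>M \<rightarrow> \<infinity>\<close> converge to the identity, then a zero \<open>p\<close> of \<open>f\<close> has preimages under every \<open>\<psi>\<^sub>n\<close> in
the compact set \<open>S\<close> that contains the orbit of \<open>p\<close>: any limit point of \<open>\<psi>\<^sub>m(p)\<close> with \<open>m = M - n\<close> is one. Hence every
\<open>T\<^sup>n f\<close> vanishes somewhere on \<open>S\<close>.\<close>

lemma recurrent_not_supercyclic:
  fixes \<omega> \<psi> :: "complex \<Rightarrow> complex"
  assumes \<Omega>: "open \<Omega>" "connected \<Omega>" "\<Omega> \<noteq> {}"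
    and hol: "\<omega> holomorphic_on \<Omega>" "\<psi> holomorphic_on \<Omega>" "\<psi> \<in> \<Omega> \<rightarrow> \<Omega>"
    and ab: "a \<noteq> b" "a \<notin> \<Omega>" "b \<notin> \<Omega>"
    and nz: "\<And>z. z \<in> \<Omega> \<Longrightarrow> \<omega> z \<noteq> 0"
    and M: "\<And>k::nat. M k \<ge> k" "\<And>z. z \<in> \<Omega> \<Longrightarrow> (\<lambda>k. (\<psi> ^^ M k) z) \<longlonglongrightarrow> z"
    and f: "f \<in> holo_funs \<Omega>"
    and dense: "\<And>g K e. g \<in> holo_funs \<Omega> \<Longrightarrow> compact K \<Longrightarrow> K \<subseteq> \<Omega> \<Longrightarrow> 0 < e \<Longrightarrow>
       \<exists>c n. \<forall>z\<in>K. cmod (c * (weighted_comp \<Omega> \<omega> \<psi> ^^ n) f z - g z) < e"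
  shows False
proof -
  obtain p where p: "p \<in> \<Omega>" "f p = 0"
    using supercyclic_vector_has_zero[OF \<Omega>(1,3) hol nz f dense] by blast
  obtain S where S: "compact S" "S \<subseteq> \<Omega>" "\<And>n. (\<psi> ^^ n) p \<in> S"
    using recurrent_orbit_relatively_compact[OF \<Omega>(1,2) hol(2,3) ab p(1) M(1) M(2)[OF p(1)]] by blast
  have zero: "\<exists>q\<in>S. (\<psi> ^^ n) q = p" for n
  proof -
    define x where "x k = (\<psi> ^^ (M (n + k) - n)) p" for k
    have "\<forall>k. x k \<in> S" using S(3) by (simp add: x_def)
    then obtain q s where q: "q \<in> S" "strict_mono (s :: nat \<Rightarrow> nat)" "(x \<circ> s) \<longlonglongrightarrow> q"
      using S(1)[unfolded compact_def, rule_format, of x] by auto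
    have "isCont (\<psi> ^^ n) q"
      using funpow_holomorphic[OF hol(2,3)] q(1) S(2) \<Omega>(1)
      by (meson continuous_on_eq_continuous_at holomorphic_on_imp_continuous_on subsetD)
    then have "(\<lambda>k. (\<psi> ^^ n) ((x \<circ> s) k)) \<longlonglongrightarrow> (\<psi> ^^ n) q"
      using q(3) by (rule isCont_tendsto_compose)
    moreover have "(\<psi> ^^ n) ((x \<circ> s) k) = (\<psi> ^^ M (n + s k)) p" for k
    proof -
      have "n + (M (n + s k) - n) = M (n + s k)" using M(1)[of "n + s k"] by simp
      then show ?thesis by (metis comp_apply funpow_add x_def)
    qed
    moreover have "(\<lambda>k. (\<psi> ^^ M (n + s k)) p) \<longlonglongrightarrow> p"
    proof (rule filterlim_compose[OF M(2)[OF p(1)]])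
      show "filterlim (\<lambda>k. n + s k) at_top sequentially"
        using q(2) by (intro filterlim_subseq) (auto simp: strict_mono_def)
    qed
    ultimately have "(\<psi> ^^ n) q = p" using LIMSEQ_unique by force
    then show ?thesis using q(1) by blast
  qed
  have "(\<lambda>z. if z \<in> \<Omega> then 1 else 0) \<in> holo_funs \<Omega>" by (rule holo_funs_cut) simp
  from dense[OF this S(1,2), of 1] obtain c n where
    cn: "\<And>z. z \<in> S \<Longrightarrow> cmod (c * (weighted_comp \<Omega> \<omega> \<psi> ^^ n) f z - (if z \<in> \<Omega> then 1 else 0)) < 1" by auto
  obtain q where q: "q \<in> S" "(\<psi> ^^ n) q = p" using zero by blast
  then have "q \<in> \<Omega>" using S(2) by blast
  then show False using cn[OF q(1)] q(2) p(2) by (simp add: weighted_comp_funpow[OF hol(3)])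
qed

text \<open>If \<open>\<psi>\<^sub>n(K)\<close> meets \<open>K\<close> infinitely often, a subsequence of the iterates converges to a self-map \<open>g\<close>. A constant value of
\<open>g\<close> is an attracting fixed point. For nonconstant \<open>g\<close>, passing to differences of the exponents gives iterates whose
limit \<open>h\<close> satisfies \<open>h \<circ> g = g\<close>; thus \<open>h\<close> is the identity on the open set \<open>g(\<Omega>)\<close> and so on \<open>\<Omega>\<close>.\<close>

lemma supercyclic_imp_strongly_run_away:
  fixes \<omega> \<psi> :: "complex \<Rightarrow> complex"
  assumes \<Omega>: "open \<Omega>" "connected \<Omega>" "\<Omega> \<noteq> {}"
    and hol: "\<omega> holomorphic_on \<Omega>" "\<psi> holomorphic_on \<Omega>" "\<psi> \<in> \<Omega> \<rightarrow> \<Omega>"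
    and ab: "a \<noteq> b" "a \<notin> \<Omega>" "b \<notin> \<Omega>"
    and nz: "\<And>z. z \<in> \<Omega> \<Longrightarrow> \<omega> z \<noteq> 0"
    and f: "f \<in> holo_funs \<Omega>"
    and dense: "\<And>g K e. g \<in> holo_funs \<Omega> \<Longrightarrow> compact K \<Longrightarrow> K \<subseteq> \<Omega> \<Longrightarrow> 0 < e \<Longrightarrow>
       \<exists>c n. \<forall>z\<in>K. cmod (c * (weighted_comp \<Omega> \<omega> \<psi> ^^ n) f z - g z) < e"
  shows "strongly_run_away_on \<Omega> \<psi>"
proof (rule ccontr)
  have hn: "(\<psi> ^^ n) holomorphic_on \<Omega>" and sn: "(\<psi> ^^ n) \<in> \<Omega> \<rightarrow> \<Omega>" for n
    using funpow_holomorphic[OF hol(2,3)] funpow_in[OF hol(3)] by auto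
  have cont: "isCont (\<psi> ^^ n) z" if "z \<in> \<Omega>" for n z
    using hn that \<Omega>(1) by (meson continuous_on_eq_continuous_at holomorphic_on_imp_continuous_on)
  assume "\<not> strongly_run_away_on \<Omega> \<psi>"
  then obtain K where K: "compact K" "K \<subseteq> \<Omega>"
    "\<not> (\<forall>\<^sub>F n in sequentially. (\<psi> ^^ n) ` K \<inter> K = {})"
    unfolding strongly_run_away_on_def by blast
  have inf: "infinite {n. (\<psi> ^^ n) ` K \<inter> K \<noteq> {}}"
    unfolding infinite_nat_iff_unbounded_le using K(3) unfolding eventually_sequentially by auto
  obtain s where s: "strict_mono (s :: nat \<Rightarrow> nat)" "\<And>j. (\<psi> ^^ s j) ` K \<inter> K \<noteq> {}"
    using infinite_enumerate[OF inf] by auto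
  have "\<exists>z\<in>K. (\<psi> ^^ s j) z \<in> K" for j using s(2)[of j] by blast
  then obtain z where z: "\<And>j. z j \<in> K" "\<And>j. (\<psi> ^^ s j) (z j) \<in> K" by metis
  obtain g r where g: "g holomorphic_on \<Omega>" "g \<in> \<Omega> \<rightarrow> \<Omega>" "strict_mono (r :: nat \<Rightarrow> nat)"
    "\<And>L. compact L \<Longrightarrow> L \<subseteq> \<Omega> \<Longrightarrow> uniform_limit L (\<lambda>j. \<psi> ^^ s (r j)) g sequentially"
    by (rule selfmap_sequence_limit[of \<Omega> "\<lambda>j. \<psi> ^^ s j" a b K z K]) (use \<Omega> hn sn ab K z in auto)
  define N where "N j = s (r j)" for j
  have N: "strict_mono N" using s(1) g(3) by (auto simp: strict_mono_def N_def)
  have gN: "uniform_limit L (\<lambda>j. \<psi> ^^ N j) g sequentially" if "compact L" "L \<subseteq> \<Omega>" for L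
    using g(4)[OF that] by (simp add: N_def)
  have pt: "(\<lambda>j. (\<psi> ^^ N j) w) \<longlonglongrightarrow> g w" if "w \<in> \<Omega>" for w
    by (rule tendsto_uniform_limitI[OF gN[of "{w}"]]) (use that in auto)
  show False
  proof (cases "g constant_on \<Omega>")
    case True
    then obtain c where c: "\<And>w. w \<in> \<Omega> \<Longrightarrow> g w = c" by (auto simp: constant_on_def)
    have cO: "c \<in> \<Omega>" using c g(2) \<Omega>(3) by fastforce
    then have \<psi>c: "\<psi> c \<in> \<Omega>" using hol(3) by blast
    have fixc: "\<psi> c = c"
    proof (rule LIMSEQ_unique)
      have "isCont \<psi> c" using cont[OF cO, of 1] by simp
      then show "(\<lambda>j. \<psi> ((\<psi> ^^ N j) c)) \<longlonglongrightarrow> \<psi> c"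
        using pt[OF cO] c[OF cO] isCont_tendsto_compose by force
      show "(\<lambda>j. \<psi> ((\<psi> ^^ N j) c)) \<longlonglongrightarrow> c"
        using pt[OF \<psi>c] c[OF \<psi>c] by (simp add: funpow_swap1)
    qed
    have fixn: "(\<psi> ^^ n) c = c" for n by (induction n) (auto simp: fixc)
    have dn: "deriv (\<psi> ^^ n) c = deriv \<psi> c ^ n" for n
    proof (induction n)
      case (Suc n)
      have "deriv (\<psi> \<circ> (\<psi> ^^ n)) c = deriv \<psi> ((\<psi> ^^ n) c) * deriv (\<psi> ^^ n) c"
        by (intro deriv_chain holomorphic_on_imp_differentiable_at[OF hn \<Omega>(1) cO])
          (simp add: fixn holomorphic_on_imp_differentiable_at[OF hol(2) \<Omega>(1) cO])
      then show ?case using Suc by (simp add: fixn o_def)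
    qed (simp add: id_def)
    obtain d where d: "d > 0" "cball c d \<subseteq> \<Omega>" using \<Omega> cO open_contains_cball by blast
    have "(\<lambda>j. deriv (\<psi> ^^ N j) c) \<longlonglongrightarrow> deriv g c"
      by (rule deriv_complex_uniform_limit[OF uniform_limit_on_subset[OF gN[OF compact_cball d(2)] ball_subset_cball]
            _ sequentially_bot open_ball])
        (use hn d in \<open>auto intro!: always_eventually intro: holomorphic_on_subset[OF hn] dest: subsetD[OF ball_subset_cball]\<close>)
    moreover have "deriv g c = 0"
      by (rule DERIV_imp_deriv, rule has_field_derivative_transform_within_open[OF DERIV_const \<Omega>(1) cO])
         (simp add: c)
    ultimately have lim0: "(\<lambda>j. deriv \<psi> c ^ N j) \<longlonglongrightarrow> 0" by (simp add: dn)
    have "cmod (deriv \<psi> c) < 1"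
    proof (rule ccontr)
      assume "\<not> cmod (deriv \<psi> c) < 1"
      then have "1 \<le> cmod (deriv \<psi> c ^ N j)" for j by (simp add: norm_power)
      then have "1 \<le> cmod (0::complex)"
        by (intro Lim_norm_lbound[OF sequentially_bot lim0]) auto
      then show False by simp
    qed
    then show False
      using attracting_fixed_point_not_supercyclic[OF \<Omega>(1) hol nz cO fixc _ f dense] by blast
  next
    case False
    obtain w where w: "w \<in> \<Omega>" using \<Omega>(3) by blast
    \<comment> \<open>The index \<open>N j + j\<close> makes the difference of exponents at least \<open>j\<close>.\<close>
    define m where "m j = N (N j + j) - N j" for j
    have m: "m j \<ge> j" "m j + N j = N (N j + j)" for j
      using seq_suble[OF N, of "N j + j"] by (auto simp: m_def)
    have "filterlim (\<lambda>j. N j + j) at_top sequentially"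
      using N by (intro filterlim_subseq) (auto simp: strict_mono_def add_less_mono)
    from filterlim_compose[OF pt this]
    have pm: "(\<lambda>j. (\<psi> ^^ m j) ((\<psi> ^^ N j) x)) \<longlonglongrightarrow> g x" if "x \<in> \<Omega>" for x
      using that by (simp flip: m(2) add: funpow_add)
    obtain h q where h: "h holomorphic_on \<Omega>" "h \<in> \<Omega> \<rightarrow> \<Omega>" "strict_mono (q :: nat \<Rightarrow> nat)"
      "\<And>L. compact L \<Longrightarrow> L \<subseteq> \<Omega> \<Longrightarrow> uniform_limit L (\<lambda>j. \<psi> ^^ m (q j)) h sequentially"
    proof (rule selfmap_sequence_limit[of \<Omega> "\<lambda>j. \<psi> ^^ m j" a b "insert (g w) (range (\<lambda>j. (\<psi> ^^ N j) w))"
          "\<lambda>j. (\<psi> ^^ N j) w" "insert (g w) (range (\<lambda>j. (\<psi> ^^ m j) ((\<psi> ^^ N j) w)))"])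
      show "compact (insert (g w) (range (\<lambda>j. (\<psi> ^^ N j) w)))"
        by (rule compact_sequence_with_limit[OF pt[OF w]])
      show "compact (insert (g w) (range (\<lambda>j. (\<psi> ^^ m j) ((\<psi> ^^ N j) w))))"
        by (rule compact_sequence_with_limit[OF pm[OF w]])
      show "insert (g w) (range (\<lambda>j. (\<psi> ^^ N j) w)) \<subseteq> \<Omega>" using w g(2) funpow_in[OF hol(3)] by auto
      show "insert (g w) (range (\<lambda>j. (\<psi> ^^ m j) ((\<psi> ^^ N j) w))) \<subseteq> \<Omega>" using w g(2) funpow_in[OF hol(3)] by auto
    qed (use \<Omega> hn sn ab in auto)
    have hg: "h (g x) = g x" if x: "x \<in> \<Omega>" for x
    proof (rule LIMSEQ_unique)
      show "(\<lambda>j. (\<psi> ^^ m (q j)) ((\<psi> ^^ N (q j)) x)) \<longlonglongrightarrow> h (g x)"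
        by (rule uniform_limit_selfmap_comp[OF \<Omega>(1) h(1,4)])
          (use LIMSEQ_subseq_LIMSEQ[OF pt[OF x] h(3)] g(2) x in \<open>auto simp: o_def\<close>)
      show "(\<lambda>j. (\<psi> ^^ m (q j)) ((\<psi> ^^ N (q j)) x)) \<longlonglongrightarrow> g x"
        using LIMSEQ_subseq_LIMSEQ[OF pm[OF x] h(3)] by (simp add: o_def)
    qed
    have og: "open (g ` \<Omega>)" using open_mapping_thm[OF g(1) \<Omega>(1,2) \<Omega>(1) order_refl False] .
    have "h x - x = 0" if x: "x \<in> \<Omega>" for x
    proof (rule analytic_continuation[of "\<lambda>x. h x - x" \<Omega> "g ` \<Omega>" "g w" x])
      show "g w islimpt g ` \<Omega>" using interior_limit_point[of "g w" "g ` \<Omega>"] og w by (simp add: interior_open)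
    qed (use h \<Omega> g(2) w hg x in \<open>auto intro!: holomorphic_intros\<close>)
    then have "(\<lambda>j. (\<psi> ^^ m (q j)) x) \<longlonglongrightarrow> x" if "x \<in> \<Omega>" for x
      using tendsto_uniform_limitI[OF h(4)[of "{x}"]] that by fastforce
    moreover have "m (q k) \<ge> k" for k using m(1)[of "q k"] seq_suble[OF h(3), of k] by linarith
    ultimately show False
      using recurrent_not_supercyclic[OF \<Omega> hol ab nz, of "\<lambda>k. m (q k)" f] f dense by blast
  qed
qed

section \<open>Runge approximation\<close>

text \<open>Membership in the uniform closure of \<open>H(\<Omega>)\<close> on \<open>M\<close>. It is an algebra, and Runge's theorem says that it contains every
function holomorphic near \<open>M\<close> if \<open>M\<close> is convex relative to \<open>\<Omega>\<close>.\<close>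

definition approximable :: "complex set \<Rightarrow> complex set \<Rightarrow> (complex \<Rightarrow> complex) \<Rightarrow> bool" where
  "approximable \<Omega> M u \<longleftrightarrow> (\<forall>e>0. \<exists>F. F holomorphic_on \<Omega> \<and> (\<forall>z\<in>M. cmod (F z - u z) < e))"

lemma approximable_holomorphic: "F holomorphic_on \<Omega> \<Longrightarrow> approximable \<Omega> M F"
  unfolding approximable_def by (intro allI impI exI[of _ F]) auto

lemma approximable_limit:
  assumes "\<And>e. 0 < e \<Longrightarrow> \<exists>v. approximable \<Omega> M v \<and> (\<forall>z\<in>M. cmod (v z - u z) < e)"
  shows "approximable \<Omega> M u"
  unfolding approximable_def
proof (intro allI impI)
  fix e :: real assume "e > 0"
  then obtain v where v: "approximable \<Omega> M v" "\<And>z. z \<in> M \<Longrightarrow> cmod (v z - u z) < e / 2"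
    using assms[of "e / 2"] by auto
  obtain F where F: "F holomorphic_on \<Omega>" "\<And>z. z \<in> M \<Longrightarrow> cmod (F z - v z) < e / 2"
    using v(1) \<open>e > 0\<close> unfolding approximable_def by (meson half_gt_zero)
  have "cmod (F z - u z) < e" if "z \<in> M" for z
    using F(2)[OF that] v(2)[OF that] norm_triangle_ineq[of "F z - v z" "v z - u z"] by simp
  then show "\<exists>F. F holomorphic_on \<Omega> \<and> (\<forall>z\<in>M. cmod (F z - u z) < e)" using F(1) by blast
qed

lemma approximable_cong:
  "approximable \<Omega> M u \<Longrightarrow> (\<And>z. z \<in> M \<Longrightarrow> u z = v z) \<Longrightarrow> approximable \<Omega> M v"
  by (rule approximable_limit) auto

lemma approximable_add:
  assumes "approximable \<Omega> M u" "approximable \<Omega> M v"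
  shows "approximable \<Omega> M (\<lambda>z. u z + v z)"
  unfolding approximable_def
proof (intro allI impI)
  fix e :: real assume e: "e > 0"
  obtain F where F: "F holomorphic_on \<Omega>" "\<And>z. z \<in> M \<Longrightarrow> cmod (F z - u z) < e / 2"
    using assms(1) e unfolding approximable_def by (meson half_gt_zero)
  obtain G where G: "G holomorphic_on \<Omega>" "\<And>z. z \<in> M \<Longrightarrow> cmod (G z - v z) < e / 2"
    using assms(2) e unfolding approximable_def by (meson half_gt_zero)
  have "cmod (F z + G z - (u z + v z)) < e" if "z \<in> M" for z
    using F(2)[OF that] G(2)[OF that] norm_triangle_ineq[of "F z - u z" "G z - v z"]
    by (simp add: algebra_simps)
  then show "\<exists>F. F holomorphic_on \<Omega> \<and> (\<forall>z\<in>M. cmod (F z - (u z + v z)) < e)"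
    using F(1) G(1) by (intro exI[of _ "\<lambda>z. F z + G z"]) (auto intro: holomorphic_on_add)
qed

lemma approximable_bounded:
  assumes "approximable \<Omega> M u" "compact M" "M \<subseteq> \<Omega>"
  obtains B where "B > 0" "\<And>z. z \<in> M \<Longrightarrow> cmod (u z) \<le> B"
proof -
  obtain F where F: "F holomorphic_on \<Omega>" "\<And>z. z \<in> M \<Longrightarrow> cmod (F z - u z) < 1"
    using assms(1) unfolding approximable_def by (meson zero_less_one)
  have "compact (F ` M)"
    using F(1) assms by (meson compact_continuous_image continuous_on_subset holomorphic_on_imp_continuous_on)
  then obtain B where B: "B > 0" "\<And>z. z \<in> M \<Longrightarrow> cmod (F z) \<le> B"
    using compact_imp_bounded bounded_pos by (metis (no_types, lifting) imageI)
  have "cmod (u z) \<le> B + 1" if "z \<in> M" for z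
    using F(2)[OF that] B(2)[OF that] norm_triangle_ineq4[of "F z" "F z - u z"] by simp
  then show ?thesis using that[of "B + 1"] B(1) by simp
qed

lemma approximable_mult:
  assumes "approximable \<Omega> M u" "approximable \<Omega> M v" "compact M" "M \<subseteq> \<Omega>"
  shows "approximable \<Omega> M (\<lambda>z. u z * v z)"
  unfolding approximable_def
proof (intro allI impI)
  fix e :: real assume e: "e > 0"
  obtain A where A: "A > 0" "\<And>z. z \<in> M \<Longrightarrow> cmod (u z) \<le> A" using approximable_bounded assms(1,3,4) by metis
  obtain B where B: "B > 0" "\<And>z. z \<in> M \<Longrightarrow> cmod (v z) \<le> B" using approximable_bounded assms(2,3,4) by metis
  \<comment> \<open>The error of a product is at most \<open>\<eta>\<^sup>2 + \<eta> B + A \<eta>\<close>.\<close>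
  define \<eta> where "\<eta> = min 1 (e / (A + B + 1))"
  have \<eta>: "0 < \<eta>" "\<eta> \<le> 1" "\<eta> \<le> e / (A + B + 1)"
    using e A B by (simp_all add: \<eta>_def)
  then have \<eta>3: "\<eta> * (A + B + 1) \<le> e" using A B by (simp add: pos_le_divide_eq)
  obtain F where F: "F holomorphic_on \<Omega>" "\<And>z. z \<in> M \<Longrightarrow> cmod (F z - u z) < \<eta>"
    using assms(1) \<eta> unfolding approximable_def by meson
  obtain G where G: "G holomorphic_on \<Omega>" "\<And>z. z \<in> M \<Longrightarrow> cmod (G z - v z) < \<eta>"
    using assms(2) \<eta> unfolding approximable_def by meson
  have "cmod (F z * G z - u z * v z) < e" if z: "z \<in> M" for z
  proof -
    have "F z * G z - u z * v z = (F z - u z) * (G z - v z) + (F z - u z) * v z + u z * (G z - v z)"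
      by (simp add: algebra_simps)
    then have "cmod (F z * G z - u z * v z) \<le> cmod (F z - u z) * cmod (G z - v z)
        + cmod (F z - u z) * cmod (v z) + cmod (u z) * cmod (G z - v z)"
      by (metis (no_types, lifting) add_mono norm_mult norm_triangle_ineq norm_triangle_le order_refl)
    also have "\<dots> < \<eta> * 1 + \<eta> * B + A * \<eta>"
      using F(2)[OF z] G(2)[OF z] A B z \<eta>(1,2)
      by (intro add_less_le_mono mult_strict_mono' mult_mono) auto
    also have "\<dots> = \<eta> * (A + B + 1)" by (simp add: algebra_simps)
    finally show ?thesis using \<eta>3 by linarith
  qed
  then show "\<exists>F. F holomorphic_on \<Omega> \<and> (\<forall>z\<in>M. cmod (F z - (u z * v z)) < e)"
    using F(1) G(1) by (intro exI[of _ "\<lambda>z. F z * G z"]) (auto intro: holomorphic_on_mult)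
qed

lemma approximable_const: "approximable \<Omega> M (\<lambda>_. c)"
  by (rule approximable_holomorphic) simp

lemma approximable_cmult:
  assumes "approximable \<Omega> M u" "compact M" "M \<subseteq> \<Omega>"
  shows "approximable \<Omega> M (\<lambda>z. c * u z)"
  using approximable_mult[OF approximable_const assms] .

lemma approximable_sum:
  assumes "finite I" "\<And>i. i \<in> I \<Longrightarrow> approximable \<Omega> M (u i)"
  shows "approximable \<Omega> M (\<lambda>z. \<Sum>i\<in>I. u i z)"
  using assms by (induction I) (auto intro: approximable_const approximable_add)

lemma approximable_power:
  assumes "approximable \<Omega> M u" "compact M" "M \<subseteq> \<Omega>"
  shows "approximable \<Omega> M (\<lambda>z. u z ^ n)"
proof (induction n)
  case (Suc n)
  then show ?case using approximable_mult[OF assms(1) Suc assms(2,3)] by simp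
qed (simp add: approximable_const)

lemma geometric_series_error:
  fixes q :: complex
  assumes "q \<noteq> 1"
  shows "1 / (1 - q) - (\<Sum>k<n. q ^ k) = q ^ n / (1 - q)"
  using assms by (simp add: sum_gp_strict diff_divide_distrib)

lemma approximable_geometric:
  assumes q: "approximable \<Omega> M q" "compact M" "M \<subseteq> \<Omega>" and le: "\<And>z. z \<in> M \<Longrightarrow> cmod (q z) \<le> 1 / 2"
  shows "approximable \<Omega> M (\<lambda>z. 1 / (1 - q z))"
proof (rule approximable_limit)
  fix e :: real assume e: "e > 0"
  obtain n where "(1 / 2) ^ n < e / 2"
    using real_arch_pow_inv[of "e / 2" "1 / 2"] e by auto
  then have n: "2 * (1 / 2) ^ n < e" by simp
  have "cmod ((\<Sum>k<n. q z ^ k) - 1 / (1 - q z)) < e" if z: "z \<in> M" for z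
  proof -
    have ge: "1 / 2 \<le> cmod (1 - q z)"
      using norm_triangle_ineq2[of 1 "q z"] le[OF z] by simp
    have "q z \<noteq> 1" using le[OF z] by auto
    have "cmod ((\<Sum>k<n. q z ^ k) - 1 / (1 - q z)) = cmod (q z) ^ n / cmod (1 - q z)"
      by (subst norm_minus_commute, subst geometric_series_error[OF \<open>q z \<noteq> 1\<close>]) (simp add: norm_divide norm_power)
    also have "\<dots> \<le> (1 / 2) ^ n / (1 / 2)"
      using le[OF z] ge by (intro frac_le power_mono) auto
    also have "\<dots> < e" using n by simp
    finally show ?thesis .
  qed
  then show "\<exists>v. approximable \<Omega> M v \<and> (\<forall>z\<in>M. cmod (v z - 1 / (1 - q z)) < e)"
    using approximable_sum[of "{..<n}" \<Omega> M "\<lambda>k z. q z ^ k"] approximable_power[OF q]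
    by (intro exI[of _ "\<lambda>z. \<Sum>k<n. q z ^ k"]) auto
qed

text \<open>Pole pushing: \<open>1 / (z - b)\<close> is \<open>1 / (z - a)\<close> times a geometric series in \<open>(b - a) / (z - a)\<close>.\<close>

lemma approximable_pole_move:
  assumes M: "compact M" "M \<subseteq> \<Omega>" and a: "approximable \<Omega> M (\<lambda>z. 1 / (z - a))"
    and d: "\<And>z. z \<in> M \<Longrightarrow> 2 * cmod (b - a) \<le> cmod (z - a)" "a \<notin> M"
  shows "approximable \<Omega> M (\<lambda>z. 1 / (z - b))"
proof -
  have 1: "approximable \<Omega> M (\<lambda>z. (b - a) * (1 / (z - a)))" by (rule approximable_cmult[OF a M])
  have "approximable \<Omega> M (\<lambda>z. 1 / (1 - (b - a) * (1 / (z - a))))"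
  proof (rule approximable_geometric[OF 1 M])
    fix z assume z: "z \<in> M"
    then have "cmod (z - a) > 0" using d(2) by auto
    then show "cmod ((b - a) * (1 / (z - a))) \<le> 1 / 2"
      using d(1)[OF z] by (simp add: norm_divide norm_mult field_simps)
  qed
  from approximable_mult[OF a this M] show ?thesis
  proof (rule approximable_cong)
    fix z assume "z \<in> M"
    then have za: "z - a \<noteq> 0" using d(2) by auto
    have "(z - a) * (1 - (b - a) * (1 / (z - a))) = z - b" using za by (simp add: field_simps)
    then show "1 / (z - a) * (1 / (1 - (b - a) * (1 / (z - a)))) = 1 / (z - b)"
      by (simp flip: \<open>_ = z - b\<close>)
  qed
qed

text \<open>By pole pushing, whether \<open>1 / (z - a)\<close> is approximable depends only on the component of the complement of \<open>M\<close> that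
contains \<open>a\<close>. A hole contains a point outside \<open>\<Omega>\<close>, for which the function itself is holomorphic on \<open>\<Omega>\<close>; in
the unbounded component, poles far away are handled by a geometric series in \<open>z\<close>.\<close>

lemma approximable_pole:
  assumes M: "convex_compact_in \<Omega> M" and a: "a \<notin> M"
  shows "approximable \<Omega> M (\<lambda>z. 1 / (z - a))"
proof -
  have cM: "compact M" "M \<subseteq> \<Omega>" and hM: "\<And>C. C \<in> holes M \<Longrightarrow> \<exists>z\<in>C. z \<notin> \<Omega>"
    using M by (auto simp: convex_compact_in_def)
  define C where "C = connected_component_set (- M) a"
  have C: "C \<in> components (- M)" "a \<in> C" "connected C" "C \<inter> M = {}"
    using a connected_component_subset[of "- M" a] by (auto simp: C_def components_def)
  have "open C" using C(1) cM(1) by (meson compact_imp_closed open_Compl open_components)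
  obtain s where s: "s \<in> C" "approximable \<Omega> M (\<lambda>z. 1 / (z - s))"
  proof (cases "bounded C")
    case True
    then obtain s where "s \<in> C" "s \<notin> \<Omega>" using hM C(1) by (auto simp: holes_def)
    then show ?thesis
      by (intro that[of s] approximable_holomorphic holomorphic_intros) auto
  next
    case False
    obtain B where B: "B > 0" "\<And>z. z \<in> M \<Longrightarrow> cmod z \<le> B"
      using compact_imp_bounded[OF cM(1)] bounded_pos by metis
    obtain s where s: "s \<in> C" "cmod s > 2 * B"
      using False unfolding bounded_iff by (meson not_le)
    then have s0: "s \<noteq> 0" using B(1) by auto
    have "approximable \<Omega> M (\<lambda>z. 1 / (1 - z / s))"
    proof (rule approximable_geometric[OF _ cM])
      show "approximable \<Omega> M (\<lambda>z. z / s)"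
        by (intro approximable_holomorphic holomorphic_intros) (use s0 in auto)
      fix z assume z: "z \<in> M"
      have "cmod z / cmod s \<le> 1 / 2" using B(2)[OF z] s(2) s0 by (simp add: field_simps)
      then show "cmod (z / s) \<le> 1 / 2" by (simp add: norm_divide)
    qed
    from approximable_cmult[OF this cM, of "- 1 / s"]
    have "approximable \<Omega> M (\<lambda>z. 1 / (z - s))"
    proof (rule approximable_cong)
      fix z assume "z \<in> M"
      have "- s * (1 - z / s) = z - s" using s0 by (simp add: field_simps)
      moreover have "- 1 / s * (1 / (1 - z / s)) = 1 / (- s * (1 - z / s))" by simp
      ultimately show "- 1 / s * (1 / (1 - z / s)) = 1 / (z - s)" by simp
    qed
    then show ?thesis using that s(1) by blast
  qed
  show ?thesis
  proof (rule connected_induction_simple[OF C(3), where P = "\<lambda>b. approximable \<Omega> M (\<lambda>z. 1 / (z - b))"])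
    fix x assume x: "x \<in> C"
    then obtain r where r: "r > 0" "ball x r \<subseteq> C" using \<open>open C\<close> open_contains_ball by blast
    show "\<exists>T. openin (top_of_set C) T \<and> x \<in> T \<and> (\<forall>y\<in>T. \<forall>w\<in>T. approximable \<Omega> M (\<lambda>z. 1 / (z - y))
        \<longrightarrow> approximable \<Omega> M (\<lambda>z. 1 / (z - w)))"
    proof (intro exI[of _ "ball x (r / 6)"] conjI ballI impI)
      show "openin (top_of_set C) (ball x (r / 6))"
        using r by (intro open_subset) (auto intro: order_trans[OF subset_ball])
      show "x \<in> ball x (r / 6)" using r by simp
      fix y w assume yw: "y \<in> ball x (r / 6)" "w \<in> ball x (r / 6)" and ap: "approximable \<Omega> M (\<lambda>z. 1 / (z - y))"
      show "approximable \<Omega> M (\<lambda>z. 1 / (z - w))"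
      proof (rule approximable_pole_move[OF cM ap])
        have "y \<in> C" using yw r by (auto simp: subset_iff)
        then show "y \<notin> M" using C(4) by blast
        fix z assume z: "z \<in> M"
        then have "z \<notin> ball x r" using r(2) C(4) by blast
        then have "r \<le> dist x z" by simp
        moreover have "dist x z \<le> dist x y + dist y z" "dist y w \<le> dist y x + dist x w"
          by (rule dist_triangle)+
        moreover have "dist x y < r / 6" "dist x w < r / 6" "dist y x = dist x y" "0 < r"
          using yw r by (simp_all add: dist_commute)
        ultimately have "2 * dist y w \<le> dist y z" by linarith
        then show "2 * cmod (w - y) \<le> cmod (z - y)" by (simp add: dist_norm norm_minus_commute)
      qed
    qed
  qed (use C(2) s in auto)
qed

lemma riemann_sum_error:
  fixes H :: "real \<Rightarrow> complex"
  assumes H: "continuous_on {0..1} H" and n: "n > 0"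
    and e: "\<And>s t. s \<in> {0..1} \<Longrightarrow> t \<in> {0..1} \<Longrightarrow> \<bar>s - t\<bar> \<le> 1 / real n \<Longrightarrow> cmod (H s - H t) \<le> e"
  shows "cmod (integral {0..1} H - (\<Sum>k<n. H (real k / real n)) / of_nat n) \<le> e"
proof -
  have "cmod (integral {0..real m / real n} H - (\<Sum>k<m. H (real k / real n)) / of_nat n) \<le> real m * e / real n"
    if "m \<le> n" for m
    using that
  proof (induction m)
    case 0
    show ?case by simp
  next
    case (Suc m)
    define a where "a = real m / real n"
    define b where "b = real (Suc m) / real n"
    have ab: "0 \<le> a" "a \<le> b" "b \<le> 1" "b - a = 1 / real n"
      using Suc.prems n by (auto simp: a_def b_def field_simps)
    have cab: "continuous_on {a..b} H" using H ab by (auto intro: continuous_on_subset)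
    have int: "H integrable_on {0..b}" using H ab
      by (auto intro!: integrable_continuous_interval intro: continuous_on_subset)
    have 1: "integral {0..b} H = integral {0..a} H + integral {a..b} H"
      using Henstock_Kurzweil_Integration.integral_combine[OF ab(1,2) int] by simp
    have "integral {a..b} (\<lambda>t. H t - H a) = integral {a..b} H - (b - a) *\<^sub>R H a"
      using cab ab(2) by (subst integral_diff) (auto intro!: integrable_continuous_interval)
    moreover have "cmod (integral {a..b} (\<lambda>t. H t - H a)) \<le> e * (b - a)"
      by (rule integral_bound) (use ab cab e in \<open>auto intro!: continuous_intros\<close>)
    ultimately have 2: "cmod (integral {a..b} H - H a / of_nat n) \<le> e / real n"
      using ab(4) by (simp add: scaleR_conv_of_real)
    have "cmod (integral {0..b} H - (\<Sum>k<Suc m. H (real k / real n)) / of_nat n)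
      \<le> cmod (integral {0..a} H - (\<Sum>k<m. H (real k / real n)) / of_nat n) + cmod (integral {a..b} H - H a / of_nat n)"
      using norm_triangle_ineq[of "integral {0..a} H - (\<Sum>k<m. H (real k / real n)) / of_nat n" "integral {a..b} H - H a / of_nat n"]
      by (simp add: 1 a_def add_divide_distrib algebra_simps)
    also have "\<dots> \<le> real m * e / real n + e / real n"
      using 2 Suc by (intro add_mono) (auto simp: a_def)
    also have "\<dots> = real (Suc m) * e / real n" by (simp add: add_divide_distrib algebra_simps)
    finally show ?case by (simp add: b_def)
  qed
  from this[of n] n show ?thesis by simp
qed

text \<open>The integrand is a multiple of \<open>1 / (w - z)\<close> for each fixed \<open>w\<close>, and the Riemann sums converge uniformly for \<open>z\<close> in \<open>M\<close>.\<close>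

lemma approximable_edge_integral:
  assumes M: "convex_compact_in \<Omega> M" and f: "continuous_on (closed_segment a b) f"
    and disj: "closed_segment a b \<inter> M = {}"
  shows "approximable \<Omega> M (\<lambda>z. contour_integral (linepath a b) (\<lambda>w. f w / (w - z)))"
proof (rule approximable_limit)
  fix e :: real assume e: "e > 0"
  have cM: "compact M" "M \<subseteq> \<Omega>" using M by (auto simp: convex_compact_in_def)
  define G where "G = (\<lambda>(t, z). f (linepath a b t) / (linepath a b t - z) * (b - a))"
  have seg: "linepath a b t \<in> closed_segment a b" if "t \<in> {0..1}" for t
    using that by (metis imageI path_image_def path_image_linepath)
  have ne: "linepath a b t - z \<noteq> 0" if "t \<in> {0..1}" "z \<in> M" for t z
    using seg[OF that(1)] that(2) disj by auto
  have "continuous_on ({0..1} \<times> M) G"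
    unfolding G_def case_prod_beta
    by (intro continuous_intros continuous_on_compose2[OF f] continuous_on_compose2[OF continuous_on_linepath]) (use seg ne in auto)
  moreover have "compact ({0..1::real} \<times> M)" using cM by (intro compact_Times) auto
  ultimately have "uniformly_continuous_on ({0..1} \<times> M) G" by (rule compact_uniformly_continuous)
  then obtain d where d: "d > 0" "\<And>x y. x \<in> {0..1} \<times> M \<Longrightarrow> y \<in> {0..1} \<times> M \<Longrightarrow> dist y x < d \<Longrightarrow> dist (G y) (G x) < e / 2"
    using e unfolding uniformly_continuous_on_def by (metis half_gt_zero)
  obtain n0 :: nat where n0: "1 / real (Suc n0) < d" using nat_approx_posE[OF d(1)] by auto
  define n where "n = Suc n0"
  have n: "n > 0" "1 / real n < d" using n0 by (auto simp: n_def)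
  define R where "R z = (\<Sum>k<n. G (real k / real n, z)) / of_nat n" for z
  have "approximable \<Omega> M R"
  proof -
    have k: "approximable \<Omega> M (\<lambda>z. G (real k / real n, z))" if "k < n" for k
    proof -
      define w where "w = linepath a b (real k / real n)"
      have "w \<notin> M" using seg[of "real k / real n"] disj that by (auto simp: w_def)
      from approximable_cmult[OF approximable_pole[OF M this] cM, of "- (f w * (b - a))"]
      show ?thesis
      proof (rule approximable_cong)
        fix z assume "z \<in> M"
        then have "z - w \<noteq> 0" "w - z \<noteq> 0" using \<open>w \<notin> M\<close> by auto
        then show "- (f w * (b - a)) * (1 / (z - w)) = G (real k / real n, z)"
          unfolding G_def by (simp add: w_def[symmetric] field_simps)
      qed
    qed
    have "approximable \<Omega> M (\<lambda>z. 1 / of_nat n * (\<Sum>k<n. G (real k / real n, z)))"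
      by (rule approximable_cmult[OF approximable_sum cM]) (use k in auto)
    then show ?thesis by (rule approximable_cong) (simp add: R_def)
  qed
  moreover have "cmod (R z - contour_integral (linepath a b) (\<lambda>w. f w / (w - z))) < e" if z: "z \<in> M" for z
  proof -
    have cG: "continuous_on {0..1} (\<lambda>t. G (t, z))"
      unfolding G_def prod.case
      by (intro continuous_intros continuous_on_compose2[OF f] continuous_on_compose2[OF continuous_on_linepath]) (use seg ne z in auto)
    have "contour_integral (linepath a b) (\<lambda>w. f w / (w - z)) = integral {0..1} (\<lambda>t. G (t, z))"
    proof (rule contour_integral_unique, unfold has_contour_integral_linepath)
      show "((\<lambda>x. f (linepath a b x) / (linepath a b x - z) * (b - a)) has_integral integral {0..1} (\<lambda>t. G (t, z))) {0..1}"
        using integrable_integral[OF integrable_continuous_interval[OF cG]] by (simp add: G_def)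
    qed
    moreover have "cmod (integral {0..1} (\<lambda>t. G (t, z)) - R z) \<le> e / 2"
      unfolding R_def
    proof (rule riemann_sum_error[OF cG n(1)])
      fix s t :: real assume st: "s \<in> {0..1}" "t \<in> {0..1}" "\<bar>s - t\<bar> \<le> 1 / real n"
      then have "dist (s, z) (t, z) < d" using n(2) by (simp add: dist_Pair_Pair dist_real_def)
      then show "cmod (G (s, z) - G (t, z)) \<le> e / 2"
        using d(2)[of "(t, z)" "(s, z)"] st z by (simp add: dist_norm less_imp_le)
    qed
    ultimately show ?thesis using e by (simp add: norm_minus_commute)
  qed
  ultimately show "\<exists>v. approximable \<Omega> M v \<and>
      (\<forall>z\<in>M. cmod (v z - contour_integral (linepath a b) (\<lambda>w. f w / (w - z))) < e)" by blast
qed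

lemma isCont_edge_integral:
  assumes f: "continuous_on (closed_segment a b) f" and z: "z \<notin> closed_segment a b"
  shows "isCont (\<lambda>z. contour_integral (linepath a b) (\<lambda>w. f w / (w - z))) z"
proof -
  let ?F = "\<lambda>z. contour_integral (linepath a b) (\<lambda>w. f w / (w - z))"
  have "(?F has_field_derivative (of_nat 1 * contour_integral (linepath a b) (\<lambda>u. f u / (u - z) ^ Suc 1))) (at z)"
  proof (rule Cauchy_next_derivative(2)[where S = UNIV and B = "cmod (b - a)"])
    fix w assume w: "w \<in> UNIV - path_image (linepath a b)"
    have "(\<lambda>u. f u / (u - w)) contour_integrable_on (linepath a b)"
      by (rule contour_integrable_continuous_linepath) (use w f in \<open>auto intro!: continuous_intros\<close>)
    then show "((\<lambda>u. f u / (u - w) ^ 1) has_contour_integral ?F w) (linepath a b)"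
      by (simp add: has_contour_integral_integral)
  qed (use f z in auto)
  then show ?thesis by (rule DERIV_isCont)
qed

definition grid_point :: "real \<Rightarrow> int \<times> int \<Rightarrow> complex" where
  "grid_point \<delta> p = Complex (\<delta> * fst p) (\<delta> * snd p)"

definition grid_square :: "real \<Rightarrow> int \<times> int \<Rightarrow> complex set" where
  "grid_square \<delta> p = cbox (grid_point \<delta> p) (grid_point \<delta> (fst p + 1, snd p + 1))"

lemma mem_grid_square:
  "z \<in> grid_square \<delta> (i, j) \<longleftrightarrow> \<delta> * i \<le> Re z \<and> Re z \<le> \<delta> * (i + 1) \<and> \<delta> * j \<le> Im z \<and> Im z \<le> \<delta> * (j + 1)"
  by (auto simp: grid_square_def grid_point_def in_cbox_complex_iff)

text \<open>The factor 2 is a convenient bound for the diagonal.\<close>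

lemma grid_square_diameter:
  assumes "\<delta> > 0" "x \<in> grid_square \<delta> p" "y \<in> grid_square \<delta> p"
  shows "cmod (x - y) \<le> 2 * \<delta>"
proof -
  obtain i j where p: "p = (i, j)" by force
  have "cmod (x - y) \<le> \<bar>Re x - Re y\<bar> + \<bar>Im x - Im y\<bar>" using cmod_le[of "x - y"] by simp
  also have "\<dots> \<le> \<delta> + \<delta>"
    using assms(2,3) unfolding p mem_grid_square by (intro add_mono) (auto simp: algebra_simps abs_le_iff)
  finally show ?thesis by simp
qed

lemma grid_square_cover:
  assumes "\<delta> > 0"
  shows "z \<in> grid_square \<delta> (\<lfloor>Re z / \<delta>\<rfloor>, \<lfloor>Im z / \<delta>\<rfloor>)"
proof -
  have "\<delta> * \<lfloor>x / \<delta>\<rfloor> \<le> x \<and> x \<le> \<delta> * (\<lfloor>x / \<delta>\<rfloor> + 1)" for x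
  proof -
    have "\<lfloor>x / \<delta>\<rfloor> * \<delta> \<le> x"
      using of_int_floor_le[of "x / \<delta>"] unfolding pos_le_divide_eq[OF assms] .
    moreover have "x / \<delta> \<le> \<lfloor>x / \<delta>\<rfloor> + 1" by linarith
    then have "x \<le> (\<lfloor>x / \<delta>\<rfloor> + 1) * \<delta>" unfolding pos_divide_le_eq[OF assms] .
    ultimately show ?thesis by (simp add: mult.commute)
  qed
  then show ?thesis unfolding mem_grid_square by blast
qed

lemma finite_grid_squares:
  assumes "\<delta> > 0" "bounded M"
  shows "finite {p. grid_square \<delta> p \<inter> M \<noteq> {}}"
proof -
  obtain B where B: "\<And>x. x \<in> M \<Longrightarrow> cmod x \<le> B" using assms(2) by (auto simp: bounded_iff)
  define b where "b = \<lceil>B / \<delta>\<rceil> + 1"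
  have *: "i \<in> {-b..b}" if "\<delta> * real_of_int i \<le> u" "u \<le> \<delta> * (real_of_int i + 1)" "\<bar>u\<bar> \<le> B" for i u
  proof -
    have "\<delta> * real_of_int i \<le> B" "- B \<le> \<delta> * (real_of_int i + 1)" using that by linarith+
    then have "real_of_int i \<le> B / \<delta>" "- (B / \<delta>) \<le> real_of_int i + 1"
      using assms(1) by (simp_all add: field_simps)
    then show ?thesis unfolding b_def by (simp, linarith)
  qed
  have "(i, j) \<in> {-b..b} \<times> {-b..b}" if "z \<in> grid_square \<delta> (i, j)" "z \<in> M" for i j z
    using that(1) B[OF that(2)] abs_Re_le_cmod[of z] abs_Im_le_cmod[of z] unfolding mem_grid_square
    by (intro SigmaI *[of i "Re z"] *[of j "Im z"]) auto
  then have "{p. grid_square \<delta> p \<inter> M \<noteq> {}} \<subseteq> {-b..b} \<times> {-b..b}" by fast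
  then show ?thesis by (rule finite_subset) simp
qed

lemma grid_edge_horizontal:
  assumes "\<delta> > 0" "w \<in> closed_segment (grid_point \<delta> (i, j)) (grid_point \<delta> (i + 1, j))"
  shows "w \<in> grid_square \<delta> (i, j)" "w \<in> grid_square \<delta> (i, j - 1)"
proof -
  obtain u where u: "0 \<le> u" "u \<le> 1" "w = (1 - u) *\<^sub>R grid_point \<delta> (i, j) + u *\<^sub>R grid_point \<delta> (i + 1, j)"
    using assms(2) by (auto simp: in_segment)
  have "Re w = \<delta> * i + u * \<delta>" "Im w = \<delta> * j"
    by (simp_all add: u(3) grid_point_def algebra_simps)
  moreover have "0 \<le> u * \<delta>" "u * \<delta> \<le> \<delta>" using u assms(1) by (simp_all add: mult_left_le_one_le)
  ultimately show "w \<in> grid_square \<delta> (i, j)" "w \<in> grid_square \<delta> (i, j - 1)"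
    using assms(1) unfolding mem_grid_square by (simp_all add: algebra_simps)
qed

lemma grid_edge_vertical:
  assumes "\<delta> > 0" "w \<in> closed_segment (grid_point \<delta> (i, j)) (grid_point \<delta> (i, j + 1))"
  shows "w \<in> grid_square \<delta> (i, j)" "w \<in> grid_square \<delta> (i - 1, j)"
proof -
  obtain u where u: "0 \<le> u" "u \<le> 1" "w = (1 - u) *\<^sub>R grid_point \<delta> (i, j) + u *\<^sub>R grid_point \<delta> (i, j + 1)"
    using assms(2) by (auto simp: in_segment)
  have "Im w = \<delta> * j + u * \<delta>" "Re w = \<delta> * i"
    by (simp_all add: u(3) grid_point_def algebra_simps)
  moreover have "0 \<le> u * \<delta>" "u * \<delta> \<le> \<delta>" using u assms(1) by (simp_all add: mult_left_le_one_le)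
  ultimately show "w \<in> grid_square \<delta> (i, j)" "w \<in> grid_square \<delta> (i - 1, j)"
    using assms(1) unfolding mem_grid_square by (simp_all add: algebra_simps)
qed

lemma contour_integral_grid_square:
  assumes "\<delta> > 0" "continuous_on (path_image (rectpath (grid_point \<delta> (i, j)) (grid_point \<delta> (i + 1, j + 1)))) g"
  shows "contour_integral (rectpath (grid_point \<delta> (i, j)) (grid_point \<delta> (i + 1, j + 1))) g =
    contour_integral (linepath (grid_point \<delta> (i, j)) (grid_point \<delta> (i + 1, j))) g
    + contour_integral (linepath (grid_point \<delta> (i + 1, j)) (grid_point \<delta> (i + 1, j + 1))) g
    - contour_integral (linepath (grid_point \<delta> (i, j + 1)) (grid_point \<delta> (i + 1, j + 1))) g
    - contour_integral (linepath (grid_point \<delta> (i, j)) (grid_point \<delta> (i, j + 1))) g"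
proof -
  define a b c d where "a = grid_point \<delta> (i, j)" "b = grid_point \<delta> (i + 1, j)"
    "c = grid_point \<delta> (i + 1, j + 1)" "d = grid_point \<delta> (i, j + 1)"
  note abcd = a_b_c_d_def
  have r: "rectpath a c = linepath a b +++ linepath b c +++ linepath c d +++ linepath d a"
    unfolding rectpath_def Let_def by (simp add: abcd grid_point_def)
  have "path_image (rectpath a c) = closed_segment a b \<union> closed_segment b c \<union> closed_segment c d \<union> closed_segment d a"
    unfolding r by (simp add: path_image_join Un_assoc)
  then have cont: "continuous_on (closed_segment a b) g" "continuous_on (closed_segment b c) g"
    "continuous_on (closed_segment c d) g" "continuous_on (closed_segment d a) g"
    using assms(2) unfolding abcd[symmetric] by (auto intro: continuous_on_subset)
  have "contour_integral (rectpath a c) g = contour_integral (linepath a b) g + contour_integral (linepath b c) g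
     + contour_integral (linepath c d) g + contour_integral (linepath d a) g"
    unfolding r by (simp add: cont contour_integrable_continuous_linepath contour_integrable_joinI valid_path_join)
  also have "contour_integral (linepath c d) g = - contour_integral (linepath d c) g"
    by (rule contour_integral_reverse_linepath[OF cont(3)])
  also have "contour_integral (linepath d a) g = - contour_integral (linepath a d) g"
    by (rule contour_integral_reverse_linepath[OF cont(4)])
  finally show ?thesis unfolding abcd by simp
qed

text \<open>Summing the boundary integrals of all squares in \<open>S\<close>, an edge common to two of them cancels; \<open>\<tau>\<close> maps a square to its
neighbour across the edge.\<close>

lemma sum_shift_cancel:
  fixes h :: "'a \<Rightarrow> complex"
  assumes "finite S" "inj_on \<tau> S"
  shows "(\<Sum>p\<in>S. h p) - (\<Sum>p\<in>S. h (\<tau> p)) = (\<Sum>p\<in>S - \<tau> ` S. h p) - (\<Sum>p\<in>\<tau> ` S - S. h p)"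
proof -
  have "(\<Sum>p\<in>S. h (\<tau> p)) = (\<Sum>p\<in>\<tau> ` S. h p)" using assms(2) by (simp add: sum.reindex)
  moreover have "(\<Sum>p\<in>S. h p) = (\<Sum>p\<in>S - \<tau> ` S. h p) + (\<Sum>p\<in>S \<inter> \<tau> ` S. h p)"
    using assms(1) by (metis add.commute sum.Int_Diff)
  moreover have "(\<Sum>p\<in>\<tau> ` S. h p) = (\<Sum>p\<in>\<tau> ` S - S. h p) + (\<Sum>p\<in>S \<inter> \<tau> ` S. h p)"
    using assms(1) by (metis add.commute finite_imageI inf_commute sum.Int_Diff)
  ultimately show ?thesis by simp
qed

lemma eq_at_closure_point:
  fixes f g :: "'a::metric_space \<Rightarrow> 'b::t2_space"
  assumes "z \<in> closure B" "\<And>x. x \<in> B \<Longrightarrow> f x = g x" "isCont f z" "isCont g z"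
  shows "f z = g z"
proof -
  obtain x where x: "\<And>n::nat. x n \<in> B" "x \<longlonglongrightarrow> z" using assms(1) closure_sequential by metis
  have "(\<lambda>n. f (x n)) \<longlonglongrightarrow> f z" by (rule isCont_tendsto_compose[OF assms(3) x(2)])
  moreover have "(\<lambda>n. f (x n)) = (\<lambda>n. g (x n))" using assms(2) x(1) by blast
  moreover have "(\<lambda>n. g (x n)) \<longlonglongrightarrow> g z" by (rule isCont_tendsto_compose[OF assms(4) x(2)])
  ultimately show ?thesis using LIMSEQ_unique by metis
qed

text \<open>Let \<open>S\<close> be the set of those squares of a fine grid that meet \<open>M\<close>. By Cauchy's formula the sum of their boundary
integrals of \<open>f w / (w - z)\<close> is \<open>2 \<pi> \<i> f z\<close> for \<open>z\<close> in the interior of one of them. After cancellation only edges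
are left that belong to a single square of \<open>S\<close>; they do not meet \<open>M\<close>, so their contributions \<open>R\<close> are approximable, and
continuous at the points of \<open>M\<close>, which yields \<open>R = f\<close> also at points of \<open>M\<close> on the grid lines.\<close>

theorem runge_approximation:
  assumes M: "convex_compact_in \<Omega> M" and U: "open U" "M \<subseteq> U" and f: "f holomorphic_on U"
  shows "approximable \<Omega> M f"
proof -
  have cM: "compact M" "M \<subseteq> \<Omega>" using M by (auto simp: convex_compact_in_def)
  obtain \<epsilon> where \<epsilon>: "\<epsilon> > 0" "(\<Union>x\<in>M. cball x \<epsilon>) \<subseteq> U"
    using compact_subset_open_imp_cball_epsilon_subset[OF cM(1) U] by metis
  define \<delta> where "\<delta> = \<epsilon> / 2"
  have \<delta>: "\<delta> > 0" using \<epsilon> by (simp add: \<delta>_def)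
  define S where "S = {p. grid_square \<delta> p \<inter> M \<noteq> {}}"
  have fin: "finite S" unfolding S_def by (rule finite_grid_squares[OF \<delta> compact_imp_bounded[OF cM(1)]])
  have SU: "grid_square \<delta> p \<subseteq> U" if p: "p \<in> S" for p
  proof
    fix w assume w: "w \<in> grid_square \<delta> p"
    obtain x where x: "x \<in> grid_square \<delta> p" "x \<in> M" using p by (auto simp: S_def)
    have "w \<in> cball x \<epsilon>" using grid_square_diameter[OF \<delta> x(1) w] by (simp add: \<delta>_def dist_norm)
    then show "w \<in> U" using \<epsilon>(2) x(2) by blast
  qed
  have nS: "grid_square \<delta> p \<inter> M = {}" if "p \<notin> S" for p using that by (simp add: S_def)
  define up where "up p = (fst p, snd p + 1)" for p :: "int \<times> int"
  define rt where "rt p = (fst p + 1, snd p)" for p :: "int \<times> int"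
  have inj: "inj_on up S" "inj_on rt S" by (auto simp: inj_on_def up_def rt_def prod_eq_iff)
  define Ih where "Ih p z = contour_integral (linepath (grid_point \<delta> p) (grid_point \<delta> (rt p))) (\<lambda>w. f w / (w - z))" for p z
  define Iv where "Iv p z = contour_integral (linepath (grid_point \<delta> p) (grid_point \<delta> (up p))) (\<lambda>w. f w / (w - z))" for p z
  have eh: "closed_segment (grid_point \<delta> p) (grid_point \<delta> (rt p)) \<subseteq> U - M"
    if p: "p \<in> (S - up ` S) \<union> (up ` S - S)" for p
  proof
    define q where "q = (fst p, snd p - 1)"
    have pq: "p = up q" by (simp add: up_def q_def)
    have qS: "q \<in> S" if "p \<in> up ` S" using that by (auto simp: up_def q_def)
    fix w assume "w \<in> closed_segment (grid_point \<delta> p) (grid_point \<delta> (rt p))"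
    then have w: "w \<in> grid_square \<delta> p" "w \<in> grid_square \<delta> q"
      using grid_edge_horizontal[OF \<delta>, of w "fst p" "snd p"] by (auto simp: rt_def q_def)
    consider "p \<in> S" "q \<notin> S" | "q \<in> S" "p \<notin> S" using p pq qS by blast
    then show "w \<in> U - M" using w SU nS by cases blast+
  qed
  have ev: "closed_segment (grid_point \<delta> p) (grid_point \<delta> (up p)) \<subseteq> U - M"
    if p: "p \<in> (S - rt ` S) \<union> (rt ` S - S)" for p
  proof
    define q where "q = (fst p - 1, snd p)"
    have pq: "p = rt q" by (simp add: rt_def q_def)
    have qS: "q \<in> S" if "p \<in> rt ` S" using that by (auto simp: rt_def q_def)
    fix w assume "w \<in> closed_segment (grid_point \<delta> p) (grid_point \<delta> (up p))"
    then have w: "w \<in> grid_square \<delta> p" "w \<in> grid_square \<delta> q"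
      using grid_edge_vertical[OF \<delta>, of w "fst p" "snd p"] by (auto simp: up_def q_def)
    consider "p \<in> S" "q \<notin> S" | "q \<in> S" "p \<notin> S" using p pq qS by blast
    then show "w \<in> U - M" using w SU nS by cases blast+
  qed
  have cf: "continuous_on U f" using f by (rule holomorphic_on_imp_continuous_on)
  have Ih: "approximable \<Omega> M (Ih p)" "\<And>z. z \<in> M \<Longrightarrow> isCont (Ih p) z"
    if "p \<in> (S - up ` S) \<union> (up ` S - S)" for p
  proof -
    have c: "continuous_on (closed_segment (grid_point \<delta> p) (grid_point \<delta> (rt p))) f"
      using eh[OF that] cf by (auto intro: continuous_on_subset)
    show "approximable \<Omega> M (Ih p)"
      unfolding Ih_def by (rule approximable_edge_integral[OF M c]) (use eh[OF that] in blast)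
    show "isCont (Ih p) z" if "z \<in> M" for z
      unfolding Ih_def by (rule isCont_edge_integral[OF c]) (use eh[OF \<open>p \<in> _\<close>] that in blast)
  qed
  have Iv: "approximable \<Omega> M (Iv p)" "\<And>z. z \<in> M \<Longrightarrow> isCont (Iv p) z"
    if "p \<in> (S - rt ` S) \<union> (rt ` S - S)" for p
  proof -
    have c: "continuous_on (closed_segment (grid_point \<delta> p) (grid_point \<delta> (up p))) f"
      using ev[OF that] cf by (auto intro: continuous_on_subset)
    show "approximable \<Omega> M (Iv p)"
      unfolding Iv_def by (rule approximable_edge_integral[OF M c]) (use ev[OF that] in blast)
    show "isCont (Iv p) z" if "z \<in> M" for z
      unfolding Iv_def by (rule isCont_edge_integral[OF c]) (use ev[OF \<open>p \<in> _\<close>] that in blast)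
  qed
  define R where "R z = 1 / (2 * of_real pi * \<i>) *
    ((\<Sum>p\<in>S - up ` S. Ih p z) + (- 1) * (\<Sum>p\<in>up ` S - S. Ih p z)
      + (- 1) * ((\<Sum>p\<in>S - rt ` S. Iv p z) + (- 1) * (\<Sum>p\<in>rt ` S - S. Iv p z)))" for z
  have "approximable \<Omega> M R"
    unfolding R_def using fin Ih(1) Iv(1)
    by (intro approximable_cmult approximable_add approximable_sum cM) auto
  then show ?thesis
  proof (rule approximable_cong)
    fix z assume z: "z \<in> M"
    define p0 where "p0 = (\<lfloor>Re z / \<delta>\<rfloor>, \<lfloor>Im z / \<delta>\<rfloor>)"
    have zp: "z \<in> grid_square \<delta> p0" unfolding p0_def by (rule grid_square_cover[OF \<delta>])
    have p0: "p0 \<in> S" using zp z by (auto simp: S_def)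
    define B where "B = box (grid_point \<delta> p0) (grid_point \<delta> (fst p0 + 1, snd p0 + 1))"
    have "B \<noteq> {}"
    proof -
      have "Complex (\<delta> * (fst p0 + 1 / 2)) (\<delta> * (snd p0 + 1 / 2)) \<in> B"
        using \<delta> by (simp add: B_def grid_point_def in_box_complex_iff)
      then show ?thesis by blast
    qed
    show "R z = f z"
    proof (rule eq_at_closure_point[of z B])
      show "z \<in> closure B"
        using zp closure_box[OF \<open>B \<noteq> {}\<close>[unfolded B_def]] by (simp add: B_def grid_square_def)
      show "isCont R z"
        unfolding R_def using Ih(2)[OF _ z] Iv(2)[OF _ z] by (intro continuous_intros) auto
      show "isCont f z" using cf U z by (auto simp: continuous_on_eq_continuous_at)
      fix x assume x: "x \<in> B"
      have x0: "x \<in> grid_square \<delta> p0" using x box_subset_cbox by (auto simp: B_def grid_square_def)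
      have other: "x \<notin> grid_square \<delta> p" if "p \<noteq> p0" for p
      proof
        assume "x \<in> grid_square \<delta> p"
        obtain i j i0 j0 where p: "p = (i, j)" "p0 = (i0, j0)" by force
        have b: "\<delta> * i0 < Re x" "Re x < \<delta> * (i0 + 1)" "\<delta> * j0 < Im x" "Im x < \<delta> * (j0 + 1)"
          using x by (auto simp: B_def p grid_point_def in_box_complex_iff)
        have c: "\<delta> * i \<le> Re x" "Re x \<le> \<delta> * (i + 1)" "\<delta> * j \<le> Im x" "Im x \<le> \<delta> * (j + 1)"
          using \<open>x \<in> grid_square \<delta> p\<close> by (auto simp: p mem_grid_square)
        have "\<delta> * i0 < \<delta> * (i + 1)" "\<delta> * i < \<delta> * (i0 + 1)" "\<delta> * j0 < \<delta> * (j + 1)" "\<delta> * j < \<delta> * (j0 + 1)"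
          using b c by linarith+
        then have "real_of_int i0 < i + 1" "real_of_int i < i0 + 1" "real_of_int j0 < j + 1" "real_of_int j < j0 + 1"
          using \<delta> by (simp_all only: mult_less_cancel_left_pos of_int_add of_int_1)
        then have "i = i0" "j = j0" by linarith+
        then show False using that p by simp
      qed
      define rp where "rp p = rectpath (grid_point \<delta> p) (grid_point \<delta> (fst p + 1, snd p + 1))" for p
      have le: "Re (grid_point \<delta> p) \<le> Re (grid_point \<delta> (fst p + 1, snd p + 1))"
        "Im (grid_point \<delta> p) \<le> Im (grid_point \<delta> (fst p + 1, snd p + 1))" for p
        using \<delta> by (simp_all add: grid_point_def)
      have pi: "path_image (rp p) \<subseteq> grid_square \<delta> p" for p
        unfolding rp_def grid_square_def by (rule path_image_rectpath_subset_cbox[OF le])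
      have nx: "x \<notin> path_image (rp p)" for p
      proof (cases "p = p0")
        case True
        then show ?thesis using x path_image_rectpath_cbox_minus_box[OF le] by (auto simp: rp_def B_def)
      next
        case False
        then show ?thesis using other pi by blast
      qed
      have sq: "contour_integral (rp p) (\<lambda>w. f w / (w - x)) = Ih p x + Iv (rt p) x - Ih (up p) x - Iv p x"
        if "p \<in> S" for p
      proof -
        have "continuous_on (path_image (rp p)) (\<lambda>w. f w / (w - x))"
        proof (intro continuous_intros)
          show "continuous_on (path_image (rp p)) f"
            using pi[of p] SU[OF that] by (intro continuous_on_subset[OF cf]) blast
        qed (use nx[of p] in auto)
        from contour_integral_grid_square[OF \<delta>, of "fst p" "snd p", folded rp_def] this show ?thesis
          by (simp add: rp_def Ih_def Iv_def up_def rt_def)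
      qed
      have val: "contour_integral (rp p) (\<lambda>w. f w / (w - x)) = (if p = p0 then 2 * of_real pi * \<i> * f x else 0)"
        if "p \<in> S" for p
      proof (cases "p = p0")
        case True
        have "((\<lambda>w. f w / (w - x)) has_contour_integral (2 * pi * \<i> * winding_number (rp p) x * f x)) (rp p)"
        proof (rule Cauchy_integral_formula_convex_simple[of "grid_square \<delta> p"])
          show "convex (grid_square \<delta> p)" by (simp add: grid_square_def)
          show "f holomorphic_on grid_square \<delta> p" using f SU[OF that] by (rule holomorphic_on_subset)
          show "x \<in> interior (grid_square \<delta> p)" using x True by (simp add: grid_square_def B_def)
          show "path_image (rp p) \<subseteq> grid_square \<delta> p - {x}" using pi nx by blast
        qed (simp_all add: rp_def)
        moreover have "winding_number (rp p) x = 1"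
          unfolding rp_def True by (rule winding_number_rectpath) (use x in \<open>simp add: B_def\<close>)
        ultimately show ?thesis using True contour_integral_unique by simp
      next
        case False
        have "((\<lambda>w. f w / (w - x)) has_contour_integral 0) (rp p)"
        proof (rule Cauchy_theorem_convex_simple[of _ "grid_square \<delta> p"])
          show "convex (grid_square \<delta> p)" by (simp add: grid_square_def)
          show "(\<lambda>w. f w / (w - x)) holomorphic_on grid_square \<delta> p"
            using f SU[OF that] other[OF False] by (intro holomorphic_intros) (auto intro: holomorphic_on_subset)
        qed (use pi in \<open>auto simp: rp_def\<close>)
        then show ?thesis using False contour_integral_unique by simp
      qed
      have "2 * of_real pi * \<i> * f x = (\<Sum>p\<in>S. contour_integral (rp p) (\<lambda>w. f w / (w - x)))"
        using fin p0 by (simp add: val)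
      also have "\<dots> = (\<Sum>p\<in>S. Ih p x + Iv (rt p) x - Ih (up p) x - Iv p x)"
        by (rule sum.cong) (simp_all add: sq)
      also have "\<dots> = ((\<Sum>p\<in>S. Ih p x) - (\<Sum>p\<in>S. Ih (up p) x)) - ((\<Sum>p\<in>S. Iv p x) - (\<Sum>p\<in>S. Iv (rt p) x))"
        by (simp add: sum.distrib sum_subtractf)
      also have "\<dots> = 2 * of_real pi * \<i> * R x"
        using sum_shift_cancel[OF fin inj(1), of "\<lambda>p. Ih p x"] sum_shift_cancel[OF fin inj(2), of "\<lambda>p. Iv p x"]
        by (simp add: R_def)
      finally show "R x = f x" by simp
    qed
  qed
qed

section \<open>Complements of plane continua\<close>

lemma bounded_subset_cballD: "bounded X \<Longrightarrow> \<exists>R. (X :: complex set) \<subseteq> cball 0 R"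
  by (auto simp: bounded_iff subset_iff)

lemma component_open: "closed X \<Longrightarrow> C \<in> components (- X) \<Longrightarrow> open (C :: complex set)"
  by (meson open_Compl open_components)

lemma component_disjoint: "C \<in> components (- X) \<Longrightarrow> C \<inter> X = {}"
  using in_components_subset by blast

lemma connected_Un_complement_component:
  fixes X :: "complex set"
  assumes "connected X" "closed X" "C \<in> components (- X)"
  shows "connected (X \<union> C)"
proof (rule connected_Un_clopen_in_complement[OF assms(1) connected_UNIV])
  show "openin (top_of_set (UNIV - X)) C"
    using component_open[OF assms(2,3)] component_disjoint[OF assms(3)] by (intro open_subset) auto
  show "closedin (top_of_set (UNIV - X)) C"
    using closedin_component[OF assms(3)] by (simp add: Compl_eq_Diff_UNIV)
qed auto

lemma connected_in_component:
  assumes "connected S" "S \<inter> X = {}" "C \<in> components (- X)" "S \<inter> C \<noteq> {}"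
  shows "S \<subseteq> C"
  using components_maximal[OF assms(3,1)] assms(2,4) by blast

lemma component_containing:
  assumes "p \<notin> X"
  obtains C where "C \<in> components (- X)" "p \<in> C"
  using assms by (metis ComplI UnionE Union_components)

lemma connected_component_iff_component:
  assumes "C \<in> components (- X)" "p \<in> C"
  shows "connected_component (- X) p q \<longleftrightarrow> q \<in> C"
  using assms by (metis components_iff connected_component_eq mem_Collect_eq)

lemma outside_ball_subset_unbounded_component:
  fixes X :: "complex set"
  assumes "X \<subseteq> cball 0 R" "C \<in> components (- X)" "\<not> bounded C"
  shows "- cball 0 R \<subseteq> C"
proof (rule connected_in_component[OF _ _ assms(2)])
  show "connected (- cball (0::complex) R)" by (intro connected_complement_bounded_convex) auto
  show "- cball 0 R \<inter> X = {}" using assms(1) by blast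
  show "- cball 0 R \<inter> C \<noteq> {}"
    using assms(3) by (metis Int_commute bounded_cball bounded_subset disjoint_eq_subset_Compl double_complement)
qed

lemma bounded_component_subset_cball:
  fixes X :: "complex set"
  assumes "X \<subseteq> cball 0 R" "C \<in> components (- X)" "bounded C"
  shows "C \<subseteq> cball 0 R"
proof (rule ccontr)
  assume "\<not> C \<subseteq> cball 0 R"
  then have "- cball 0 R \<inter> C \<noteq> {}" by blast
  then have "- cball 0 R \<subseteq> C"
    using assms(1) by (intro connected_in_component[OF _ _ assms(2)] connected_complement_bounded_convex) auto
  then have "bounded (- cball (0::complex) R)" using assms(3) bounded_subset by blast
  then show False using cobounded_imp_unbounded by (metis bounded_cball double_complement)
qed

text \<open>The situation in which one of two disjoint continua may surround the other: \<open>A\<close> is the complementary component of \<open>E\<close>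
that contains \<open>L\<close>, and \<open>B\<close> that of \<open>L\<close> containing \<open>E\<close>. The region between them is \<open>A \<inter> B\<close>.\<close>

locale disjoint_continua =
  fixes E L A B :: "complex set"
  assumes E: "compact E" "connected E" "E \<noteq> {}" and L: "compact L" "connected L" "L \<noteq> {}"
    and disj: "E \<inter> L = {}"
    and A: "A \<in> components (- E)" "L \<subseteq> A" and B: "B \<in> components (- L)" "E \<subseteq> B"

lemma disjoint_continua_exist:
  fixes E L :: "complex set"
  assumes "compact E" "connected E" "E \<noteq> {}" "compact L" "connected L" "L \<noteq> {}" "E \<inter> L = {}"
  obtains A B where "disjoint_continua E L A B"
proof -
  obtain e l where el: "e \<in> E" "l \<in> L" using assms by blast
  obtain A where A: "A \<in> components (- E)" "l \<in> A" using component_containing[of l E] el assms(7) by blast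
  obtain B where B: "B \<in> components (- L)" "e \<in> B" using component_containing[of e L] el assms(7) by blast
  have "L \<subseteq> A" by (rule connected_in_component[OF assms(5) _ A(1)]) (use assms el A in blast)+
  moreover have "E \<subseteq> B" by (rule connected_in_component[OF assms(2) _ B(1)]) (use assms el B in blast)+
  ultimately show ?thesis using that[of A B] assms A B by (simp add: disjoint_continua_def)
qed

context disjoint_continua
begin

lemma other_component_subset:
  assumes "Q \<in> components (- L)" "Q \<noteq> B"
  shows "Q \<subseteq> A"
proof -
  have "connected (L \<union> Q)"
    using connected_Un_complement_component[OF L(2) compact_imp_closed[OF L(1)] assms(1)] .
  moreover have "Q \<inter> B = {}" using assms B(1) components_nonoverlap by blast
  then have "(L \<union> Q) \<inter> E = {}" using disj B(2) by blast
  ultimately have "L \<union> Q \<subseteq> A"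
    by (rule connected_in_component[OF _ _ A(1)]) (use A L in blast)
  then show ?thesis by blast
qed

text \<open>Janiszewski's theorem: points separated neither by \<open>E\<close> nor by \<open>L\<close> are not separated by their disjoint union.\<close>

lemma connected_between: "connected (A \<inter> B)"
proof (rule connected_iff_connected_component[THEN iffD2], intro ballI)
  fix p q assume pq: "p \<in> A \<inter> B" "q \<in> A \<inter> B"
  have "connected_component (- (E \<union> L)) p q"
  proof (rule Janiszewski[OF E(1) compact_imp_closed[OF L(1)]])
    show "connected (E \<inter> L)" using disj by simp
    show "connected_component (- E) p q" using connected_component_iff_component[OF A(1)] pq by blast
    show "connected_component (- L) p q" using connected_component_iff_component[OF B(1)] pq by blast
  qed
  then obtain T where T: "connected T" "T \<subseteq> - (E \<union> L)" "p \<in> T" "q \<in> T"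
    unfolding connected_component_def by blast
  have "T \<subseteq> A" by (rule connected_in_component[OF T(1) _ A(1)]) (use T pq in blast)+
  moreover have "T \<subseteq> B" by (rule connected_in_component[OF T(1) _ B(1)]) (use T pq in blast)+
  ultimately show "connected_component (A \<inter> B) p q" using T unfolding connected_component_def by blast
qed

text \<open>A hole of the union that is not already a hole of one of the two continua is the region between them.\<close>

lemma component_cases:
  assumes D: "D \<in> components (- (E \<union> L))"
  shows "D \<in> components (- E) \<or> D \<in> components (- L) \<or> D = A \<inter> B"
proof -
  obtain d where d: "d \<in> D" using D in_components_nonempty by blast
  have Dc: "connected D" using D in_components_connected by blast
  have DEL: "D \<inter> E = {}" "D \<inter> L = {}" using component_disjoint[OF D] by blast+
  obtain A' where A': "A' \<in> components (- E)" "d \<in> A'" using component_containing[of d E] d DEL by blast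
  obtain B' where B': "B' \<in> components (- L)" "d \<in> B'" using component_containing[of d L] d DEL by blast
  have DA: "D \<subseteq> A'" by (rule connected_in_component[OF Dc DEL(1) A'(1)]) (use d A' in blast)
  have DB: "D \<subseteq> B'" by (rule connected_in_component[OF Dc DEL(2) B'(1)]) (use d B' in blast)
  have max: "S \<subseteq> D" if "connected S" "S \<inter> E = {}" "S \<inter> L = {}" "d \<in> S" for S
    by (rule connected_in_component[OF that(1) _ D]) (use that d in blast)+
  show ?thesis
  proof (cases "A' = A")
    case False
    then have "A' \<inter> L = {}" using A A' components_nonoverlap by blast
    then have "A' \<subseteq> D"
      using A' component_disjoint[OF A'(1)] in_components_connected by (intro max) auto
    then show ?thesis using DA A' by auto
  next
    case A'A: True
    show ?thesis
    proof (cases "B' = B")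
      case False
      then have "B' \<inter> E = {}" using B B' components_nonoverlap by blast
      then have "B' \<subseteq> D"
        using B' component_disjoint[OF B'(1)] in_components_connected by (intro max) auto
      then show ?thesis using DB B' by auto
    next
      case True
      have "A \<inter> B \<subseteq> D"
        using connected_between component_disjoint[OF A(1)] component_disjoint[OF B(1)] A'A True A' B'
        by (intro max) auto
      then show ?thesis using DA DB A'A True by auto
    qed
  qed
qed

text \<open>If \<open>E\<close> surrounds \<open>L\<close>, then \<open>L\<close> does not surround \<open>E\<close>.\<close>

lemma bounded_imp_unbounded: "bounded A \<Longrightarrow> \<not> bounded B"
proof -
  assume bA: "bounded A"
  have "connected (- A)" using component_complement_connected[OF E(2) A(1)] .
  moreover have "- A \<inter> L = {}" using A(2) by blast
  moreover have "- A \<inter> B \<noteq> {}" using component_disjoint[OF A(1)] B(2) E(3) by blast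
  ultimately have "- A \<subseteq> B" using connected_in_component[OF _ _ B(1)] by blast
  moreover have "\<not> bounded (- A)" using bA cobounded_imp_unbounded by (metis double_complement)
  ultimately show ?thesis using bounded_subset by blast
qed

lemma unbounded_between:
  assumes "\<not> bounded A" "\<not> bounded B"
  shows "\<not> bounded (A \<inter> B)"
proof -
  have "bounded (E \<union> L)" using E(1) L(1) by (simp add: compact_imp_bounded)
  then obtain R where R: "E \<union> L \<subseteq> cball 0 R" using bounded_subset_cballD by blast
  have "- cball 0 R \<subseteq> A \<inter> B"
    using outside_ball_subset_unbounded_component[OF _ A(1) assms(1), of R]
      outside_ball_subset_unbounded_component[OF _ B(1) assms(2), of R] R by blast
  moreover have "\<not> bounded (- cball (0::complex) R)"
    using cobounded_imp_unbounded by (metis bounded_cball double_complement)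
  ultimately show ?thesis using bounded_subset by blast
qed

end

text \<open>A compact component \<open>C\<close> of a closed set has arbitrarily small compact neighbourhoods \<open>P\<close> that are relatively open in that
set (Sura-Bura). Hence \<open>P\<close> has a positive distance \<open>d\<close> from the rest of the complement of \<open>\<Omega>\<close> and from \<open>q\<close>, and the
points at distance \<open>d / 2\<close> from \<open>P\<close> form a compact subset of \<open>\<Omega>\<close> that surrounds \<open>P\<close>.\<close>

lemma separating_compact:
  fixes \<Omega> :: "complex set"
  assumes \<Omega>: "open \<Omega>" and p: "p \<notin> \<Omega>" and C: "C = connected_component_set (- \<Omega>) p" "bounded C" and q: "q \<notin> C"
  obtains X where "compact X" "X \<subseteq> \<Omega>" "bounded (connected_component_set (- X) p)" "\<not> connected_component (- X) p q"
proof -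
  have cl: "closed (- \<Omega>)" using \<Omega> by (simp add: closed_Compl)
  have Cc: "C \<in> components (- \<Omega>)" using p C(1) by (auto simp: components_def)
  have pC: "p \<in> C" using p C(1) by simp
  have cC: "compact C"
    unfolding compact_eq_bounded_closed using closed_components[OF cl Cc] C(2) by (rule conjI[rotated])
  have op: "open (- {q})" by (simp add: open_Compl)
  have Cq: "C \<subseteq> - {q}" using q by blast
  obtain P where P: "openin (top_of_set (- \<Omega>)) P" "compact P" "C \<subseteq> P" "P \<subseteq> - {q}"
    by (rule Sura_Bura_clopen_subset[OF closed_imp_locally_compact[OF cl] Cc cC op Cq])
  obtain V where V: "open V" "P = - \<Omega> \<inter> V" using P(1) by (auto simp: openin_open)
  define Q where "Q = insert q (- \<Omega> - V)"
  have Q: "closed Q" "P \<inter> Q = {}" using V P(4) cl by (auto simp: Q_def closed_Diff)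
  obtain d where d: "d > 0" "\<And>x y. x \<in> P \<Longrightarrow> y \<in> Q \<Longrightarrow> d \<le> dist x y"
    using separate_compact_closed[OF P(2) Q] by blast
  have Pne: "P \<noteq> {}" using pC P(3) by blast
  have Qd: "d \<le> infdist y P" if "y \<in> Q" for y
    unfolding infdist_def using Pne d(2) that by (auto intro!: cINF_greatest simp: dist_commute)
  define X where "X = {z. infdist z P = d / 2}"
  have cX: "closed X" unfolding X_def by (intro closed_Collect_eq continuous_intros)
  obtain R where R: "P \<subseteq> cball 0 R" using bounded_subset_cballD compact_imp_bounded[OF P(2)] by blast
  have bd: "bounded {z. infdist z P \<le> d / 2}"
  proof (rule bounded_subset[OF bounded_cball[of 0 "R + d / 2"]], rule subsetI)
    fix z assume "z \<in> {z. infdist z P \<le> d / 2}"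
    obtain y where y: "y \<in> P" "infdist z P = dist z y"
      using infdist_attains_inf[OF compact_imp_closed[OF P(2)] Pne] by blast
    have "dist 0 z \<le> dist 0 y + dist y z" by (rule dist_triangle)
    moreover have "dist 0 y \<le> R" using R y(1) by auto
    ultimately show "z \<in> cball 0 (R + d / 2)" using y \<open>z \<in> _\<close> by (simp add: dist_commute)
  qed
  have low: "infdist z P < d / 2" if z: "connected_component (- X) p z" for z
  proof (rule ccontr)
    assume ge: "\<not> infdist z P < d / 2"
    obtain T where T: "connected T" "T \<subseteq> - X" "p \<in> T" "z \<in> T" using z unfolding connected_component_def by blast
    have con: "connected ((\<lambda>x. infdist x P) ` T)"
      by (intro connected_continuous_image continuous_intros T)
    have "infdist p P = 0" using pC P(3) by (intro infdist_zero) auto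
    then have "0 \<in> (\<lambda>x. infdist x P) ` T" using T(3) by force
    moreover have "infdist z P \<in> (\<lambda>x. infdist x P) ` T" using T(4) by blast
    ultimately have "d / 2 \<in> (\<lambda>x. infdist x P) ` T"
      by (rule connectedD_interval[OF con]) (use ge d(1) in auto)
    then show False using T(2) by (auto simp: X_def)
  qed
  show ?thesis
  proof
    show "compact X"
      using cX bounded_subset[OF bd, of X] by (auto simp: X_def compact_eq_bounded_closed)
    show "X \<subseteq> \<Omega>"
    proof (rule subsetI, rule ccontr)
      fix z assume z: "z \<in> X" "z \<notin> \<Omega>"
      then have "z \<in> P \<or> z \<in> Q" using V by (auto simp: Q_def)
      then show False using z(1) d(1) Qd[of z] infdist_zero[of z P] by (auto simp: X_def)
    qed
    show "bounded (connected_component_set (- X) p)"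
      by (rule bounded_subset[OF bd]) (use low in force)
    show "\<not> connected_component (- X) p q"
      using low[of q] Qd[of q] d(1) by (auto simp: Q_def)
  qed
qed

lemma compact_subset_connected_compact:
  fixes \<Omega> :: "complex set"
  assumes "open \<Omega>" "connected \<Omega>" "\<Omega> \<noteq> {}" "compact K" "K \<subseteq> \<Omega>"
  obtains K' where "compact K'" "connected K'" "K \<subseteq> K'" "K' \<subseteq> \<Omega>" "K' \<noteq> {}"
proof -
  obtain z where z: "z \<in> \<Omega>" using assms(3) by blast
  have "\<exists>N. compact N \<and> connected N \<and> N \<subseteq> \<Omega> \<and> z \<in> N \<and> x \<in> interior N" if x: "x \<in> \<Omega>" for x
  proof -
    obtain g where g: "path g" "path_image g \<subseteq> \<Omega>" "pathstart g = z" "pathfinish g = x"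
      using connected_open_path_connected[OF assms(1,2)] z x unfolding path_connected_def by blast
    obtain r where r: "r > 0" "cball x r \<subseteq> \<Omega>" using assms(1) x open_contains_cball by blast
    show ?thesis
    proof (intro exI[of _ "path_image g \<union> cball x r"] conjI)
      show "compact (path_image g \<union> cball x r)" using g(1) by (simp add: compact_Un compact_path_image)
      show "connected (path_image g \<union> cball x r)"
        using g r(1) by (intro connected_Un connected_path_image) (auto intro: pathfinish_in_path_image)
      show "path_image g \<union> cball x r \<subseteq> \<Omega>" using g r by blast
      show "z \<in> path_image g \<union> cball x r" using g(3) pathstart_in_path_image by blast
      have "ball x r \<subseteq> path_image g \<union> cball x r" by auto
      then show "x \<in> interior (path_image g \<union> cball x r)" using r(1) by (meson centre_in_ball interiorI open_ball)
    qed
  qed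
  then obtain N where N: "\<And>x. x \<in> \<Omega> \<Longrightarrow> compact (N x)" "\<And>x. x \<in> \<Omega> \<Longrightarrow> connected (N x)"
    "\<And>x. x \<in> \<Omega> \<Longrightarrow> N x \<subseteq> \<Omega>" "\<And>x. x \<in> \<Omega> \<Longrightarrow> z \<in> N x" "\<And>x. x \<in> \<Omega> \<Longrightarrow> x \<in> interior (N x)" by metis
  obtain F where F: "F \<subseteq> K" "finite F" "K \<subseteq> (\<Union>x\<in>F. interior (N x))"
  proof (rule compactE_image[OF assms(4), of K "\<lambda>x. interior (N x)"])
    show "K \<subseteq> (\<Union>x\<in>K. interior (N x))" using N(5) assms(5) by blast
  qed auto
  define K' where "K' = {z} \<union> (\<Union>x\<in>F. N x)"
  show ?thesis
  proof
    show "compact K'" unfolding K'_def using F N(1) assms(5) by (intro compact_Un compact_UN) auto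
    have "K' = \<Union>(insert {z} (N ` F))" by (auto simp: K'_def)
    moreover have "connected \<dots>" using F(1) N(2,4) assms(5) by (intro connected_Union) auto
    ultimately show "connected K'" by simp
    show "K \<subseteq> K'" using F(3) interior_subset unfolding K'_def by blast
    show "K' \<subseteq> \<Omega>" using F(1) N(3) assms(5) z by (auto simp: K'_def)
    show "K' \<noteq> {}" by (simp add: K'_def)
  qed
qed

text \<open>Filling in those holes of a connected compact set that are contained in \<open>\<Omega>\<close>.\<close>

lemma connected_convex_hull_in:
  assumes \<Omega>: "open \<Omega>" "connected \<Omega>" "\<Omega> \<noteq> {}" and K: "compact K" "K \<subseteq> \<Omega>"
  obtains E where "convex_compact_in \<Omega> E" "connected E" "K \<subseteq> E" "E \<noteq> {}"
proof -
  obtain X where X: "compact X" "connected X" "K \<subseteq> X" "X \<subseteq> \<Omega>" "X \<noteq> {}"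
    using compact_subset_connected_compact[OF \<Omega> K] by metis
  have cX: "closed X" using X(1) compact_imp_closed by blast
  define keep where "keep = {D \<in> components (- X). \<not> (bounded D \<and> D \<subseteq> \<Omega>)}"
  define E where "E = - \<Union>keep"
  have E: "E = X \<union> \<Union>{D \<in> components (- X). bounded D \<and> D \<subseteq> \<Omega>}"
  proof (rule set_eqI)
    fix z
    show "z \<in> E \<longleftrightarrow> z \<in> X \<union> \<Union>{D \<in> components (- X). bounded D \<and> D \<subseteq> \<Omega>}"
    proof (cases "z \<in> X")
      case True
      then show ?thesis using component_disjoint by (auto simp: E_def keep_def)
    next
      case False
      then obtain D where D: "D \<in> components (- X)" "z \<in> D" using component_containing by metis
      have "D' = D" if "D' \<in> components (- X)" "z \<in> D'" for D'
        using that D components_eq by blast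
      then show ?thesis using False D by (auto simp: E_def keep_def)
    qed
  qed
  obtain R where R: "X \<subseteq> cball 0 R" using bounded_subset_cballD compact_imp_bounded[OF X(1)] by blast
  have "closed E"
    unfolding E_def by (rule closed_Compl[OF open_Union]) (use component_open[OF cX] in \<open>auto simp: keep_def\<close>)
  moreover have "E \<subseteq> cball 0 R" using R bounded_component_subset_cball[OF R] unfolding E by blast
  ultimately have cE: "compact E" using bounded_subset[OF bounded_cball] compact_eq_bounded_closed by blast
  have conE: "connected E"
  proof -
    have "E = \<Union>(insert X ((\<lambda>D. X \<union> D) ` {D \<in> components (- X). bounded D \<and> D \<subseteq> \<Omega>}))"
      unfolding E by auto
    moreover have "connected \<dots>"
      using X(2,5) connected_Un_complement_component[OF X(2) cX] by (intro connected_Union) auto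
    ultimately show ?thesis by simp
  qed
  have "convex_compact_in \<Omega> E"
    unfolding convex_compact_in_def
  proof (intro conjI cE ballI)
    show "E \<subseteq> \<Omega>" unfolding E using X(4) by blast
    fix C assume "C \<in> holes E"
    then have C: "C \<in> components (- E)" "bounded C" by (auto simp: holes_def)
    obtain c where c: "c \<in> C" using C(1) in_components_nonempty by blast
    then have "c \<in> \<Union>keep" using component_disjoint[OF C(1)] by (auto simp: E_def)
    then obtain D where D: "D \<in> keep" "c \<in> D" by blast
    have DX: "D \<in> components (- X)" using D by (simp add: keep_def)
    have CX: "C \<inter> X = {}" using component_disjoint[OF C(1)] unfolding E by blast
    have "C \<subseteq> D"
      by (rule connected_in_component[OF in_components_connected[OF C(1)] CX DX]) (use c D in blast)
    moreover have "D \<subseteq> C"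
      by (rule connected_in_component[OF in_components_connected[OF DX] _ C(1)]) (use c D in \<open>auto simp: E_def\<close>)
    ultimately have "C = D" by blast
    then show "\<exists>z\<in>C. z \<notin> \<Omega>" using D(1) C(2) by (auto simp: keep_def)
  qed
  then show ?thesis using that conE X(3,5) unfolding E by blast
qed

text \<open>The holes are open, and each of them meets the compact part of the complement of \<open>\<Omega>\<close> inside a large disc.\<close>

lemma finite_holes:
  assumes "convex_compact_in \<Omega> E" "open \<Omega>"
  shows "finite (holes E)"
proof -
  have E: "compact E" "E \<subseteq> \<Omega>" "\<And>C. C \<in> holes E \<Longrightarrow> \<exists>z\<in>C. z \<notin> \<Omega>"
    using assms(1) by (auto simp: convex_compact_in_def)
  obtain R where R: "E \<subseteq> cball 0 R" using bounded_subset_cballD compact_imp_bounded[OF E(1)] by blast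
  define T where "T = - \<Omega> \<inter> cball 0 R"
  have "compact T" unfolding T_def using assms(2) by (intro closed_Int_compact) auto
  moreover have "\<And>C. C \<in> components (- E) \<Longrightarrow> open C" using component_open compact_imp_closed[OF E(1)] by blast
  moreover have "T \<subseteq> \<Union>(components (- E))" using E(2) by (auto simp: T_def Union_components)
  ultimately obtain \<D> where D: "\<D> \<subseteq> components (- E)" "finite \<D>" "T \<subseteq> \<Union>\<D>"
    using compactE by metis
  have "holes E \<subseteq> \<D>"
  proof
    fix C assume C: "C \<in> holes E"
    then obtain z where z: "z \<in> C" "z \<notin> \<Omega>" using E(3) by blast
    have C': "C \<in> components (- E)" "bounded C" using C by (auto simp: holes_def)
    have "C \<subseteq> cball 0 R" by (rule bounded_component_subset_cball[OF R C'])
    then have "z \<in> T" using z by (auto simp: T_def)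
    then obtain D where "D \<in> \<D>" "z \<in> D" using D(3) by blast
    then have "C = D" using C' D(1) z components_eq by blast
    then show "C \<in> \<D>" using \<open>D \<in> \<D>\<close> by simp
  qed
  then show ?thesis using D(2) finite_subset by blast
qed

section \<open>Counting holes with continuous logarithms\<close>

lemma continuous_logarithms_differ_by_constant:
  fixes f g :: "'a::topological_space \<Rightarrow> complex"
  assumes "connected S" "continuous_on S f" "continuous_on S g" "\<And>x. x \<in> S \<Longrightarrow> exp (f x) = exp (g x)"
  obtains n :: int where "\<And>x. x \<in> S \<Longrightarrow> f x = g x + 2 * of_int n * of_real pi * \<i>"
proof (cases "S = {}")
  case False
  then obtain a where a: "a \<in> S" by blast
  have ex: "\<exists>n::int. f x - g x = 2 * of_int n * of_real pi * \<i>" if "x \<in> S" for x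
    using assms(4)[OF that] unfolding exp_eq by (auto simp: algebra_simps)
  have "(\<lambda>x. f x - g x) constant_on S"
  proof (rule continuous_discrete_range_constant[OF assms(1)])
    show "continuous_on S (\<lambda>x. f x - g x)" using assms by (intro continuous_intros)
    fix x assume x: "x \<in> S"
    show "\<exists>e>0. \<forall>y. y \<in> S \<and> f y - g y \<noteq> f x - g x \<longrightarrow> e \<le> cmod (f y - g y - (f x - g x))"
    proof (intro exI[of _ "2 * pi"] conjI allI impI)
      fix y assume y: "y \<in> S \<and> f y - g y \<noteq> f x - g x"
      obtain n m :: int where nm: "f x - g x = 2 * of_int n * of_real pi * \<i>" "f y - g y = 2 * of_int m * of_real pi * \<i>"
        using ex x y by meson
      then have "f y - g y - (f x - g x) = of_int (m - n) * (2 * of_real pi * \<i>)" by (simp add: algebra_simps)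
      then have "cmod (f y - g y - (f x - g x)) = \<bar>of_int (m - n)\<bar> * (2 * pi)"
        by (simp add: norm_mult del: of_int_diff)
      moreover have "1 \<le> \<bar>real_of_int (m - n)\<bar>"
      proof -
        have "m \<noteq> n" using nm y by auto
        then have "1 \<le> \<bar>m - n\<bar>" by simp
        then show ?thesis by linarith
      qed
      then have "1 * (2 * pi) \<le> \<bar>real_of_int (m - n)\<bar> * (2 * pi)" by (intro mult_right_mono) auto
      ultimately show "2 * pi \<le> cmod (f y - g y - (f x - g x))" by simp
    qed simp
  qed
  then obtain c where c: "\<And>x. x \<in> S \<Longrightarrow> f x - g x = c" by (auto simp: constant_on_def)
  obtain n :: int where "c = 2 * of_int n * of_real pi * \<i>" using ex[OF a] c[OF a] by auto
  then show ?thesis using that[of n] c by (metis add.commute diff_eq_eq)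
qed (use that in auto)

text \<open>Going once around the circle changes a logarithm of \<open>(z - c)\<^sup>m\<close> by \<open>2 \<pi> \<i> m\<close>.\<close>

lemma logarithm_of_power_on_sphere:
  fixes c :: complex
  assumes "r > 0" "continuous_on (sphere c r) G" "\<And>z. z \<in> sphere c r \<Longrightarrow> (z - c) powi m = exp (G z)"
  shows "m = 0"
proof -
  define \<gamma> where "\<gamma> t = c + of_real r * exp (\<i> * of_real t)" for t :: real
  have \<gamma>: "\<gamma> t \<in> sphere c r" for t using assms(1) by (simp add: \<gamma>_def dist_norm norm_mult)
  have c1: "continuous_on {0..2 * pi} (\<lambda>t. G (\<gamma> t))"
    by (rule continuous_on_compose2[OF assms(2)]) (use \<gamma> in \<open>auto simp: \<gamma>_def intro!: continuous_intros\<close>)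
  have c2: "continuous_on {0..2 * pi} (\<lambda>t. of_int m * (of_real (ln r) + \<i> * of_real t))"
    by (intro continuous_intros)
  have "exp (of_int m * (of_real (ln r) + \<i> * of_real t)) = exp (G (\<gamma> t))" for t
  proof -
    have "exp (of_real (ln r) + \<i> * of_real t) = \<gamma> t - c"
      using assms(1) by (simp add: \<gamma>_def exp_add exp_of_real)
    then show ?thesis using assms(3)[OF \<gamma>, of t] exp_power_int[of "of_real (ln r) + \<i> * of_real t" m] by simp
  qed
  then obtain n :: int where n: "\<And>t. t \<in> {0..2 * pi} \<Longrightarrow>
      G (\<gamma> t) = of_int m * (of_real (ln r) + \<i> * of_real t) + 2 * of_int n * of_real pi * \<i>"
    by - (rule continuous_logarithms_differ_by_constant[OF connected_Icc c1 c2], auto)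
  have "\<gamma> (2 * pi) = \<gamma> 0" by (simp add: \<gamma>_def exp_two_pi_i' mult.commute)
  then have "of_int m * (\<i> * of_real (2 * pi)) = 0" using n[of 0] n[of "2 * pi"] by (simp add: algebra_simps)
  then show ?thesis by simp
qed

text \<open>The universal covering \<open>b + exp \<zeta>\<close> turns \<open>g\<close> into \<open>exp (h \<zeta>)\<close>. The translation by \<open>2 \<pi> \<i>\<close> changes \<open>h\<close> by a constant
\<open>2 \<pi> \<i> k\<close>, so \<open>h \<zeta> - k \<zeta>\<close> is periodic and descends to the punctured plane.\<close>

lemma logarithm_on_punctured_plane:
  fixes g :: "complex \<Rightarrow> complex"
  assumes cont: "continuous_on (- {b}) g" and nz: "\<And>w. w \<noteq> b \<Longrightarrow> g w \<noteq> 0"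
  shows "\<exists>(k::int) H. continuous_on (- {b}) H \<and> (\<forall>w. w \<noteq> b \<longrightarrow> g w = (w - b) powi k * exp (H w))"
proof -
  have "continuous_on UNIV (\<lambda>\<zeta>. g (b + exp \<zeta>))"
    by (rule continuous_on_compose2[OF cont]) (auto intro!: continuous_intros)
  then obtain h where h: "continuous_on UNIV h" "\<And>\<zeta>. g (b + exp \<zeta>) = exp (h \<zeta>)"
    by (rule continuous_logarithm_on_contractible[OF _ contractible_UNIV]) (use nz in auto)
  have hc: "continuous_on UNIV (\<lambda>\<zeta>. h (\<zeta> + 2 * of_real pi * \<i>))"
    by (rule continuous_on_compose2[OF h(1)]) (auto intro!: continuous_intros)
  have he: "exp (h (\<zeta> + 2 * of_real pi * \<i>)) = exp (h \<zeta>)" for \<zeta>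
    by (simp flip: h(2) add: exp_add exp_two_pi_i)
  obtain k :: int where k: "\<And>\<zeta>. h (\<zeta> + 2 * of_real pi * \<i>) = h \<zeta> + 2 * of_int k * of_real pi * \<i>"
    using continuous_logarithms_differ_by_constant[OF connected_UNIV hc h(1) he] by auto
  define Q where "Q \<zeta> = h \<zeta> - of_int k * \<zeta>" for \<zeta>
  have Q1: "Q (\<zeta> + 2 * of_real pi * \<i>) = Q \<zeta>" for \<zeta> using k[of \<zeta>] by (simp add: Q_def algebra_simps)
  have Qnat: "Q (\<zeta> + of_nat n * (2 * of_real pi * \<i>)) = Q \<zeta>" for \<zeta> n
  proof (induction n)
    case (Suc n)
    have "Q (\<zeta> + of_nat (Suc n) * (2 * of_real pi * \<i>)) = Q ((\<zeta> + of_nat n * (2 * of_real pi * \<i>)) + 2 * of_real pi * \<i>)"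
      by (simp add: algebra_simps)
    then show ?case using Suc Q1 by simp
  qed simp
  have Qint: "Q (\<zeta> + of_int n * (2 * of_real pi * \<i>)) = Q \<zeta>" for \<zeta> n
  proof (cases "n \<ge> 0")
    case True
    then show ?thesis using Qnat[of \<zeta> "nat n"] by simp
  next
    case False
    then show ?thesis using Qnat[of "\<zeta> + of_int n * (2 * of_real pi * \<i>)" "nat (- n)"] by simp
  qed
  have Qexp: "Q x = Q y" if e: "exp x = exp y" for x y
  proof -
    obtain n :: int where "x = y + (of_int (2 * n) * pi) * \<i>" using e unfolding exp_eq by blast
    then show ?thesis using Qint[of y n] by (simp add: algebra_simps)
  qed
  have contQ: "continuous_on UNIV Q" unfolding Q_def using h(1) by (intro continuous_intros)
  define H where "H w = Q (Ln (w - b))" for w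
  \<comment> \<open>On the branch cut of \<open>Ln\<close> this other branch of the logarithm is continuous, and \<open>Q\<close> does not see the difference.\<close>
  have H2: "H w = Q (Ln (- (w - b)) + \<i> * of_real pi)" if "w \<noteq> b" for w
    unfolding H_def by (rule Qexp) (use that in \<open>simp add: exp_add exp_Ln mult.commute[of \<i>]\<close>)
  show ?thesis
  proof (intro exI conjI allI impI)
    show "continuous_on (- {b}) H"
    proof (rule continuous_at_imp_continuous_on, rule ballI)
      fix w assume w: "w \<in> - {b}"
      have cQ: "isCont Q x" for x using contQ by (simp add: continuous_on_eq_continuous_at)
      show "isCont H w"
      proof (cases "w - b \<in> \<real>\<^sub>\<le>\<^sub>0")
        case False
        have "isCont (\<lambda>w. Ln (w - b)) w" using False by (intro continuous_intros) auto
        then show ?thesis unfolding H_def by (rule isCont_o2) (rule cQ)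
      next
        case True
        then have "- (w - b) \<notin> \<real>\<^sub>\<le>\<^sub>0" using w by (auto simp: complex_nonpos_Reals_iff complex_eq_iff)
        then have "isCont (\<lambda>w. Ln (- (w - b)) + \<i> * of_real pi) w" by (intro continuous_intros) auto
        then have "isCont (\<lambda>w. Q (Ln (- (w - b)) + \<i> * of_real pi)) w" by (rule isCont_o2) (rule cQ)
        moreover have ev: "\<forall>\<^sub>F x in nhds w. Q (Ln (- (x - b)) + \<i> * of_real pi) = H x"
        proof (rule eventually_nhds_in_open[THEN eventually_mono])
          show "open (- {b})" by (simp add: open_Compl)
        qed (use w H2 in auto)
        ultimately show ?thesis using isCont_cong[OF ev] by simp
      qed
    qed
    fix w assume w: "w \<noteq> b"
    have "g w = exp (h (Ln (w - b)))" using h(2)[of "Ln (w - b)"] w by (simp add: exp_Ln)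
    also have "h (Ln (w - b)) = of_int k * Ln (w - b) + H w" by (simp add: H_def Q_def)
    also have "exp \<dots> = (w - b) powi k * exp (H w)"
      using w exp_power_int[of "Ln (w - b)" k] by (simp add: exp_add exp_Ln)
    finally show "g w = (w - b) powi k * exp (H w)" .
  qed
qed

text \<open>A nowhere vanishing function on a compact set with at most one hole extends, up to its modulus, to the plane punctured at a
point of that hole (this is an extension theorem for maps into the circle). So its homotopy class is that of a
power of \<open>w - b\<close>.\<close>

lemma logarithm_on_compact_with_one_hole:
  fixes u :: "complex \<Rightarrow> complex"
  assumes L: "compact L" "b \<notin> L" "\<And>C. C \<in> components (- L) \<Longrightarrow> bounded C \<Longrightarrow> b \<in> C"
    and u: "continuous_on L u" "\<And>w. w \<in> L \<Longrightarrow> u w \<noteq> 0"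
  shows "\<exists>(k::int) H. continuous_on L H \<and> (\<forall>w\<in>L. u w = (w - b) powi k * exp (H w))"
proof -
  define v where "v w = u w / of_real (cmod (u w))" for w
  have v: "continuous_on L v" "v \<in> L \<rightarrow> sphere 0 1"
    unfolding v_def using u by (auto intro!: continuous_intros simp: norm_divide)
  obtain F g where F: "F \<subseteq> {b}" "continuous_on (- F) g" "g \<in> (- F) \<rightarrow> sphere 0 1" "\<And>x. x \<in> L \<Longrightarrow> g x = v x"
    by (rule extend_map_UNIV_to_sphere_cofinite[OF _ _ L(1) v, of "{b}"]) (use L(3) in auto)
  have cg: "continuous_on (- {b}) g" using F by (auto intro: continuous_on_subset)
  have gn: "g w \<noteq> 0" if "w \<noteq> b" for w
  proof -
    have "w \<in> - F" using F(1) that by blast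
    then have "g w \<in> sphere 0 1" using F(3) by blast
    then show ?thesis by auto
  qed
  obtain k :: int and H where H: "continuous_on (- {b}) H" "\<And>w. w \<noteq> b \<Longrightarrow> g w = (w - b) powi k * exp (H w)"
    using logarithm_on_punctured_plane[OF cg gn] by auto
  show ?thesis
  proof (intro exI conjI ballI)
    show "continuous_on L (\<lambda>w. H w + of_real (ln (cmod (u w))))"
      using u L(2) by (intro continuous_intros continuous_on_subset[OF H(1)]) auto
    fix w assume w: "w \<in> L"
    then have "w \<noteq> b" using L(2) by blast
    have "u w = g w * of_real (cmod (u w))" using F(4)[OF w] u(2)[OF w] by (simp add: v_def)
    also have "of_real (cmod (u w)) = exp (of_real (ln (cmod (u w))) :: complex)"
      using u(2)[OF w] by (simp add: exp_of_real)
    finally show "u w = (w - b) powi k * exp (H w + of_real (ln (cmod (u w))))"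
      using H(2)[OF \<open>w \<noteq> b\<close>] by (simp add: exp_add mult.assoc)
  qed
qed

text \<open>Distinct holes give independent classes: if a product of powers of \<open>z - a\<close> and \<open>z - b\<close> has a logarithm on \<open>K\<close>, then
filling the hole \<open>C\<close> of \<open>a\<close> with the exponential of an extended logarithm gives a function \<open>g\<close> without zeros on the plane
punctured at \<open>b\<close>. Its winding numbers on small circles around \<open>b\<close> and on large circles agree; they are \<open>l\<close> and
\<open>m + l\<close>.\<close>

lemma logarithm_excludes_hole:
  fixes K :: "complex set"
  assumes K: "compact K" and C: "C \<in> components (- K)" "bounded C" "a \<in> C" and b: "b \<notin> K" "b \<notin> C"
    and H: "continuous_on K H" "\<And>z. z \<in> K \<Longrightarrow> (z - a) powi m * (z - b) powi l = exp (H z)"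
  shows "m = 0"
proof -
  have op: "open C" using C(1) K by (meson compact_imp_closed open_Compl open_components)
  have CK: "C \<inter> K = {}" using C(1) in_components_subset by blast
  have cl: "closure C \<subseteq> C \<union> K"
    using C(1) K compact_imp_closed frontier_of_components_closed_complement closure_Un_frontier by blast
  then have bcl: "b \<notin> closure C" using b by blast
  obtain J where J: "continuous_on UNIV J" "\<And>z. z \<in> K \<Longrightarrow> J z = H z"
    using Tietze_unbounded[OF H(1), of UNIV] compact_imp_closed[OF K] by auto
  define p where "p z = (z - a) powi m * (z - b) powi l" for z
  define g where "g z = (if z \<in> C then exp (J z) else p z)" for z
  have contg: "continuous_on (- {b}) g"
  proof -
    have un: "closure C \<union> (- C - {b}) = - {b}" using bcl closure_subset by blast
    have "continuous_on (closure C \<union> (- C - {b})) (\<lambda>z. if z \<in> C then exp (J z) else p z)"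
    proof (rule continuous_on_cases_local)
      show "closedin (top_of_set (closure C \<union> (- C - {b}))) (closure C)"
        by (rule closed_subset) auto
      have "- C - {b} = (closure C \<union> (- C - {b})) \<inter> - C" unfolding un by auto
      then show "closedin (top_of_set (closure C \<union> (- C - {b}))) (- C - {b})"
        using op by (metis closedin_closed_Int closed_Compl)
      show "continuous_on (closure C) (\<lambda>z. exp (J z))"
        by (intro continuous_intros continuous_on_subset[OF J(1)]) auto
      show "continuous_on (- C - {b}) p"
        unfolding p_def using C(3) by (intro continuous_intros) auto
      fix z assume "z \<in> closure C \<and> z \<notin> C \<or> z \<in> - C - {b} \<and> z \<in> C"
      then have "z \<in> K" using cl by blast
      then show "exp (J z) = p z" using J(2) H(2) by (simp add: p_def)
    qed
    then show ?thesis unfolding un g_def .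
  qed
  have gn: "g z \<noteq> 0" if "z \<noteq> b" for z using that C(3) by (auto simp: g_def p_def power_int_eq_0_iff)
  obtain k :: int and G where G: "continuous_on (- {b}) G" "\<And>z. z \<noteq> b \<Longrightarrow> g z = (z - b) powi k * exp (G z)"
    using logarithm_on_punctured_plane[OF contg gn] by auto
  have out: "(z - a) powi m * (z - b) powi (l - k) = exp (G z)" if "z \<notin> C" "z \<noteq> b" for z
  proof -
    have "(z - a) powi m * (z - b) powi l = (z - b) powi k * exp (G z)"
      using G(2)[OF that(2)] that(1) by (simp add: g_def p_def)
    then show ?thesis using that(2) by (simp add: power_int_diff field_simps)
  qed
  \<comment> \<open>On a small disc around \<open>b\<close> the factor \<open>(z - a)\<^sup>m\<close> has a logarithm.\<close>
  have "l - k = 0"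
  proof -
    have "open (- closure C)" by (simp add: open_Compl)
    then obtain r where r: "r > 0" "cball b r \<subseteq> - closure C" using bcl open_contains_cball by blast
    have aout: "a \<notin> cball b r" using r(2) C(3) closure_subset by blast
    obtain q where q: "continuous_on (cball b r) q" "\<And>z. z \<in> cball b r \<Longrightarrow> z - a = exp (q z)"
      by (rule continuous_logarithm_on_cball[of b r "\<lambda>z. z - a"]) (use aout in \<open>auto intro!: continuous_intros\<close>)
    show ?thesis
    proof (rule logarithm_of_power_on_sphere[OF r(1)])
      show "continuous_on (sphere b r) (\<lambda>z. G z - of_int m * q z)"
        using r(1) by (intro continuous_intros continuous_on_subset[OF G(1)] continuous_on_subset[OF q(1)]) auto
      fix z assume z: "z \<in> sphere b r"
      then have "z \<notin> C" "z \<noteq> b" "z \<in> cball b r" using r closure_subset[of C] by auto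
      from out[OF this(1,2)] q(2)[OF this(3)]
      show "(z - b) powi (l - k) = exp (G z - of_int m * q z)"
        by (simp add: exp_diff exp_power_int field_simps)
    qed
  qed
  \<comment> \<open>The circle of radius \<open>R\<close> around \<open>a\<close> encloses \<open>C\<close> and \<open>b\<close>.\<close>
  obtain R where R: "\<And>z. z \<in> insert b C \<Longrightarrow> cmod (z - a) < R" "R > 0"
  proof -
    have "bounded (insert b C)" using C(2) by simp
    then obtain R where "R > 0" "insert b C \<subseteq> ball a R" using bounded_subset_ballD by blast
    then have "cmod (z - a) < R" if "z \<in> insert b C" for z
      using that by (metis dist_norm mem_ball norm_minus_commute subsetD)
    then show ?thesis using that \<open>R > 0\<close> by blast
  qed
  show ?thesis
  proof (rule logarithm_of_power_on_sphere[OF R(2)])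
    have nb: "b \<notin> sphere a R" using R(1)[of b] by (auto simp: dist_norm norm_minus_commute)
    then show "continuous_on (sphere a R) G" by (intro continuous_on_subset[OF G(1)]) auto
    fix z assume z: "z \<in> sphere a R"
    then have "z \<notin> C" "z \<noteq> b" using R(1)[of z] nb by (auto simp: dist_norm norm_minus_commute)
    from out[OF this] show "(z - a) powi m = exp (G z)" using \<open>l - k = 0\<close> by simp
  qed
qed

text \<open>If \<open>\<phi>(K)\<close> had at most one hole, the functions \<open>z - a1\<close> and \<open>z - a2\<close>, transported to \<open>\<phi>(K)\<close>, would up to
logarithms be the powers with exponents \<open>k1\<close> and \<open>k2\<close> of one function. Then the product of \<open>(z - a1) powi k2\<close> and
\<open>(z - a2) powi (- k1)\<close> has a logarithm, which forces \<open>k2 = 0\<close>,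
and so \<open>z - a2\<close> itself has one: a contradiction.\<close>

lemma two_holes_preserved:
  fixes \<phi> :: "complex \<Rightarrow> complex"
  assumes K: "compact K" and \<phi>: "continuous_on K \<phi>" "inj_on \<phi> K"
    and C: "C1 \<in> components (- K)" "bounded C1" "C2 \<in> components (- K)" "bounded C2" "C1 \<noteq> C2"
  shows "\<exists>D1 D2. D1 \<in> components (- (\<phi> ` K)) \<and> bounded D1 \<and> D2 \<in> components (- (\<phi> ` K)) \<and> bounded D2 \<and> D1 \<noteq> D2"
proof (rule ccontr)
  assume none: "\<not> ?thesis"
  have one: "D1 = D2" if "D1 \<in> components (- (\<phi> ` K))" "bounded D1" "D2 \<in> components (- (\<phi> ` K))" "bounded D2" for D1 D2
    using that none by blast
  have L: "compact (\<phi> ` K)" using K \<phi>(1) compact_continuous_image by blast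
  obtain b where b: "b \<notin> \<phi> ` K" "\<And>D. D \<in> components (- (\<phi> ` K)) \<Longrightarrow> bounded D \<Longrightarrow> b \<in> D"
  proof (cases "\<exists>D. D \<in> components (- (\<phi> ` K)) \<and> bounded D")
    case True
    then obtain D where D: "D \<in> components (- (\<phi> ` K))" "bounded D" by blast
    then obtain b where "b \<in> D" using in_components_nonempty by blast
    moreover have "b \<notin> \<phi> ` K" using D(1) calculation in_components_subset by blast
    ultimately show ?thesis using that one D by blast
  next
    case False
    have "\<phi> ` K \<noteq> UNIV" using L compact_imp_bounded by (metis not_bounded_UNIV)
    then show ?thesis using that False by blast
  qed
  obtain a1 where a1: "a1 \<in> C1" using C(1) in_components_nonempty by blast
  obtain a2 where a2: "a2 \<in> C2" using C(3) in_components_nonempty by blast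
  have disj: "C1 \<inter> C2 = {}" using C(1,3,5) components_nonoverlap by blast
  have aK: "a1 \<notin> K" "a2 \<notin> K" using a1 a2 C(1,3) in_components_subset by blast+
  obtain \<theta> where \<theta>: "homeomorphism K (\<phi> ` K) \<phi> \<theta>" using homeomorphism_compact[OF K \<phi>(1) refl \<phi>(2)] by blast
  have c\<theta>: "continuous_on (\<phi> ` K) \<theta>" using \<theta> by (simp add: homeomorphism_def)
  have \<theta>\<phi>: "\<theta> (\<phi> z) = z" if "z \<in> K" for z using \<theta> that by (simp add: homeomorphism_def)
  have log: "\<exists>(k::int) H. continuous_on K H \<and> (\<forall>z\<in>K. z - a = (\<phi> z - b) powi k * exp (H z))" if a: "a \<notin> K" for a
  proof -
    have c: "continuous_on (\<phi> ` K) (\<lambda>w. \<theta> w - a)" using c\<theta> by (intro continuous_intros)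
    have n: "\<theta> w - a \<noteq> 0" if "w \<in> \<phi> ` K" for w using that \<theta>\<phi> a by auto
    obtain k :: int and H where H: "continuous_on (\<phi> ` K) H"
      "\<And>w. w \<in> \<phi> ` K \<Longrightarrow> \<theta> w - a = (w - b) powi k * exp (H w)"
      using logarithm_on_compact_with_one_hole[OF L b c n] by auto
    have "continuous_on K (\<lambda>z. H (\<phi> z))" by (rule continuous_on_compose2[OF H(1) \<phi>(1)]) auto
    moreover have "z - a = (\<phi> z - b) powi k * exp (H (\<phi> z))" if "z \<in> K" for z
      using H(2)[of "\<phi> z"] \<theta>\<phi>[OF that] that by simp
    ultimately show ?thesis by (intro exI[of _ k] exI[of _ "\<lambda>z. H (\<phi> z)"]) auto
  qed
  obtain k1 :: int and H1 where 1: "continuous_on K H1" "\<And>z. z \<in> K \<Longrightarrow> z - a1 = (\<phi> z - b) powi k1 * exp (H1 z)"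
    using log[OF aK(1)] by blast
  obtain k2 :: int and H2 where 2: "continuous_on K H2" "\<And>z. z \<in> K \<Longrightarrow> z - a2 = (\<phi> z - b) powi k2 * exp (H2 z)"
    using log[OF aK(2)] by blast
  have "k2 = 0"
  proof (rule logarithm_excludes_hole[OF K C(1,2) a1 aK(2)])
    show "a2 \<notin> C1" using a2 disj by blast
    show "continuous_on K (\<lambda>z. of_int k2 * H1 z - of_int k1 * H2 z)" using 1 2 by (intro continuous_intros)
    fix z assume z: "z \<in> K"
    then have nz: "\<phi> z - b \<noteq> 0" using b(1) by auto
    have "(z - a1) powi k2 * (z - a2) powi (- k1)
      = ((\<phi> z - b) powi (k1 * k2) * exp (H1 z) powi k2) * ((\<phi> z - b) powi (k2 * (- k1)) * exp (H2 z) powi (- k1))"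
      using 1(2)[OF z] 2(2)[OF z] by (simp only: power_int_mult_distrib power_int_mult)
    also have "\<dots> = exp (H1 z) powi k2 * exp (H2 z) powi (- k1)"
      using nz by (simp add: mult.commute[of k2] power_int_minus)
    also have "\<dots> = exp (of_int k2 * H1 z - of_int k1 * H2 z)"
      by (simp add: exp_diff exp_power_int power_int_minus field_simps)
    finally show "(z - a1) powi k2 * (z - a2) powi (- k1) = exp (of_int k2 * H1 z - of_int k1 * H2 z)" .
  qed
  moreover have "(1::int) = 0"
  proof (rule logarithm_excludes_hole[OF K C(3,4) a2 aK(1)])
    show "a1 \<notin> C2" using a1 disj by blast
    show "continuous_on K H2" by (rule 2(1))
    show "(z - a2) powi 1 * (z - a1) powi 0 = exp (H2 z)" if "z \<in> K" for z
      using 2(2)[OF that] \<open>k2 = 0\<close> by simp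
  qed
  ultimately show False by simp
qed

section \<open>Unions of two distant continua\<close>

lemma separated_antimono:
  assumes "X \<subseteq> Y" "connected_component (- Y) p q"
  shows "connected_component (- X) p q"
  using assms connected_component_mono[of "- Y" "- X"] by blast

lemma bounded_component_antimono:
  assumes "X \<subseteq> Y" "bounded (connected_component_set (- X) p)"
  shows "bounded (connected_component_set (- Y) p)"
  by (rule bounded_subset[OF assms(2)]) (use separated_antimono[OF assms(1)] in blast)

text \<open>The continuum \<open>K\<close> detects in each component \<open>A\<close> of the complement of \<open>E\<close> what is needed to keep \<open>\<psi>\<^sub>n(E)\<close> from
enclosing all of \<open>A - \<Omega>\<close>. If a hole \<open>A\<close> of \<open>E\<close> contains points of two components of the complement of \<open>\<Omega>\<close>, then \<open>K\<close>
separates two points of \<open>A - \<Omega>\<close>; if the unbounded \<open>A\<close> contains a hole of \<open>\<Omega>\<close>, then \<open>K\<close> surrounds a point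
of \<open>A - \<Omega>\<close>. Finitely many compact sets suffice because \<open>E\<close> has only finitely many holes.\<close>

lemma separating_continuum:
  fixes \<Omega> :: "complex set"
  assumes \<Omega>: "open \<Omega>" "connected \<Omega>" "\<Omega> \<noteq> {}" and E: "convex_compact_in \<Omega> E"
  obtains K where "convex_compact_in \<Omega> K" "connected K" "E \<subseteq> K" "K \<noteq> {}"
    "\<And>A p q. A \<in> holes E \<Longrightarrow> p \<in> A - \<Omega> \<Longrightarrow> q \<in> A - \<Omega> \<Longrightarrow> \<not> connected_component (- \<Omega>) p q \<Longrightarrow>
        \<exists>p\<in>A - \<Omega>. \<exists>q\<in>A - \<Omega>. \<not> connected_component (- K) p q"
    "\<And>A p. A \<in> components (- E) \<Longrightarrow> \<not> bounded A \<Longrightarrow> p \<in> A - \<Omega> \<Longrightarrow> bounded (connected_component_set (- \<Omega>) p) \<Longrightarrow>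
        \<exists>p\<in>A - \<Omega>. bounded (connected_component_set (- K) p)"
proof -
  have cE: "compact E" "E \<subseteq> \<Omega>" using E by (auto simp: convex_compact_in_def)
  have "\<exists>X. compact X \<and> X \<subseteq> \<Omega> \<and>
      ((\<exists>p\<in>A - \<Omega>. \<exists>q\<in>A - \<Omega>. \<not> connected_component (- \<Omega>) p q) \<longrightarrow>
         (\<exists>p\<in>A - \<Omega>. \<exists>q\<in>A - \<Omega>. \<not> connected_component (- X) p q))" if A: "A \<in> holes E" for A
  proof (cases "\<exists>p\<in>A - \<Omega>. \<exists>q\<in>A - \<Omega>. \<not> connected_component (- \<Omega>) p q")
    case True
    then obtain p q where pq: "p \<in> A - \<Omega>" "q \<in> A - \<Omega>" "\<not> connected_component (- \<Omega>) p q" by blast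
    have A': "A \<in> components (- E)" "bounded A" using A by (auto simp: holes_def)
    have "connected_component_set (- \<Omega>) p \<subseteq> A"
    proof (rule connected_in_component[OF _ _ A'(1)])
      show "connected_component_set (- \<Omega>) p \<inter> E = {}" using cE(2) connected_component_subset[of "- \<Omega>" p] by blast
      have "p \<in> connected_component_set (- \<Omega>) p" using pq(1) by simp
      then show "connected_component_set (- \<Omega>) p \<inter> A \<noteq> {}" using pq(1) by blast
    qed simp
    then have "bounded (connected_component_set (- \<Omega>) p)" using A'(2) bounded_subset by blast
    then obtain X where X: "compact X" "X \<subseteq> \<Omega>" "\<not> connected_component (- X) p q"
      using separating_compact[OF \<Omega>(1) _ refl, of p q] pq by auto
    then show ?thesis using pq by blast
  next
    case False
    then show ?thesis by (intro exI[of _ "{}"]) auto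
  qed
  then obtain X where X: "\<And>A. A \<in> holes E \<Longrightarrow> compact (X A)" "\<And>A. A \<in> holes E \<Longrightarrow> X A \<subseteq> \<Omega>"
    "\<And>A. A \<in> holes E \<Longrightarrow> (\<exists>p\<in>A - \<Omega>. \<exists>q\<in>A - \<Omega>. \<not> connected_component (- \<Omega>) p q) \<Longrightarrow>
         \<exists>p\<in>A - \<Omega>. \<exists>q\<in>A - \<Omega>. \<not> connected_component (- X A) p q" by metis
  have uniq: "A = A'" if "A \<in> components (- E)" "\<not> bounded A" "A' \<in> components (- E)" "\<not> bounded A'" for A A'
    using cobounded_unique_unbounded_components[of "- E" A A'] that cE(1) by (simp add: compact_imp_bounded)
  obtain Y where Y: "compact Y" "Y \<subseteq> \<Omega>"
    "\<And>A p. A \<in> components (- E) \<Longrightarrow> \<not> bounded A \<Longrightarrow> p \<in> A - \<Omega> \<Longrightarrow> bounded (connected_component_set (- \<Omega>) p) \<Longrightarrow>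
        \<exists>p\<in>A - \<Omega>. bounded (connected_component_set (- Y) p)"
  proof (cases "\<exists>A p. A \<in> components (- E) \<and> \<not> bounded A \<and> p \<in> A - \<Omega> \<and> bounded (connected_component_set (- \<Omega>) p)")
    case True
    then obtain A p where A: "A \<in> components (- E)" "\<not> bounded A" "p \<in> A - \<Omega>"
      "bounded (connected_component_set (- \<Omega>) p)" by blast
    have "\<exists>q. q \<notin> connected_component_set (- \<Omega>) p" using A(4) not_bounded_UNIV by (metis UNIV_eq_I)
    then obtain q where q: "q \<notin> connected_component_set (- \<Omega>) p" by blast
    have p: "p \<notin> \<Omega>" using A(3) by blast
    obtain Y where Y: "compact Y" "Y \<subseteq> \<Omega>" "bounded (connected_component_set (- Y) p)"
      using separating_compact[OF \<Omega>(1) p refl A(4) q] by blast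
    show ?thesis
    proof (rule that[OF Y(1,2)])
      fix A' p' assume "A' \<in> components (- E)" "\<not> bounded A'"
      then have "A' = A" using uniq A by blast
      then show "\<exists>p\<in>A' - \<Omega>. bounded (connected_component_set (- Y) p)" using A(3) Y(3) by blast
    qed
  next
    case False
    show ?thesis by (rule that[of "{}"]) (use False in auto)
  qed
  define Z where "Z = E \<union> Y \<union> (\<Union>A\<in>holes E. X A)"
  have "compact Z" unfolding Z_def using cE(1) Y(1) X(1) finite_holes[OF E \<Omega>(1)] by (intro compact_Un compact_UN) auto
  moreover have "Z \<subseteq> \<Omega>" unfolding Z_def using cE(2) Y(2) X(2) by blast
  ultimately obtain K where K: "convex_compact_in \<Omega> K" "connected K" "Z \<subseteq> K" "K \<noteq> {}"
    using connected_convex_hull_in[OF \<Omega>] by metis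
  show ?thesis
  proof (rule that[OF K(1,2) _ K(4)])
    show "E \<subseteq> K" using K(3) by (auto simp: Z_def)
    fix A p assume "A \<in> components (- E)" "\<not> bounded A" "p \<in> A - \<Omega>" "bounded (connected_component_set (- \<Omega>) p)"
    from Y(3)[OF this] obtain p' where "p' \<in> A - \<Omega>" "bounded (connected_component_set (- Y) p')" by blast
    moreover have "Y \<subseteq> K" using K(3) by (auto simp: Z_def)
    ultimately show "\<exists>p\<in>A - \<Omega>. bounded (connected_component_set (- K) p)"
      using bounded_component_antimono by blast
  next
    fix A p q assume A: "A \<in> holes E" and "p \<in> A - \<Omega>" "q \<in> A - \<Omega>" "\<not> connected_component (- \<Omega>) p q"
    then obtain p' q' where "p' \<in> A - \<Omega>" "q' \<in> A - \<Omega>" "\<not> connected_component (- X A) p' q'"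
      using X(3)[OF A] by blast
    moreover have "X A \<subseteq> K" using K(3) A by (auto simp: Z_def)
    ultimately show "\<exists>p\<in>A - \<Omega>. \<exists>q\<in>A - \<Omega>. \<not> connected_component (- K) p q"
      using separated_antimono by blast
  qed
qed

text \<open>Only the region \<open>A \<inter> B\<close> between \<open>E\<close> and \<open>L\<close> can be a hole of the union inside \<open>\<Omega>\<close>. Two holes \<open>D1\<close>, \<open>D2\<close> of \<open>L\<close> contain
points outside \<open>\<Omega>\<close>, and every complementary component of \<open>L\<close> other than \<open>B\<close> lies in \<open>A\<close>. So if \<open>A\<close> is
bounded, \<open>A - \<Omega>\<close> meets two components of the complement of \<open>\<Omega>\<close>, and \<open>K\<close> separates two points of \<open>A - \<Omega>\<close>. As \<open>L\<close> lies in a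
single component of the complement of \<open>K\<close>, one of these points is in another component, which together with \<open>K\<close> is
connected and disjoint from \<open>L\<close>; so this point is in \<open>B\<close>. If \<open>A\<close> is unbounded and \<open>B\<close> bounded, a point of \<open>A - \<Omega>\<close>
surrounded by \<open>K\<close> plays the same role: \<open>L\<close> cannot lie in the hole of \<open>K\<close> containing it, since then \<open>L\<close> would not
surround \<open>E\<close>.\<close>

lemma convex_union_of_distant_continua:
  fixes \<Omega> :: "complex set"
  assumes E: "convex_compact_in \<Omega> E" "connected E" "E \<noteq> {}"
    and L: "convex_compact_in \<Omega> L" "connected L"
    and K: "connected K" "compact K" "E \<subseteq> K" "K \<inter> L = {}" "K \<subseteq> \<Omega>"
    and D: "D1 \<in> holes L" "D2 \<in> holes L" "D1 \<noteq> D2"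
    and sep: "\<And>A p q. A \<in> holes E \<Longrightarrow> p \<in> A - \<Omega> \<Longrightarrow> q \<in> A - \<Omega> \<Longrightarrow> \<not> connected_component (- \<Omega>) p q \<Longrightarrow>
        \<exists>p\<in>A - \<Omega>. \<exists>q\<in>A - \<Omega>. \<not> connected_component (- K) p q"
    and bnd: "\<And>A p. A \<in> components (- E) \<Longrightarrow> \<not> bounded A \<Longrightarrow> p \<in> A - \<Omega> \<Longrightarrow> bounded (connected_component_set (- \<Omega>) p) \<Longrightarrow>
        \<exists>p\<in>A - \<Omega>. bounded (connected_component_set (- K) p)"
  shows "convex_compact_in \<Omega> (E \<union> L)"
proof -
  have cE: "compact E" "E \<subseteq> \<Omega>" "\<And>C. C \<in> holes E \<Longrightarrow> \<exists>z\<in>C. z \<notin> \<Omega>"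
    using E(1) by (auto simp: convex_compact_in_def)
  have cL: "compact L" "L \<subseteq> \<Omega>" "\<And>C. C \<in> holes L \<Longrightarrow> \<exists>z\<in>C. z \<notin> \<Omega>"
    using L(1) by (auto simp: convex_compact_in_def)
  have cK: "closed K" using K(2) compact_imp_closed by blast
  have D': "D1 \<in> components (- L)" "bounded D1" "D2 \<in> components (- L)" "bounded D2"
    using D by (auto simp: holes_def)
  have Lne: "L \<noteq> {}"
  proof
    assume "L = {}"
    then have "D1 = UNIV" using D'(1) by (simp add: components_eq_sing_iff[THEN iffD2])
    then show False using D'(2) not_bounded_UNIV by blast
  qed
  obtain A B where AB: "disjoint_continua E L A B"
    using disjoint_continua_exist[OF cE(1) E(2,3) cL(1) L(2) Lne] K(3,4) by blast
  interpret disjoint_continua E L A B by (rule AB)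
  obtain p1 p2 where p: "p1 \<in> D1" "p1 \<notin> \<Omega>" "p2 \<in> D2" "p2 \<notin> \<Omega>" using cL(3) D by blast
  \<comment> \<open>What \<open>K\<close> encloses without \<open>L\<close> cannot be cut off from \<open>E\<close> by \<open>L\<close>.\<close>
  have away: "Q \<subseteq> B" if Q: "Q \<in> components (- K)" "Q \<inter> L = {}" for Q
  proof -
    have "connected (K \<union> Q)" by (rule connected_Un_complement_component[OF K(1) cK Q(1)])
    moreover have "(K \<union> Q) \<inter> L = {}" using K(4) Q(2) by blast
    moreover have "(K \<union> Q) \<inter> B \<noteq> {}" using K(3) B(2) E(3) by blast
    ultimately have "K \<union> Q \<subseteq> B" using connected_in_component[OF _ _ B(1)] by blast
    then show ?thesis by blast
  qed
  obtain l where l: "l \<in> L" using Lne by blast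
  obtain A2 where A2: "A2 \<in> components (- K)" "l \<in> A2" using component_containing[of l K] l K(4) by blast
  have LA2: "L \<subseteq> A2" by (rule connected_in_component[OF L(2) _ A2(1)]) (use K(4) l A2 in blast)+
  have away': "Q \<subseteq> B" if "Q \<in> components (- K)" "Q \<noteq> A2" for Q
  proof (rule away[OF that(1)])
    show "Q \<inter> L = {}" using that A2(1) LA2 components_nonoverlap by blast
  qed
  have between: "\<exists>z\<in>A \<inter> B. z \<notin> \<Omega>" if bAB: "bounded (A \<inter> B)"
  proof (cases "bounded A")
    case True
    then have "\<not> bounded B" by (rule bounded_imp_unbounded)
    then have "D1 \<noteq> B" "D2 \<noteq> B" using D' by blast+
    then have "D1 \<subseteq> A" "D2 \<subseteq> A" using other_component_subset D' by blast+
    then have pA: "p1 \<in> A - \<Omega>" "p2 \<in> A - \<Omega>" using p by blast+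
    have "\<not> connected_component (- \<Omega>) p1 p2"
    proof
      assume "connected_component (- \<Omega>) p1 p2"
      then have "connected_component (- L) p1 p2" using separated_antimono[OF cL(2)] by blast
      then have "p2 \<in> D1" using connected_component_iff_component[OF D'(1) p(1)] by blast
      then show False using p(3) D(3) D'(1,3) components_nonoverlap by blast
    qed
    moreover have "A \<in> holes E" using A(1) True by (simp add: holes_def)
    ultimately obtain x y where xy: "x \<in> A - \<Omega>" "y \<in> A - \<Omega>" "\<not> connected_component (- K) x y"
      using sep pA by blast
    obtain Qx where Qx: "Qx \<in> components (- K)" "x \<in> Qx" using component_containing[of x K] xy(1) K(5) by blast
    obtain Qy where Qy: "Qy \<in> components (- K)" "y \<in> Qy" using component_containing[of y K] xy(2) K(5) by blast
    have "y \<notin> Qx" using connected_component_iff_component[OF Qx] xy(3) by blast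
    then have "Qx \<noteq> A2 \<or> Qy \<noteq> A2" using Qy(2) by blast
    then have "x \<in> B \<or> y \<in> B" using away' Qx Qy by blast
    then show ?thesis using xy(1,2) by blast
  next
    case False
    then have bB: "bounded B" using unbounded_between bAB by blast
    obtain D0 p0 where D0: "D0 \<in> components (- L)" "bounded D0" "D0 \<noteq> B" "p0 \<in> D0" "p0 \<notin> \<Omega>"
      using D D' p by metis
    then have pA: "p0 \<in> A - \<Omega>" using other_component_subset by blast
    have "connected_component_set (- \<Omega>) p0 \<subseteq> D0"
    proof (rule connected_in_component[OF _ _ D0(1)])
      show "connected_component_set (- \<Omega>) p0 \<inter> L = {}" using cL(2) connected_component_subset[of "- \<Omega>" p0] by blast
      have "p0 \<in> connected_component_set (- \<Omega>) p0" using D0(5) by simp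
      then show "connected_component_set (- \<Omega>) p0 \<inter> D0 \<noteq> {}" using D0(4) by blast
    qed simp
    then have "bounded (connected_component_set (- \<Omega>) p0)" using D0(2) bounded_subset by blast
    then obtain x where x: "x \<in> A - \<Omega>" "bounded (connected_component_set (- K) x)"
      using bnd[OF A(1) False pA] by blast
    obtain Q where Q: "Q \<in> components (- K)" "x \<in> Q" using component_containing[of x K] x(1) K(5) by blast
    have "Q \<noteq> A2"
    proof
      assume "Q = A2"
      have "connected_component_set (- K) x = Q"
        using connected_component_iff_component[OF Q] by blast
      then have bQ: "bounded Q" using x(2) by simp
      have "connected (- Q)" by (rule component_complement_connected[OF K(1) Q(1)])
      moreover have "- Q \<inter> L = {}" using LA2 \<open>Q = A2\<close> by blast
      moreover have "- Q \<inter> B \<noteq> {}" using component_disjoint[OF Q(1)] K(3) B(2) E(3) by blast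
      ultimately have "- Q \<subseteq> B" using connected_in_component[OF _ _ B(1)] by blast
      then have "bounded (- Q)" using bB bounded_subset by blast
      then show False using bQ cobounded_imp_unbounded by blast
    qed
    then show ?thesis using away'[OF Q(1)] Q(2) x(1) by blast
  qed
  show ?thesis
    unfolding convex_compact_in_def
  proof (intro conjI ballI)
    show "compact (E \<union> L)" using cE(1) cL(1) by (rule compact_Un)
    show "E \<union> L \<subseteq> \<Omega>" using cE(2) cL(2) by blast
    fix C assume "C \<in> holes (E \<union> L)"
    then have C: "C \<in> components (- (E \<union> L))" "bounded C" by (auto simp: holes_def)
    from component_cases[OF C(1)] show "\<exists>z\<in>C. z \<notin> \<Omega>"
      using cE(3) cL(3) between C(2) by (auto simp: holes_def)
  qed
qed

section \<open>The three conditions are equivalent\<close>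

lemma convex_map_on_funpow:
  assumes "convex_map_on \<Omega> \<psi>" "convex_compact_in \<Omega> K"
  shows "convex_compact_in \<Omega> ((\<psi> ^^ n) ` K)"
proof (induction n)
  case (Suc n)
  have "(\<psi> ^^ Suc n) ` K = \<psi> ` (\<psi> ^^ n) ` K" by (simp add: image_image)
  then show ?case using assms(1) Suc unfolding convex_map_on_def by simp
qed (use assms(2) in simp)

lemma continuum_with_two_holes:
  fixes \<Omega> :: "complex set"
  assumes \<Omega>: "open \<Omega>" "connected \<Omega>" "\<Omega> \<noteq> {}" and C: "C1 \<in> holes \<Omega>" "C2 \<in> holes \<Omega>" "C1 \<noteq> C2"
    and K: "compact K" "K \<subseteq> \<Omega>"
  obtains E D1 D2 where "convex_compact_in \<Omega> E" "connected E" "K \<subseteq> E" "E \<noteq> {}"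
    "D1 \<in> holes E" "D2 \<in> holes E" "D1 \<noteq> D2"
proof -
  have C': "C1 \<in> components (- \<Omega>)" "bounded C1" "C2 \<in> components (- \<Omega>)" "bounded C2"
    using C by (auto simp: holes_def)
  obtain p1 where p1: "p1 \<in> C1" using C'(1) in_components_nonempty by blast
  obtain p2 where p2: "p2 \<in> C2" using C'(3) in_components_nonempty by blast
  have pO: "p1 \<notin> \<Omega>" "p2 \<notin> \<Omega>" using p1 p2 C'(1,3) in_components_subset by blast+
  have disj: "p1 \<notin> C2" "p2 \<notin> C1" using p1 p2 C(3) C'(1,3) components_nonoverlap by blast+
  have cc: "C1 = connected_component_set (- \<Omega>) p1" "C2 = connected_component_set (- \<Omega>) p2"
    using connected_component_iff_component[OF C'(1) p1] connected_component_iff_component[OF C'(3) p2] by blast+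
  obtain X1 where X1: "compact X1" "X1 \<subseteq> \<Omega>" "bounded (connected_component_set (- X1) p1)"
    "\<not> connected_component (- X1) p1 p2"
    using separating_compact[OF \<Omega>(1) pO(1) cc(1) C'(2) disj(2)] by blast
  obtain X2 where X2: "compact X2" "X2 \<subseteq> \<Omega>" "bounded (connected_component_set (- X2) p2)"
    using separating_compact[OF \<Omega>(1) pO(2) cc(2) C'(4) disj(1)] by blast
  have "compact (K \<union> X1 \<union> X2)" "K \<union> X1 \<union> X2 \<subseteq> \<Omega>" using K X1 X2 by (auto intro: compact_Un)
  then obtain E where E: "convex_compact_in \<Omega> E" "connected E" "K \<union> X1 \<union> X2 \<subseteq> E" "E \<noteq> {}"
    using connected_convex_hull_in[OF \<Omega>] by metis
  have EO: "E \<subseteq> \<Omega>" using E(1) by (simp add: convex_compact_in_def)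
  show ?thesis
  proof (rule that[OF E(1,2) _ E(4)])
    show "K \<subseteq> E" using E(3) by blast
    show "connected_component_set (- E) p1 \<in> holes E"
      using bounded_component_antimono[of X1 E p1] X1(3) E(3) EO pO(1) by (auto simp: holes_def components_def)
    show "connected_component_set (- E) p2 \<in> holes E"
      using bounded_component_antimono[of X2 E p2] X2(3) E(3) EO pO(2) by (auto simp: holes_def components_def)
    have "\<not> connected_component (- E) p1 p2" using separated_antimono[of X1 E p1 p2] X1(4) E(3) by blast
    moreover have "connected_component (- E) p2 p2" using EO pO(2) by auto
    ultimately show "connected_component_set (- E) p1 \<noteq> connected_component_set (- E) p2" by blast
  qed
qed

text \<open>The function to be approximated is \<open>g\<close> near \<open>E\<close> and \<open>(h / \<omega>\<^sub>n) \<circ> \<psi>\<^sub>n\<^sup>-\<^sup>1\<close> near \<open>\<psi>\<^sub>n(E)\<close>; the latter is what makes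
\<open>T\<^sup>n f\<close> close to \<open>h\<close> on \<open>E\<close>.\<close>

lemma univalent_convex_run_away_imp_mixing:
  fixes \<Omega> :: "complex set"
  assumes \<Omega>: "open \<Omega>" "connected \<Omega>" "\<Omega> \<noteq> {}" and C: "C1 \<in> holes \<Omega>" "C2 \<in> holes \<Omega>" "C1 \<noteq> C2"
    and hol: "\<omega> holomorphic_on \<Omega>" "\<psi> holomorphic_on \<Omega>" "\<psi> \<in> \<Omega> \<rightarrow> \<Omega>"
    and nz: "\<And>z. z \<in> \<Omega> \<Longrightarrow> \<omega> z \<noteq> 0" and inj: "inj_on \<psi> \<Omega>"
    and conv: "convex_map_on \<Omega> \<psi>" and run: "strongly_run_away_on \<Omega> \<psi>"
    and g: "g \<in> holo_funs \<Omega>" and h: "h \<in> holo_funs \<Omega>" and K: "compact K" "K \<subseteq> \<Omega>" and e: "0 < (e::real)"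
  shows "\<exists>N. \<forall>n\<ge>N. \<exists>f\<in>holo_funs \<Omega>. (\<forall>z\<in>K. cmod (f z - g z) < e) \<and>
             (\<forall>z\<in>K. cmod ((weighted_comp \<Omega> \<omega> \<psi> ^^ n) f z - h z) < e)"
proof -
  obtain E D1 D2 where E: "convex_compact_in \<Omega> E" "connected E" "K \<subseteq> E" "E \<noteq> {}"
    and D: "D1 \<in> holes E" "D2 \<in> holes E" "D1 \<noteq> D2"
    using continuum_with_two_holes[OF \<Omega> C K] by metis
  have cE: "compact E" "E \<subseteq> \<Omega>" using E(1) by (auto simp: convex_compact_in_def)
  obtain K' where K': "convex_compact_in \<Omega> K'" "connected K'" "E \<subseteq> K'"
    and sep: "\<And>A p q. A \<in> holes E \<Longrightarrow> p \<in> A - \<Omega> \<Longrightarrow> q \<in> A - \<Omega> \<Longrightarrow> \<not> connected_component (- \<Omega>) p q \<Longrightarrow>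
        \<exists>p\<in>A - \<Omega>. \<exists>q\<in>A - \<Omega>. \<not> connected_component (- K') p q"
    and bnd: "\<And>A p. A \<in> components (- E) \<Longrightarrow> \<not> bounded A \<Longrightarrow> p \<in> A - \<Omega> \<Longrightarrow> bounded (connected_component_set (- \<Omega>) p) \<Longrightarrow>
        \<exists>p\<in>A - \<Omega>. bounded (connected_component_set (- K') p)"
    using separating_continuum[OF \<Omega> E(1)] by metis
  have cK': "compact K'" "K' \<subseteq> \<Omega>" using K'(1) by (auto simp: convex_compact_in_def)
  obtain N where N: "\<And>n. n \<ge> N \<Longrightarrow> (\<psi> ^^ n) ` K' \<inter> K' = {}"
    using run cK' unfolding strongly_run_away_on_def eventually_sequentially by metis
  show ?thesis
  proof (intro exI[of _ N] allI impI)
    fix n assume n: "n \<ge> N"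
    define \<phi> where "\<phi> = \<psi> ^^ n"
    define w where "w z = (\<Prod>j<n. \<omega> ((\<psi> ^^ j) z))" for z
    have \<phi>: "\<phi> holomorphic_on \<Omega>" "inj_on \<phi> \<Omega>" "\<And>z. z \<in> \<Omega> \<Longrightarrow> \<phi> z \<in> \<Omega>"
      unfolding \<phi>_def using funpow_holomorphic[OF hol(2,3)] funpow_inj_on[OF inj hol(3)] funpow_in[OF hol(3)] by auto
    have "(\<omega> \<circ> (\<psi> ^^ j)) holomorphic_on \<Omega>" for j
      by (rule holomorphic_on_compose_gen[OF funpow_holomorphic[OF hol(2,3)] hol(1)]) (use funpow_in[OF hol(3)] in auto)
    then have w: "w holomorphic_on \<Omega>" unfolding w_def by (intro holomorphic_intros) (simp add: o_def)
    have wnz: "w z \<noteq> 0" if "z \<in> \<Omega>" for z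
      using nz funpow_in[OF hol(3) that] by (simp add: w_def)
    have c\<phi>: "continuous_on E \<phi>"
      using continuous_on_subset[OF holomorphic_on_imp_continuous_on[OF \<phi>(1)] cE(2)] .
    define L where "L = \<phi> ` E"
    have L: "convex_compact_in \<Omega> L" "connected L"
      using convex_map_on_funpow[OF conv E(1)] connected_continuous_image[OF c\<phi> E(2)] by (simp_all add: L_def \<phi>_def)
    have cL: "compact L" "L \<subseteq> \<Omega>" using L(1) by (auto simp: convex_compact_in_def)
    have KL: "K' \<inter> L = {}" using N[OF n] K'(3) unfolding L_def \<phi>_def by blast
    obtain B1 B2 where B: "B1 \<in> holes L" "B2 \<in> holes L" "B1 \<noteq> B2"
      using two_holes_preserved[OF cE(1) c\<phi> inj_on_subset[OF \<phi>(2) cE(2)], of D1 D2] D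
      unfolding L_def holes_def by blast
    have M: "convex_compact_in \<Omega> (E \<union> L)"
      by (rule convex_union_of_distant_continua[OF E(1,2,4) L K'(2) cK'(1) K'(3) KL cK'(2) B sep bnd])
    obtain \<theta> where \<theta>: "\<theta> holomorphic_on \<phi> ` \<Omega>" "\<And>z. z \<in> \<Omega> \<Longrightarrow> \<theta> (\<phi> z) = z"
      using holomorphic_has_inverse[OF \<phi>(1) \<Omega>(1) \<phi>(2)] by metis
    have op: "open (\<phi> ` \<Omega>)" by (rule open_mapping_thm3[OF \<phi>(1) \<Omega>(1) \<phi>(2)])
    have "E \<inter> L = {}" using KL K'(3) by blast
    then obtain U1 U2 where U: "open U1" "open U2" "E \<subseteq> U1" "L \<subseteq> U2" "U1 \<inter> U2 = {}"
      using separation_normal_compact[OF cE(1) compact_imp_closed[OF cL(1)]] by metis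
    define f where "f x = (if x \<in> U1 then g x else h (\<theta> x) / w (\<theta> x))" for x
    define U where "U = (U1 \<inter> \<Omega>) \<union> (U2 \<inter> \<phi> ` \<Omega>)"
    have "f holomorphic_on U"
      unfolding U_def
    proof (rule holomorphic_on_Un)
      show "f holomorphic_on U1 \<inter> \<Omega>"
        by (rule holomorphic_transform[OF holomorphic_on_subset[OF holo_funs_holomorphic[OF g]]]) (auto simp: f_def)
      have im: "\<theta> ` (\<phi> ` \<Omega>) \<subseteq> \<Omega>" using \<theta>(2) by auto
      have "(\<lambda>x. (h \<circ> \<theta>) x / (w \<circ> \<theta>) x) holomorphic_on \<phi> ` \<Omega>"
      proof (rule holomorphic_on_divide)
        show "(h \<circ> \<theta>) holomorphic_on \<phi> ` \<Omega>"
          by (rule holomorphic_on_compose_gen[OF \<theta>(1) holo_funs_holomorphic[OF h] im])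
        show "(w \<circ> \<theta>) holomorphic_on \<phi> ` \<Omega>"
          by (rule holomorphic_on_compose_gen[OF \<theta>(1) w im])
      qed (use wnz im in auto)
      then show "f holomorphic_on U2 \<inter> \<phi> ` \<Omega>"
        by (rule holomorphic_transform[OF holomorphic_on_subset]) (use U(5) in \<open>auto simp: f_def\<close>)
    qed (use U \<Omega>(1) op in auto)
    moreover have "open U" unfolding U_def using U(1,2) \<Omega>(1) op by blast
    moreover have "E \<union> L \<subseteq> U"
      unfolding U_def using U(3,4) cE(2) by (auto simp: L_def)
    ultimately have appr: "approximable \<Omega> (E \<union> L) f" using runge_approximation[OF M] by blast
    have "compact (w ` E)"
      using compact_continuous_image[OF continuous_on_subset[OF holomorphic_on_imp_continuous_on[OF w] cE(2)] cE(1)] .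
    then obtain B where Bd: "B > 0" "\<And>z. z \<in> E \<Longrightarrow> cmod (w z) \<le> B"
      using compact_imp_bounded bounded_pos by (metis (no_types, lifting) imageI)
    \<comment> \<open>The factor \<open>\<omega>\<^sub>n\<close>, bounded by \<open>B\<close> on \<open>E\<close>, multiplies the error on \<open>\<psi>\<^sub>n(E)\<close>.\<close>
    define \<delta> where "\<delta> = min e (e / B)"
    have \<delta>: "\<delta> > 0" "\<delta> \<le> e" "\<delta> \<le> e / B" using e Bd(1) by (simp_all add: \<delta>_def)
    obtain F where F: "F holomorphic_on \<Omega>" "\<And>z. z \<in> E \<union> L \<Longrightarrow> cmod (F z - f z) < \<delta>"
      using appr \<delta>(1) unfolding approximable_def by blast
    define F0 where "F0 z = (if z \<in> \<Omega> then F z else 0)" for z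
    have "F0 \<in> holo_funs \<Omega>" unfolding F0_def by (rule holo_funs_cut[OF F(1)])
    moreover have "cmod (F0 z - g z) < e" if "z \<in> K" for z
    proof -
      have "z \<in> E" using that E(3) by blast
      then have "z \<in> \<Omega>" "z \<in> U1" using cE(2) U(3) by blast+
      then show ?thesis using F(2)[of z] \<open>z \<in> E\<close> \<delta>(2) by (simp add: F0_def f_def)
    qed
    moreover have "cmod ((weighted_comp \<Omega> \<omega> \<psi> ^^ n) F0 z - h z) < e" if "z \<in> K" for z
    proof -
      have zE: "z \<in> E" using that E(3) by blast
      then have zO: "z \<in> \<Omega>" using cE(2) by blast
      have "\<phi> z \<in> L" using zE by (simp add: L_def)
      then have "\<phi> z \<notin> U1" using U(4,5) by blast
      then have "f (\<phi> z) = h z / w z" by (simp add: f_def \<theta>(2)[OF zO])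
      then have less: "cmod (F (\<phi> z) - h z / w z) < \<delta>" using F(2)[of "\<phi> z"] \<open>\<phi> z \<in> L\<close> by simp
      have "(weighted_comp \<Omega> \<omega> \<psi> ^^ n) F0 z = w z * F (\<phi> z)"
        using weighted_comp_funpow[OF hol(3) zO] \<phi>(3)[OF zO] by (simp add: w_def \<phi>_def F0_def)
      then have "(weighted_comp \<Omega> \<omega> \<psi> ^^ n) F0 z - h z = w z * (F (\<phi> z) - h z / w z)"
        using wnz[OF zO] by (simp add: right_diff_distrib)
      then have "cmod ((weighted_comp \<Omega> \<omega> \<psi> ^^ n) F0 z - h z) = cmod (w z) * cmod (F (\<phi> z) - h z / w z)"
        by (simp add: norm_mult)
      also have "\<dots> \<le> B * cmod (F (\<phi> z) - h z / w z)" using Bd(2)[OF zE] by (intro mult_right_mono) auto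
      also have "\<dots> < B * \<delta>" using less Bd(1) by (intro mult_strict_left_mono)
      also have "\<dots> \<le> e" using \<delta>(3) Bd(1) by (simp add: field_simps)
      finally show ?thesis .
    qed
    ultimately show "\<exists>f\<in>holo_funs \<Omega>. (\<forall>z\<in>K. cmod (f z - g z) < e) \<and>
             (\<forall>z\<in>K. cmod ((weighted_comp \<Omega> \<omega> \<psi> ^^ n) f z - h z) < e)" by blast
  qed
qed

theorem theorem1p6:
  fixes \<Omega> :: "complex set" and \<omega> \<psi> :: "complex \<Rightarrow> complex"
  assumes "open \<Omega>" and "connected \<Omega>" and "\<Omega> \<noteq> {}"
    and "infinitely_connected \<Omega>"
    and "\<omega> holomorphic_on \<Omega>"
    and "\<psi> holomorphic_on \<Omega>" and "\<psi> \<in> \<Omega> \<rightarrow> \<Omega>"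
  shows "(supercyclic_on (holo_space \<Omega>) (weighted_comp \<Omega> \<omega> \<psi>)
            \<longleftrightarrow> mixing_on (holo_space \<Omega>) (weighted_comp \<Omega> \<omega> \<psi>))
       \<and> (mixing_on (holo_space \<Omega>) (weighted_comp \<Omega> \<omega> \<psi>)
            \<longleftrightarrow> (\<forall>z \<in> \<Omega>. \<omega> z \<noteq> 0) \<and> univalent_on \<Omega> \<psi> \<and> convex_map_on \<Omega> \<psi>
                \<and> strongly_run_away_on \<Omega> \<psi>)"
proof -
  let ?T = "weighted_comp \<Omega> \<omega> \<psi>"
  note \<Omega> = assms(1-3) and hol = assms(5-7)
  obtain C1 C2 where C: "C1 \<in> holes \<Omega>" "C2 \<in> holes \<Omega>" "C1 \<noteq> C2"
  proof -
    have inf: "infinite (holes \<Omega>)" using assms(4) by (simp add: infinitely_connected_def)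
    then obtain C1 where C1: "C1 \<in> holes \<Omega>" using infinite_imp_nonempty by blast
    have "infinite (holes \<Omega> - {C1})" using inf by simp
    then obtain C2 where "C2 \<in> holes \<Omega> - {C1}" using infinite_imp_nonempty by blast
    then show ?thesis using that C1 by blast
  qed
  have C': "C1 \<in> components (- \<Omega>)" "C2 \<in> components (- \<Omega>)" using C by (auto simp: holes_def)
  obtain a where a: "a \<in> C1" using C'(1) in_components_nonempty by blast
  obtain b where b: "b \<in> C2" using C'(2) in_components_nonempty by blast
  have "C1 \<inter> C2 = {}" using components_nonoverlap[OF C'] C(3) by simp
  then have ab: "a \<noteq> b" "a \<notin> \<Omega>" "b \<notin> \<Omega>"
    using a b component_disjoint[OF C'(1)] component_disjoint[OF C'(2)] by auto
  have TH: "(?T ^^ n) f \<in> holo_funs \<Omega>" if "f \<in> holo_funs \<Omega>" for n f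
    by (rule weighted_comp_funpow_holo_funs[OF hol that])
  have lin: "\<forall>f\<in>holo_funs \<Omega>. \<forall>c n. (\<lambda>z. c * (?T ^^ n) f z) \<in> holo_funs \<Omega>"
    using TH by (auto simp: holo_funs_def intro!: holomorphic_intros)
  have self: "?T \<in> holo_funs \<Omega> \<rightarrow> holo_funs \<Omega>"
    using weighted_comp_in_holo_funs[OF hol] by blast
  note super_iff = supercyclic_on_holo_space_iff[OF \<Omega>(1) lin]
  note mix_iff = mixing_on_holo_space_iff[OF \<Omega>(1) self]
  have "supercyclic_on (holo_space \<Omega>) ?T" if mix: "mixing_on (holo_space \<Omega>) ?T"
  proof -
    have "\<exists>f\<in>holo_funs \<Omega>. \<forall>g\<in>holo_funs \<Omega>. \<forall>K e. compact K \<and> K \<subseteq> \<Omega> \<and> 0 < e \<longrightarrow>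
       (\<exists>n. \<forall>z\<in>K. cmod ((?T ^^ n) f z - g z) < e)"
    proof (rule birkhoff_transitivity[OF \<Omega>(1)])
      fix n f K and e :: real assume "compact K" "K \<subseteq> \<Omega>" "0 < e"
      then show "\<exists>L d. compact L \<and> L \<subseteq> \<Omega> \<and> 0 < d \<and>
         (\<forall>g\<in>holo_funs \<Omega>. (\<forall>z\<in>L. cmod (g z - f z) < d) \<longrightarrow> (\<forall>z\<in>K. cmod ((?T ^^ n) g z - (?T ^^ n) f z) < e))"
        by (rule weighted_comp_funpow_continuous[OF \<Omega>(1) hol])
    next
      fix g h K and e :: real
      assume gh: "g \<in> holo_funs \<Omega>" "h \<in> holo_funs \<Omega>" and K: "compact K" "K \<subseteq> \<Omega>" "0 < e"
      obtain N where "\<forall>n\<ge>N. \<exists>f\<in>holo_funs \<Omega>. (\<forall>z\<in>K. cmod (f z - g z) < e) \<and> (\<forall>z\<in>K. cmod ((?T ^^ n) f z - h z) < e)"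
        using bspec[OF bspec[OF mix[unfolded mix_iff] gh(1)] gh(2), rule_format, of K e] K by auto
      then show "\<exists>n. \<exists>f\<in>holo_funs \<Omega>. (\<forall>z\<in>K. cmod (f z - g z) < e) \<and> (\<forall>z\<in>K. cmod ((?T ^^ n) f z - h z) < e)"
        by (intro exI[of _ N]) simp
    qed
    then obtain f where f: "f \<in> holo_funs \<Omega>" and
      dense: "\<forall>g\<in>holo_funs \<Omega>. \<forall>K e. compact K \<and> K \<subseteq> \<Omega> \<and> 0 < e \<longrightarrow> (\<exists>n. \<forall>z\<in>K. cmod ((?T ^^ n) f z - g z) < e)"
      ..
    show ?thesis
      unfolding super_iff
    proof (rule bexI[OF _ f], intro ballI allI impI)
      fix g K and e :: real assume g: "g \<in> holo_funs \<Omega>" and K: "compact K \<and> K \<subseteq> \<Omega> \<and> 0 < e"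
      obtain n where "\<forall>z\<in>K. cmod ((?T ^^ n) f z - g z) < e"
        using bspec[OF dense g, rule_format, OF K] by auto
      then show "\<exists>c n. \<forall>z\<in>K. cmod (c * (?T ^^ n) f z - g z) < e"
        by (intro exI[of _ 1] exI[of _ n]) simp
    qed
  qed
  moreover have "(\<forall>z \<in> \<Omega>. \<omega> z \<noteq> 0) \<and> univalent_on \<Omega> \<psi> \<and> convex_map_on \<Omega> \<psi> \<and> strongly_run_away_on \<Omega> \<psi>"
    if super: "supercyclic_on (holo_space \<Omega>) ?T"
  proof -
    obtain f where f: "f \<in> holo_funs \<Omega>" and
      dense': "\<forall>g\<in>holo_funs \<Omega>. \<forall>K e. compact K \<and> K \<subseteq> \<Omega> \<and> 0 < e \<longrightarrow> (\<exists>c n. \<forall>z\<in>K. cmod (c * (?T ^^ n) f z - g z) < e)"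
      using super[unfolded super_iff] ..
    have dense: "\<exists>c n. \<forall>z\<in>K. cmod (c * (?T ^^ n) f z - g z) < e"
      if "g \<in> holo_funs \<Omega>" "compact K" "K \<subseteq> \<Omega>" "0 < e" for g K e
      using bspec[OF dense' that(1), rule_format, of K e] that by simp
    note range = supercyclic_dense_range[OF \<Omega>(1,3) hol f dense]
    have nz: "\<omega> z \<noteq> 0" if "z \<in> \<Omega>" for z by (rule dense_range_zero_free[OF range that])
    have inj: "inj_on \<psi> \<Omega>" by (rule dense_range_inj[OF range])
    note range' = dense_range_unweighted[OF hol(1) range]
    have "convex_map_on \<Omega> \<psi>" by (rule dense_range_convex[OF \<Omega>(1) hol(2,3) inj range'])
    moreover have "strongly_run_away_on \<Omega> \<psi>"
      by (rule supercyclic_imp_strongly_run_away[OF \<Omega> hol ab nz f dense])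
    ultimately show ?thesis using nz inj hol(2) by (simp add: univalent_on_def)
  qed
  moreover have "mixing_on (holo_space \<Omega>) ?T"
    if "(\<forall>z \<in> \<Omega>. \<omega> z \<noteq> 0) \<and> univalent_on \<Omega> \<psi> \<and> convex_map_on \<Omega> \<psi> \<and> strongly_run_away_on \<Omega> \<psi>"
    unfolding mix_iff
  proof (intro ballI allI impI)
    fix g h K and e :: real
    assume gh: "g \<in> holo_funs \<Omega>" "h \<in> holo_funs \<Omega>" and K: "compact K \<and> K \<subseteq> \<Omega> \<and> 0 < e"
    show "\<exists>N. \<forall>n\<ge>N. \<exists>f\<in>holo_funs \<Omega>. (\<forall>z\<in>K. cmod (f z - g z) < e) \<and> (\<forall>z\<in>K. cmod ((?T ^^ n) f z - h z) < e)"
      by (rule univalent_convex_run_away_imp_mixing[OF \<Omega> C hol])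
        (use that gh K in \<open>auto simp: univalent_on_def\<close>)
  qed
  ultimately show ?thesis by blast
qed

end
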